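(* Let $F\in\mathcal P_A(P_{\rm avg})$, let $h_+=\max_{0\le r\le L:\,h_r>0}h_r$ and $\Omega=\{z\in\mathbb C:\operatorname{Re}z>-\lambda_0/h_+\}$. For every compact set $K\subset\Omega$, the finite-block derivative functions $$D_{n,F}(z)=\frac1n\left.\frac{d}{d\epsilon}H_{F_\epsilon^{(z)}}(Y_1^n)\right|_{\epsilon=0}$$ are well defined by finite-dimensional analytic continuation and converge, as $n\to\infty$, locally uniformly on $K$ to $$\dot h_{Y,F}^{\rm hol}(z)=\sum_{t=0}^\infty\Delta_t(z),$$ where $\Delta_t(z)$ is the locally uniform limit, as $m\to\infty$, of the finite-history analytic functions $\Delta_{t,m}(z)$. Equivalently, $\Delta_t(z)$ is the analytic continuation of the change in the (expected) baseline information density $\ell_F(Y_t\mid Y_{<t})=-\log P_F(Y_t\mid Y_{<t})$ caused by fixing $X_0=z$, with the baseline log-likelihood kept fixed and only the finite-dimensional measure complexified. Moreover, $$\sum_{t=0}^\infty\sup_{z\in K}|\Delta_t(z)|<\infty .$$ For real $x\in[0,A]$, $\dot h_{Y,F}^{\rm hol}(x)$ equals the directional derivative of the output entropy rate in the direction $\delta_x-F$, i.e. $\left.\frac{d}{d\epsilon}h_{(1-\epsilon)F+\epsilon\delta_x}(\mathbf Y)\right|_{\epsilon=0^+}$.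
   Context: Setting: $L\ge0$ an integer, $\lambda_0>0$, $h_0>0$, $h_\ell\ge0$, $\sum_{\ell=0}^L h_\ell=1$, $0\le A<\infty$, $P_{\rm avg}\ge0$; $\mathcal P_A(P_{\rm avg})$ is the set of Borel probability measures on $[0,A]$ with mean at most $P_{\rm avg}$. For a probability law $F$ on $[0,A]$, $P_F,\mathbb E_F,H_F$ refer to the stationary process with $(X_k)_{k\in\mathbb Z}$ i.i.d. of law $F$ and, given the inputs, conditionally independent $Y_k\sim\operatorname{Poisson}(\lambda_0+\sum_{\ell=0}^L h_\ell X_{k-\ell})$. The output entropy rate is $h_F(\mathbf Y)=H_F(Y_0\mid Y_{-\infty}^{-1})$. Logarithms are natural; $Y_i^j=(Y_i,\dots,Y_j)$. Complexified laws: fixing an input symbol $X_j=z$ with $z\in\Omega$ means the following. For a finite window of output times, replace $X_j$ by $z$ in all Poisson means $\zeta_s(z)=\lambda_0+\sum_{\ell=0}^L h_\ell X_{s-\ell}$ containing it, replace each affected Poisson kernel by the analytic expression $e^{-\zeta_s(z)}\zeta_s(z)^{y_s}/y_s!$, keep all other input symbols i.i.d. with law $F$, and integrate the product of kernels over those other symbols. This gives a finite complex measure on the output window, which for $z\in[0,A]$ is the ordinary law of the outputs when $X_j$ is fixed to $z$. For the window $Y_1^n$ it is denoted $P_{F,n}^{(j,z)}$; $P_{F,n}$ is the baseline law of $Y_1^n$ under $F$. $F_\epsilon^{(z)}=(1-\epsilon)F+\epsilon\delta_z$; for $z\in\Omega$ the derivative defining $D_{n,F}(z)$ is understood via this analytic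 continuation, i.e. $$D_{n,F}(z)=-\frac1n\sum_{j=1-L}^n\ \sum_{y^n\in\mathbb N_0^n}\bigl[P_{F,n}^{(j,z)}(y^n)-P_{F,n}(y^n)\bigr]\log P_{F,n}(y^n).$$ Finite-history functionals: for $t\ge0$, $m\ge1$, let $\ell_{F,m}(y_t\mid y_{t-m}^{t-1})=-\log P_F(Y_t=y_t\mid Y_{t-m}^{t-1}=y_{t-m}^{t-1})$ (under the stationary baseline law), let $\Lambda_{t,m}^{(z)}$ be the complex measure on the window $Y_{t-m}^t$ obtained by fixing $X_0=z$, i.e. by replacing $X_0$ by $z$ in all Poisson means $\zeta_s(z)=\lambda_0+\sum_{\ell=0}^L h_\ell X_{s-\ell}$, $t-m\le s\le t$, containing it, replacing each affected Poisson kernel by the analytic expression $e^{-\zeta_s(z)}\zeta_s(z)^{y_s}/y_s!$, keeping all other input symbols i.i.d. with law $F$, and integrating the product of the kernels over those other symbols, and $\Lambda_{t,m}^{(F)}$ the baseline law of $Y_{t-m}^t$. Then $$\Delta_{t,m}(z)=\sum_{y_{t-m}^t}\ell_{F,m}(y_t\mid y_{t-m}^{t-1})\bigl[\Lambda_{t,m}^{(z)}-\Lambda_{t,m}^{(F)}\bigr](y_{t-m}^t).$$ *)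

theory Defs
  imports "HOL-Probability.Probability" "HOL-Complex_Analysis.Complex_Analysis"
begin

(* Time is indexed by int, so that windows may start before time 0.  An input law F is a measure
   on the subspace [0,A] of the reals, so every Poisson mean below is at least lam0 > 0. *)

definition input_laws :: "real \<Rightarrow> real \<Rightarrow> real measure set" where
  "input_laws A Pavg =
     {F \<in> space (prob_algebra (restrict_space borel {0..A})). (\<integral>x. x \<partial>F) \<le> Pavg}"

(* The law (1 - e) F + e delta_x; only 0 \<le> e \<le> 1 and x \<in> space F are meaningful. *)
definition mix_dirac :: "real measure \<Rightarrow> real \<Rightarrow> real \<Rightarrow> real measure" where
  "mix_dirac F x e = measure_of (space F) (sets F)
     (\<lambda>S. ennreal (1 - e) * emeasure F S + ennreal e * emeasure (return F x) S)"

definition window :: "int \<Rightarrow> int \<Rightarrow> (int \<Rightarrow> nat) set" where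
  "window a b = (\<Pi>\<^sub>E s\<in>{a..b}. UNIV)"

definition cylinder :: "int set \<Rightarrow> (int \<Rightarrow> nat) \<Rightarrow> (int \<Rightarrow> nat) set" where
  "cylinder S y = {w. \<forall>s\<in>S. w s = y s}"

definition past :: "int \<Rightarrow> (int \<Rightarrow> nat) measure" where
  "past t = vimage_algebra UNIV (\<lambda>w. restrict w {..<t}) (\<Pi>\<^sub>M s\<in>{..<t}. count_space UNIV)"

definition poisson_kernel :: "complex \<Rightarrow> nat \<Rightarrow> complex" where
  "poisson_kernel \<zeta> k = exp (- \<zeta>) * \<zeta> ^ k / fact k"

context
  fixes L :: nat and lam0 :: real and h :: "nat \<Rightarrow> real"
begin

definition h_plus :: real where
  "h_plus = Max {h r | r. r \<le> L \<and> h r > 0}"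

definition Omega :: "complex set" where
  "Omega = {z. Re z > - lam0 / h_plus}"

definition rate :: "(int \<Rightarrow> real) \<Rightarrow> int \<Rightarrow> real" where
  "rate x s = lam0 + (\<Sum>l\<le>L. h l * x (s - int l))"

definition crate :: "(int \<Rightarrow> complex) \<Rightarrow> int \<Rightarrow> complex" where
  "crate x s = of_real lam0 + (\<Sum>l\<le>L. of_real (h l) * x (s - int l))"

definition output_kernel :: "(int \<Rightarrow> real) \<Rightarrow> (int \<Rightarrow> nat) measure" where
  "output_kernel x = (\<Pi>\<^sub>M s\<in>UNIV. measure_pmf (poisson_pmf (rate x s)))"

(* Law of the whole output process under i.i.d. inputs of law F ... *)
definition output_law :: "real measure \<Rightarrow> (int \<Rightarrow> nat) measure" where
  "output_law F = (\<Pi>\<^sub>M k\<in>(UNIV :: int set). F) \<bind> output_kernel"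

(* ... and with the symbol at time j fixed to the real value u. *)
definition output_law_fixed :: "real measure \<Rightarrow> int \<Rightarrow> real \<Rightarrow> (int \<Rightarrow> nat) measure" where
  "output_law_fixed F j u =
     (\<Pi>\<^sub>M k\<in>(UNIV :: int set). F) \<bind> (\<lambda>x. output_kernel (x(j := u)))"

definition block_prob :: "real measure \<Rightarrow> int \<Rightarrow> int \<Rightarrow> (int \<Rightarrow> nat) \<Rightarrow> real" where
  "block_prob F a b y = measure (output_law F) (cylinder {a..b} y)"

definition window_kernel ::
    "int \<Rightarrow> int \<Rightarrow> int \<Rightarrow> complex \<Rightarrow> (int \<Rightarrow> nat) \<Rightarrow> (int \<Rightarrow> real) \<Rightarrow> complex" where
  "window_kernel a b j z y x =
     (\<Prod>s\<in>{a..b}. poisson_kernel (crate ((\<lambda>k. of_real (x k))(j := z)) s) (y s))"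

(* The complexified law of the outputs at times a..b when the symbol at time j is fixed to z:
   the mass at y.  These outputs involve exactly the input symbols at times a-L..b. *)
definition fixed_prob ::
    "real measure \<Rightarrow> int \<Rightarrow> int \<Rightarrow> int \<Rightarrow> complex \<Rightarrow> (int \<Rightarrow> nat) \<Rightarrow> complex" where
  "fixed_prob F a b j z y =
     (\<integral>x. window_kernel a b j z y x \<partial>(\<Pi>\<^sub>M k\<in>{a - int L..b} - {j}. F))"

definition block_entropy :: "real measure \<Rightarrow> nat \<Rightarrow> real" where
  "block_entropy F n =
     - (\<Sum>\<^sub>\<infinity>y\<in>window 1 (int n). block_prob F 1 (int n) y * ln (block_prob F 1 (int n) y))"

definition D_block_term :: "real measure \<Rightarrow> nat \<Rightarrow> int \<Rightarrow> complex \<Rightarrow> (int \<Rightarrow> nat) \<Rightarrow> complex" where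
  "D_block_term F n j z y =
     (fixed_prob F 1 (int n) j z y - of_real (block_prob F 1 (int n) y))
       * of_real (ln (block_prob F 1 (int n) y))"

(* (1/n) times the derivative of the block entropy of (1 - e) F + e delta_z at e = 0: the derivative
   of the block law is the sum over j of fixed_prob - block_prob, which has total mass 0, so only
   the logarithm survives in the derivative of - p ln p. *)
definition D_block :: "real measure \<Rightarrow> nat \<Rightarrow> complex \<Rightarrow> complex" where
  "D_block F n z = - (1 / of_nat n) *
     (\<Sum>j\<in>{1 - int L..int n}. \<Sum>\<^sub>\<infinity>y\<in>window 1 (int n). D_block_term F n j z y)"

definition history_info :: "real measure \<Rightarrow> nat \<Rightarrow> nat \<Rightarrow> (int \<Rightarrow> nat) \<Rightarrow> real" where
  "history_info F t m y =
     - ln (cond_prob (output_law F) (\<lambda>w. w (int t) = y (int t))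
             (\<lambda>w. \<forall>s\<in>{int t - int m..<int t}. w s = y s))"

definition Delta_hist_term ::
    "real measure \<Rightarrow> nat \<Rightarrow> nat \<Rightarrow> complex \<Rightarrow> (int \<Rightarrow> nat) \<Rightarrow> complex" where
  "Delta_hist_term F t m z y =
     of_real (history_info F t m y) *
       (fixed_prob F (int t - int m) (int t) 0 z y
         - of_real (block_prob F (int t - int m) (int t) y))"

definition Delta_hist :: "real measure \<Rightarrow> nat \<Rightarrow> nat \<Rightarrow> complex \<Rightarrow> complex" where
  "Delta_hist F t m z =
     (\<Sum>\<^sub>\<infinity>y\<in>window (int t - int m) (int t). Delta_hist_term F t m z y)"

definition Delta :: "real measure \<Rightarrow> nat \<Rightarrow> complex \<Rightarrow> complex" where
  "Delta F t z = lim (\<lambda>m. Delta_hist F t m z)"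

definition h_dot :: "real measure \<Rightarrow> complex \<Rightarrow> complex" where
  "h_dot F z = (\<Sum>t. Delta F t z)"

(* - log P_F(Y_t | Y_{<t}), evaluated at the output path w, through a version of the conditional
   probability given the infinite past. *)
definition info_density :: "real measure \<Rightarrow> int \<Rightarrow> (int \<Rightarrow> nat) \<Rightarrow> real" where
  "info_density F t w =
     - ln (real_cond_exp (output_law F) (past t) (indicator {v. v t = w t}) w)"

(* H_F(Y_0 | Y_{<0}) *)
definition entropy_rate :: "real measure \<Rightarrow> real" where
  "entropy_rate F = (\<integral>w. info_density F 0 w \<partial>output_law F)"

end

end

theory Submission
  imports Defs
begin

text \<open>Fixing \<open>X\<^sub>j = z\<close> only changes finitely many Poisson kernels, whose moduli are bounded multiples
  of Poisson weights for every complex \<open>z\<close>; so all functionals below are entire in \<open>z\<close>.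
  The engine is exponential forgetting: for two independent copies of the input, exchanging the
  futures of the copies at some time preserves their law and changes the weight of only \<open>L + 1\<close>
  consecutive outputs. Hence two versions of the conditional probability of \<open>y\<^sub>t\<close>, with histories that
  agree on the last \<open>N (L + 1)\<close> outputs, differ by a factor that is a product over \<open>N\<close> blocks of
  outputs, and its expectation decays geometrically in \<open>N\<close>. This bounds the
  finite-history functionals by \<open>C \<tau>\<^sup>t\<close> and their increments in \<open>m\<close> by \<open>C \<tau>\<^sup>m\<close>, where the constants depend
  on the input law only through \<open>A\<close>. By the chain rule and
  stationarity the block derivative is a Cesaro mean of partial sums of these functionals, hence
  within \<open>C / n\<close> of its limit. Since this is uniform in the input law, the mean value theorem
  carries the derivative over from block entropies to the entropy rate. Forgetting also identifies the
  conditional law given the infinite past as the limit of the finite-history ones.\<close>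

section \<open>Sums and integrals\<close>

text \<open>Counts are unbounded, so forgetting has no rate valid along every output path: a block
  with large counts may forget next to nothing. The estimate is therefore a path-dependent factor
  \<open>theta\<close>, the same for all input laws on [0, A], and only its sum against a law
  decays. That law is complex, so its modulus has to be summed. Since |exp(-\<zeta>) \<zeta>^k / k!|
  is exp(|\<zeta>| - Re \<zeta>) times the Poisson weight of mean |\<zeta>|, and the prefactor
  differs from 1 at no more than L + 1 times, the modulus given the inputs is again a product of
  Poisson laws up to a constant that does not grow with the window. Decay in the lag t is deduced
  from decay in the history length m: a history too short to reach the outputs of the fixed symbol
  sees no change at all, so a longer one sees only an increment. Both decays are needed together,
  because the block derivative uses history length m for every lag up to m + L. The rate \<tau> is
  half the natural exponent, so that the better of \<tau>^(2m) and \<tau>^(2t) is at most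
  \<tau>^(m+t), which is summable in both variables.\<close>

lemma has_sum_prod_PiE:
  fixes f :: "'i \<Rightarrow> 'b::countable \<Rightarrow> 'c::{real_normed_field,banach,second_countable_topology}"
  assumes fin: "finite I" and f: "\<And>i. i \<in> I \<Longrightarrow> (\<lambda>k. norm (f i k)) summable_on UNIV"
  shows "(\<lambda>y. norm (\<Prod>i\<in>I. f i (y i))) summable_on PiE I (\<lambda>_. UNIV)"
    and "((\<lambda>y. \<Prod>i\<in>I. f i (y i)) has_sum (\<Prod>i\<in>I. infsum (f i) UNIV)) (PiE I (\<lambda>_. UNIV))"
proof -
  show 1: "(\<lambda>y. norm (\<Prod>i\<in>I. f i (y i))) summable_on PiE I (\<lambda>_. UNIV)"
    using Infinite_Set_Sum.abs_summable_on_prod_PiE[OF fin, of "\<lambda>_. UNIV" f] f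
    by (simp add: abs_summable_equivalent)
  then have "(\<lambda>y. \<Prod>i\<in>I. f i (y i)) summable_on PiE I (\<lambda>_. UNIV)"
    by (rule abs_summable_summable)
  moreover have "infsum (\<lambda>y. \<Prod>i\<in>I. f i (y i)) (PiE I (\<lambda>_. UNIV)) = (\<Prod>i\<in>I. infsum (f i) UNIV)"
    by (rule infsum_prod_PiE_abs[OF fin f])
  ultimately show "((\<lambda>y. \<Prod>i\<in>I. f i (y i)) has_sum (\<Prod>i\<in>I. infsum (f i) UNIV)) (PiE I (\<lambda>_. UNIV))"
    by (metis has_sum_infsum)
qed

text \<open>The sum runs along the net of finite subsets, which is no sequence, so dominated
  convergence does not apply directly. The majorant \<open>b\<close> makes the convergence uniform
  in \<open>x\<close>, and on a probability space that suffices.\<close>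

lemma has_sum_integral:
  fixes K :: "'y \<Rightarrow> 'x \<Rightarrow> 'c::{banach,second_countable_topology}"
  assumes "prob_space M"
    and meas: "\<And>y. y \<in> W \<Longrightarrow> K y \<in> borel_measurable M"
    and bound: "\<And>x y. x \<in> space M \<Longrightarrow> y \<in> W \<Longrightarrow> norm (K y x) \<le> b y"
    and b: "b summable_on W"
    and sum: "\<And>x. x \<in> space M \<Longrightarrow> ((\<lambda>y. K y x) has_sum G x) W"
    and G: "G \<in> borel_measurable M"
  shows "((\<lambda>y. \<integral>x. K y x \<partial>M) has_sum (\<integral>x. G x \<partial>M)) W"
proof -
  interpret prob_space M by fact
  have ul: "uniform_limit (space M) (\<lambda>S x. \<Sum>y\<in>S. K y x) (\<lambda>x. \<Sum>\<^sub>\<infinity>y\<in>W. K y x) (finite_subsets_at_top W)"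
    by (rule Weierstrass_m_test_general[OF _ b]) (use bound in auto)
  have intK: "integrable M (K y)" if "y \<in> W" for y
    by (rule integrable_const_bound[where B="b y"]) (use that meas bound in auto)
  have Gb: "norm (G x) \<le> infsum b W" if "x \<in> space M" for x
  proof -
    have "(\<lambda>y. norm (K y x)) summable_on W"
      by (rule Infinite_Sum.summable_on_comparison_test[OF b]) (use bound that in auto)
    then have "norm (infsum (\<lambda>y. K y x) W) \<le> infsum (\<lambda>y. norm (K y x)) W"
      by (rule norm_infsum_bound)
    also have "\<dots> \<le> infsum b W"
      by (rule infsum_mono) (use bound that b \<open>(\<lambda>y. norm (K y x)) summable_on W\<close> in auto)
    finally show ?thesis using infsumI[OF sum[OF that]] by simp
  qed
  have intG: "integrable M G"
    by (rule integrable_const_bound[where B="infsum b W"]) (use G Gb in auto)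
  show ?thesis unfolding has_sum_def
  proof (rule tendstoI)
    fix e :: real assume "e > 0"
    then have "\<forall>\<^sub>F S in finite_subsets_at_top W. \<forall>x\<in>space M.
        dist (\<Sum>y\<in>S. K y x) (\<Sum>\<^sub>\<infinity>y\<in>W. K y x) < e/2"
      using ul unfolding uniform_limit_iff by (meson half_gt_zero)
    moreover have "\<forall>\<^sub>F S in finite_subsets_at_top W. finite S \<and> S \<subseteq> W"
      by (rule eventually_finite_subsets_at_top_weakI) auto
    ultimately show "\<forall>\<^sub>F S in finite_subsets_at_top W. dist (\<Sum>y\<in>S. \<integral>x. K y x \<partial>M) (\<integral>x. G x \<partial>M) < e"
    proof eventually_elim
      case (elim S)
      then have iS: "integrable M (\<lambda>x. \<Sum>y\<in>S. K y x)" using intK by auto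
      have "(\<Sum>y\<in>S. \<integral>x. K y x \<partial>M) - (\<integral>x. G x \<partial>M) = (\<integral>x. (\<Sum>y\<in>S. K y x) - G x \<partial>M)"
        using elim intK iS intG by (subst Bochner_Integration.integral_diff) (auto intro!: sum.cong simp: Bochner_Integration.integral_sum subset_iff)
      also have "norm \<dots> \<le> (\<integral>x. norm ((\<Sum>y\<in>S. K y x) - G x) \<partial>M)"
        by (rule integral_norm_bound)
      also have "\<dots> \<le> (\<integral>x. e/2 \<partial>M)"
        by (rule integral_mono_AE)
          (use iS intG elim in \<open>auto intro!: integrable_norm AE_I2 less_imp_le simp: dist_norm infsumI[OF sum]\<close>)
      also have "\<dots> < e" using \<open>e > 0\<close> by (simp add: prob_space)
      finally show ?case by (simp add: dist_norm)
    qed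
  qed
qed

text \<open>Nonnegative terms let the bound pass through finite partial sums, so neither a majorant
  uniform in \<open>x\<close> nor measurability of the infinite sum enters.\<close>

lemma summable_on_integral_bound:
  fixes K :: "'y \<Rightarrow> 'x \<Rightarrow> real"
  assumes "prob_space M"
    and int: "\<And>y. y \<in> W \<Longrightarrow> integrable M (K y)"
    and pos: "\<And>x y. x \<in> space M \<Longrightarrow> y \<in> W \<Longrightarrow> K y x \<ge> 0"
    and summ: "\<And>x. x \<in> space M \<Longrightarrow> (\<lambda>y. K y x) summable_on W"
    and le: "\<And>x. x \<in> space M \<Longrightarrow> infsum (\<lambda>y. K y x) W \<le> C"
  shows "(\<lambda>y. \<integral>x. K y x \<partial>M) summable_on W" and "infsum (\<lambda>y. \<integral>x. K y x \<partial>M) W \<le> C"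
proof -
  interpret prob_space M by fact
  have fin: "(\<Sum>y\<in>S. \<integral>x. K y x \<partial>M) \<le> C" if S: "finite S" "S \<subseteq> W" for S
  proof -
    have "(\<Sum>y\<in>S. \<integral>x. K y x \<partial>M) = (\<integral>x. (\<Sum>y\<in>S. K y x) \<partial>M)"
      by (rule Bochner_Integration.integral_sum[symmetric]) (use S int in auto)
    also have "\<dots> \<le> (\<integral>x. C \<partial>M)"
    proof (rule integral_mono)
      fix x assume x: "x \<in> space M"
      have "(\<Sum>y\<in>S. K y x) \<le> infsum (\<lambda>y. K y x) W"
        by (rule finite_sum_le_infsum) (use S summ[OF x] pos[OF x] in auto)
      with le[OF x] show "(\<Sum>y\<in>S. K y x) \<le> C" by linarith
    qed (use S int in auto)
    finally show ?thesis by (simp add: prob_space)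
  qed
  show s: "(\<lambda>y. \<integral>x. K y x \<partial>M) summable_on W"
    by (rule nonneg_bdd_above_summable_on)
      (auto intro!: integral_nonneg_AE AE_I2 pos bdd_aboveI[where M=C] fin)
  show "infsum (\<lambda>y. \<integral>x. K y x \<partial>M) W \<le> C"
    by (rule infsum_le_finite_sums[OF s fin])
qed

text \<open>Independence of disjoint blocks in the language of sums: with product weights, the
  expectations of the block factors multiply. It is the source of the geometric decay.\<close>

lemma has_sum_block_prod:
  fixes f :: "'i \<Rightarrow> 'k::countable \<Rightarrow> real" and g :: "'k \<Rightarrow> real" and B :: "nat \<Rightarrow> 'i set"
  assumes fin: "finite I" and g: "\<And>k. \<bar>g k\<bar> \<le> 1"
    and B: "\<And>i. i < N \<Longrightarrow> B i \<subseteq> I" "\<And>i j. i < N \<Longrightarrow> j < N \<Longrightarrow> i \<noteq> j \<Longrightarrow> B i \<inter> B j = {}"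
    and f: "\<And>s. s \<in> I \<Longrightarrow> (\<lambda>k. \<bar>f s k\<bar>) summable_on UNIV"
  shows "((\<lambda>y. (\<Prod>i<N. 1 - (\<Prod>s\<in>B i. g (y s))) * (\<Prod>s\<in>I. f s (y s))) has_sum
     (\<Prod>i<N. (\<Prod>s\<in>B i. infsum (f s) UNIV) - (\<Prod>s\<in>B i. \<Sum>\<^sub>\<infinity>k. g k * f s k))
       * (\<Prod>s\<in>I - (\<Union>i<N. B i). infsum (f s) UNIV)) (PiE I (\<lambda>_. UNIV))"
  using B f
proof (induction N arbitrary: f)
  case 0
  then show ?case using has_sum_prod_PiE(2)[OF fin, of f] by simp
next
  case (Suc N)
  \<comment> \<open>Expanding the last factor gives the claim for \<open>f\<close> minus the claim
    for \<open>f'\<close>, into which the weights \<open>g\<close> of block \<open>N\<close> have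
    been absorbed; hence the induction over arbitrary \<open>f\<close>.\<close>
  define f' where "f' = (\<lambda>s k. if s \<in> B N then g k * f s k else f s k)"
  have BN: "B N \<subseteq> I" and finB: "finite (B N)"
    using Suc.prems(1)[of N] fin finite_subset by auto
  have disj: "B i \<inter> B N = {}" if "i < N" for i using Suc.prems(2)[of i N] that by auto
  have f's: "(\<lambda>k. \<bar>f' s k\<bar>) summable_on UNIV" if "s \<in> I" for s
    by (rule Infinite_Sum.summable_on_comparison_test[OF Suc.prems(3)[OF that]])
      (auto simp: f'_def abs_mult intro!: mult_left_le_one_le g)
  let ?I = "infsum" let ?J = "I - (\<Union>i<N. B i)" let ?P = "\<Prod>i<N. (\<Prod>s\<in>B i. infsum (f s) UNIV) - (\<Prod>s\<in>B i. \<Sum>\<^sub>\<infinity>k. g k * f s k)"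
  have 1: "((\<lambda>y. (\<Prod>i<N. 1 - (\<Prod>s\<in>B i. g (y s))) * (\<Prod>s\<in>I. f s (y s))) has_sum
      ?P * (\<Prod>s\<in>?J. infsum (f s) UNIV)) (PiE I (\<lambda>_. UNIV))"
    by (rule Suc.IH) (use Suc.prems in auto)
  have 2: "((\<lambda>y. (\<Prod>i<N. 1 - (\<Prod>s\<in>B i. g (y s))) * (\<Prod>s\<in>I. f' s (y s))) has_sum
      (\<Prod>i<N. (\<Prod>s\<in>B i. infsum (f' s) UNIV) - (\<Prod>s\<in>B i. \<Sum>\<^sub>\<infinity>k. g k * f' s k))
        * (\<Prod>s\<in>?J. infsum (f' s) UNIV)) (PiE I (\<lambda>_. UNIV))"
    by (rule Suc.IH) (use Suc.prems f's in auto)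
  have P': "(\<Prod>i<N. (\<Prod>s\<in>B i. infsum (f' s) UNIV) - (\<Prod>s\<in>B i. \<Sum>\<^sub>\<infinity>k. g k * f' s k)) = ?P"
  proof (rule prod.cong[OF refl])
    fix i assume "i \<in> {..<N}"
    then have "s \<notin> B N" if "s \<in> B i" for s using disj[of i] that by auto
    then have "f' s = f s" if "s \<in> B i" for s using that by (auto simp: f'_def)
    then show "(\<Prod>s\<in>B i. infsum (f' s) UNIV) - (\<Prod>s\<in>B i. \<Sum>\<^sub>\<infinity>k. g k * f' s k)
        = (\<Prod>s\<in>B i. infsum (f s) UNIV) - (\<Prod>s\<in>B i. \<Sum>\<^sub>\<infinity>k. g k * f s k)" by simp
  qed
  have J: "?J = B N \<union> (I - (\<Union>i<Suc N. B i))" "B N \<inter> (I - (\<Union>i<Suc N. B i)) = {}"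
    using BN disj by (auto simp: lessThan_Suc)
  have J1: "(\<Prod>s\<in>?J. infsum (f s) UNIV) = (\<Prod>s\<in>B N. infsum (f s) UNIV) * (\<Prod>s\<in>I - (\<Union>i<Suc N. B i). infsum (f s) UNIV)"
    unfolding J(1) by (rule prod.union_disjoint) (use fin finB J(2) in auto)
  have "(\<Prod>s\<in>?J. infsum (f' s) UNIV) = (\<Prod>s\<in>B N. infsum (f' s) UNIV) * (\<Prod>s\<in>I - (\<Union>i<Suc N. B i). infsum (f' s) UNIV)"
    unfolding J(1) by (rule prod.union_disjoint) (use fin finB J(2) in auto)
  also have "(\<Prod>s\<in>B N. infsum (f' s) UNIV) = (\<Prod>s\<in>B N. \<Sum>\<^sub>\<infinity>k. g k * f s k)"
    by (rule prod.cong) (auto simp: f'_def)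
  also have "(\<Prod>s\<in>I - (\<Union>i<Suc N. B i). infsum (f' s) UNIV) = (\<Prod>s\<in>I - (\<Union>i<Suc N. B i). infsum (f s) UNIV)"
    by (intro prod.cong refl arg_cong2[where f=infsum]) (auto simp: f'_def lessThan_Suc)
  finally have J2: "(\<Prod>s\<in>?J. infsum (f' s) UNIV) = (\<Prod>s\<in>B N. \<Sum>\<^sub>\<infinity>k. g k * f s k) * (\<Prod>s\<in>I - (\<Union>i<Suc N. B i). infsum (f s) UNIV)" .
  have pf': "(\<Prod>s\<in>I. f' s (y s)) = (\<Prod>s\<in>B N. g (y s)) * (\<Prod>s\<in>I. f s (y s))" for y
  proof -
    have "(\<Prod>s\<in>I. f' s (y s)) = (\<Prod>s\<in>I. (if s \<in> B N then g (y s) else 1) * f s (y s))"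
      by (rule prod.cong) (auto simp: f'_def)
    also have "\<dots> = (\<Prod>s\<in>I. if s \<in> B N then g (y s) else 1) * (\<Prod>s\<in>I. f s (y s))"
      by (rule prod.distrib)
    also have "(\<Prod>s\<in>I. if s \<in> B N then g (y s) else 1) = (\<Prod>s\<in>B N. g (y s))"
      using BN fin by (subst prod.inter_restrict[symmetric]) (auto simp: Int_absorb1)
    finally show ?thesis .
  qed
  have "((\<lambda>y. (\<Prod>i<N. 1 - (\<Prod>s\<in>B i. g (y s))) * (\<Prod>s\<in>I. f s (y s))
        - (\<Prod>i<N. 1 - (\<Prod>s\<in>B i. g (y s))) * (\<Prod>s\<in>I. f' s (y s))) has_sum
      ?P * (\<Prod>s\<in>?J. infsum (f s) UNIV) - ?P * (\<Prod>s\<in>?J. infsum (f' s) UNIV)) (PiE I (\<lambda>_. UNIV))"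
    using has_sum_add[OF 1 has_sum_uminusI[OF 2]] unfolding P' by simp
  then show ?case
    unfolding J1 J2 pf' by (simp add: algebra_simps)
qed

lemma has_sum_difference:
  fixes f g :: "'x \<Rightarrow> 'v::real_normed_algebra_1"
  assumes "(f has_sum a) X" "(g has_sum b) X"
  shows "((\<lambda>x. f x - g x) has_sum a - b) X"
  using has_sum_add[OF assms(1) has_sum_uminusI[OF assms(2)]] by simp

lemma norm_diff_diff_le: "norm ((a - b) - (c - d)) \<le> norm (a - c) + norm (b - d)"
  for a b c d :: "'v::real_normed_vector"
  using norm_triangle_ineq4[of "a - c" "b - d"] by (simp add: algebra_simps)

lemma has_sum_finite_sum:
  fixes f :: "'i \<Rightarrow> 'x \<Rightarrow> 'v::topological_comm_monoid_add"
  assumes "finite I" "\<And>i. i \<in> I \<Longrightarrow> (f i has_sum a i) X"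
  shows "((\<lambda>x. \<Sum>i\<in>I. f i x) has_sum (\<Sum>i\<in>I. a i)) X"
  using assms by (induction I rule: finite_induct) (auto intro!: has_sum_add)

lemma mean_geometric_le:
  assumes "0 < s" "s < (1::real)" "C \<ge> 0"
  shows "(\<Sum>m<n. C * s ^ m) \<le> C / (1 - s)"
proof -
  have "(\<Sum>m<n. s ^ m) \<le> (\<Sum>m. s ^ m)"
    by (rule sum_le_suminf) (use assms in \<open>auto intro: summable_geometric\<close>)
  also have "\<dots> = 1 / (1 - s)" using assms by (simp add: suminf_geometric)
  finally show ?thesis using mult_left_mono[of "\<Sum>m<n. s ^ m" "1 / (1 - s)" C] assms(3)
    by (simp add: sum_distrib_left)
qed

text \<open>An enumeration of \<open>W\<close> turns the unordered sum into a series, where termwise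
  differentiation on a convex set is available. The derivative within \<open>S\<close> covers
  one-sided derivatives at endpoints.\<close>

lemma infsum_has_field_derivative:
  fixes f f' :: "'y \<Rightarrow> real \<Rightarrow> real"
  assumes W: "countable W" "infinite W" and S: "convex S"
    and der: "\<And>y x. y \<in> W \<Longrightarrow> x \<in> S \<Longrightarrow> (f y has_field_derivative f' y x) (at x within S)"
    and f: "\<And>y x. y \<in> W \<Longrightarrow> x \<in> S \<Longrightarrow> \<bar>f y x\<bar> \<le> c y" "c summable_on W"
    and f': "\<And>y x. y \<in> W \<Longrightarrow> x \<in> S \<Longrightarrow> \<bar>f' y x\<bar> \<le> b y" "b summable_on W"
    and x: "x \<in> S"
  shows "((\<lambda>x. \<Sum>\<^sub>\<infinity>y\<in>W. f y x) has_field_derivative (\<Sum>\<^sub>\<infinity>y\<in>W. f' y x)) (at x within S)"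
proof -
  define e where "e = from_nat_into W"
  have e: "bij_betw e UNIV W" unfolding e_def using W by (rule bij_betw_from_nat_into)
  then have eW: "e n \<in> W" for n by (auto simp: bij_betw_def)
  have sums: "(\<lambda>n. g (e n)) sums (\<Sum>\<^sub>\<infinity>y\<in>W. g y)" if "\<And>y. y \<in> W \<Longrightarrow> \<bar>g y\<bar> \<le> d y" "d summable_on W" for g d :: "'y \<Rightarrow> real"
  proof -
    have "g summable_on W"
      by (rule abs_summable_summable, rule Infinite_Sum.summable_on_comparison_test[OF that(2)]) (use that(1) in auto)
    then have "(g has_sum (\<Sum>\<^sub>\<infinity>y\<in>W. g y)) W" by (rule has_sum_infsum)
    then have "((\<lambda>n. g (e n)) has_sum (\<Sum>\<^sub>\<infinity>y\<in>W. g y)) UNIV"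
      by (subst has_sum_reindex_bij_betw[OF e])
    then show ?thesis by (rule has_sum_imp_sums)
  qed
  have sf: "(\<lambda>n. f (e n) x') sums (\<Sum>\<^sub>\<infinity>y\<in>W. f y x')" if "x' \<in> S" for x'
    by (rule sums[OF _ f(2)]) (use f(1) that in auto)
  have sf': "(\<lambda>n. f' (e n) x) sums (\<Sum>\<^sub>\<infinity>y\<in>W. f' y x)"
    by (rule sums[OF _ f'(2)]) (use f'(1) x in auto)
  have b0: "0 \<le> b y" if "y \<in> W" for y using f'(1)[OF that x] by linarith
  have bs: "summable (\<lambda>n. b (e n))"
    by (rule sums_summable[OF sums[of b b]]) (use b0 f'(2) in auto)
  have ul: "uniform_limit S (\<lambda>n x. \<Sum>i<n. f' (e i) x) (\<lambda>x. \<Sum>i. f' (e i) x) sequentially"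
    by (rule Weierstrass_m_test[OF _ bs]) (use f'(1) eW in auto)
  have sm: "summable (\<lambda>n. f (e n) x)" using sf[OF x] by (rule sums_summable)
  have "\<exists>g. \<forall>x\<in>S. (\<lambda>n. f (e n) x) sums g x \<and> (g has_field_derivative (\<Sum>i. f' (e i) x)) (at x within S)"
    by (rule has_field_derivative_series[OF S der ul x sm]) (use eW in auto)
  then obtain g where g: "\<And>x. x \<in> S \<Longrightarrow> (\<lambda>n. f (e n) x) sums g x \<and> (g has_field_derivative (\<Sum>i. f' (e i) x)) (at x within S)"
    by blast
  have "g x' = (\<Sum>\<^sub>\<infinity>y\<in>W. f y x')" if "x' \<in> S" for x'
    using g[OF that] sf[OF that] by (auto dest: sums_unique2)
  moreover have "(\<Sum>i. f' (e i) x) = (\<Sum>\<^sub>\<infinity>y\<in>W. f' y x)"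
    using sf' by (auto dest: sums_unique)
  ultimately show ?thesis
    using has_field_derivative_transform_within[of g _ x S 1 "\<lambda>x. \<Sum>\<^sub>\<infinity>y\<in>W. f y x"] g[OF x] x by simp
qed

lemma continuous_on_infsum:
  fixes f :: "'y \<Rightarrow> real \<Rightarrow> real"
  assumes "\<And>y. y \<in> W \<Longrightarrow> continuous_on S (f y)"
    and "\<And>y x. y \<in> W \<Longrightarrow> x \<in> S \<Longrightarrow> \<bar>f y x\<bar> \<le> b y" "b summable_on W"
  shows "continuous_on S (\<lambda>x. \<Sum>\<^sub>\<infinity>y\<in>W. f y x)"
proof (rule uniform_limit_theorem)
  show "uniform_limit S (\<lambda>X x. \<Sum>y\<in>X. f y x) (\<lambda>x. \<Sum>\<^sub>\<infinity>y\<in>W. f y x) (finite_subsets_at_top W)"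
    by (rule Weierstrass_m_test_general[OF _ assms(3)]) (use assms(2) in auto)
  show "\<forall>\<^sub>F X in finite_subsets_at_top W. continuous_on S (\<lambda>x. \<Sum>y\<in>X. f y x)"
    by (rule eventually_finite_subsets_at_top_weakI) (use assms(1) in \<open>auto intro!: continuous_on_sum\<close>)
qed simp

lemma integral_eq_enn2real_bounded:
  assumes "prob_space M" "f \<in> borel_measurable M" "\<And>x. x \<in> space M \<Longrightarrow> 0 \<le> f x \<and> f x \<le> (c::real)"
  shows "(\<integral>x. f x \<partial>M) = enn2real (\<integral>\<^sup>+x. ennreal (f x) \<partial>M)" "(\<integral>\<^sup>+x. ennreal (f x) \<partial>M) < \<infinity>"
proof -
  interpret prob_space M by fact
  show "(\<integral>x. f x \<partial>M) = enn2real (\<integral>\<^sup>+x. ennreal (f x) \<partial>M)"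
    by (rule integral_eq_nn_integral) (use assms in auto)
  have "(\<integral>\<^sup>+x. ennreal (f x) \<partial>M) \<le> (\<integral>\<^sup>+x. ennreal c \<partial>M)"
    by (rule nn_integral_mono) (use assms in \<open>auto intro: ennreal_leI\<close>)
  also have "\<dots> < \<infinity>" by (simp add: emeasure_space_1)
  finally show "(\<integral>\<^sup>+x. ennreal (f x) \<partial>M) < \<infinity>" .
qed

text \<open>Fubini with one coordinate split off an infinite product. It serves both to mix the law
  of one input and to change the law of one output.\<close>

lemma nn_integral_PiM_coordinate:
  fixes f :: "('i \<Rightarrow> 'a) \<Rightarrow> ennreal"
  assumes N: "\<And>i. prob_space (N i)" and f: "f \<in> borel_measurable (Pi\<^sub>M UNIV N)"
  shows "(\<integral>\<^sup>+x. f x \<partial>Pi\<^sub>M UNIV N) = (\<integral>\<^sup>+X. \<integral>\<^sup>+v. f (X(k := v)) \<partial>N k \<partial>Pi\<^sub>M (UNIV - {k}) N)"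
    and "(\<lambda>(v, X). f (X(k := v))) \<in> borel_measurable (N k \<Otimes>\<^sub>M Pi\<^sub>M (UNIV - {k}) N)"
proof -
  interpret P: prob_space "N k" by (rule N)
  interpret Q: prob_space "Pi\<^sub>M (UNIV - {k}) N" by (rule prob_space_PiM[OF N])
  interpret PQ: pair_prob_space "N k" "Pi\<^sub>M (UNIV - {k}) N" ..
  have ins: "insert k (UNIV - {k}) = (UNIV :: 'i set)" by auto
  have m: "(\<lambda>(v, X). X(k := v)) \<in> N k \<Otimes>\<^sub>M Pi\<^sub>M (UNIV - {k}) N \<rightarrow>\<^sub>M Pi\<^sub>M UNIV N"
    using measurable_add_dim[of k "UNIV - {k}" N] measurable_compose[OF measurable_pair_swap' measurable_add_dim[of k "UNIV - {k}" N]]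
    unfolding ins by (simp add: case_prod_unfold)
  have d: "distr (N k \<Otimes>\<^sub>M Pi\<^sub>M (UNIV - {k}) N) (Pi\<^sub>M UNIV N) (\<lambda>(v, X). X(k := v)) = Pi\<^sub>M UNIV N"
    using distr_pair_PiM_eq_PiM[of "UNIV - {k}" N k] N unfolding ins by simp
  show fm: "(\<lambda>(v, X). f (X(k := v))) \<in> borel_measurable (N k \<Otimes>\<^sub>M Pi\<^sub>M (UNIV - {k}) N)"
    using measurable_compose[OF m f] by (simp add: case_prod_unfold)
  have "(\<integral>\<^sup>+x. f x \<partial>Pi\<^sub>M UNIV N) = (\<integral>\<^sup>+p. f (case p of (v, X) \<Rightarrow> X(k := v)) \<partial>(N k \<Otimes>\<^sub>M Pi\<^sub>M (UNIV - {k}) N))"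
    by (subst d[symmetric], subst nn_integral_distr[OF m]) (use f in auto)
  also have "\<dots> = (\<integral>\<^sup>+p. (\<lambda>(v, X). f (X(k := v))) p \<partial>(N k \<Otimes>\<^sub>M Pi\<^sub>M (UNIV - {k}) N))"
    by (simp add: case_prod_unfold)
  also have "\<dots> = (\<integral>\<^sup>+X. \<integral>\<^sup>+v. f (X(k := v)) \<partial>N k \<partial>Pi\<^sub>M (UNIV - {k}) N)"
    using PQ.nn_integral_snd[OF fm] by simp
  finally show "(\<integral>\<^sup>+x. f x \<partial>Pi\<^sub>M UNIV N) = (\<integral>\<^sup>+X. \<integral>\<^sup>+v. f (X(k := v)) \<partial>N k \<partial>Pi\<^sub>M (UNIV - {k}) N)" .
qed

section \<open>Holomorphic parameter dependence\<close>

lemma entire_uniform_limit: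
  fixes f :: "'i \<Rightarrow> complex \<Rightarrow> complex"
  assumes hol: "\<And>n. f n holomorphic_on UNIV" and F: "F \<noteq> bot"
    and lim: "\<And>B. B \<ge> 0 \<Longrightarrow> uniform_limit (cball 0 B) f g F"
  shows "g holomorphic_on UNIV"
proof -
  have "g holomorphic_on ball 0 r" if "r \<ge> 0" for r
    by (rule holomorphic_uniform_limit[OF _ lim[OF that] F])
      (use hol in \<open>auto intro!: always_eventually holomorphic_on_imp_continuous_on intro: holomorphic_on_subset\<close>)
  then have "g holomorphic_on (\<Union>r\<in>{0..}. ball 0 r)"
    by (intro holomorphic_on_UN_open) auto
  moreover have "(\<Union>r\<in>{0::real..}. ball (0::complex) r) = UNIV"
  proof (intro set_eqI iffI)
    fix z :: complex
    have "norm z + 1 \<in> {0..}" "z \<in> ball 0 (norm z + 1)" by auto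
    then show "z \<in> (\<Union>r\<in>{0::real..}. ball (0::complex) r)" by blast
  qed simp
  ultimately show ?thesis by simp
qed

text \<open>Membership in this class survives products and makes the integral over \<open>M\<close> a polynomial.\<close>

definition poly_family :: "'a measure \<Rightarrow> ('a \<Rightarrow> complex poly) \<Rightarrow> bool" where
  "poly_family M p \<longleftrightarrow> (\<forall>i. (\<lambda>x. coeff (p x) i) \<in> borel_measurable M \<and> (\<exists>C. \<forall>x\<in>space M. norm (coeff (p x) i) \<le> C))
     \<and> (\<exists>N. \<forall>x. degree (p x) \<le> N)"

lemma poly_family_mult:
  assumes "poly_family M p" "poly_family M q"
  shows "poly_family M (\<lambda>x. p x * q x)"
proof -
  obtain N K where N: "\<And>x. degree (p x) \<le> N" "\<And>x. degree (q x) \<le> K"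
    using assms by (auto simp: poly_family_def)
  have "degree (p x * q x) \<le> N + K" for x
    using degree_mult_le[of "p x" "q x"] N[of x] by linarith
  moreover have "(\<lambda>x. coeff (p x * q x) i) \<in> borel_measurable M" for i
    using assms by (auto simp: coeff_mult poly_family_def intro!: borel_measurable_sum borel_measurable_times)
  moreover have "\<exists>C. \<forall>x\<in>space M. norm (coeff (p x * q x) i) \<le> C" for i
  proof -
    have "\<exists>a. \<forall>k. \<forall>x\<in>space M. norm (coeff (p x) k) \<le> a k" "\<exists>b. \<forall>k. \<forall>x\<in>space M. norm (coeff (q x) k) \<le> b k"
      using assms unfolding poly_family_def by metis+
    then obtain a b where ab: "\<forall>k. \<forall>x\<in>space M. norm (coeff (p x) k) \<le> a k" "\<forall>k. \<forall>x\<in>space M. norm (coeff (q x) k) \<le> b k"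
      by blast
    have "norm (coeff (p x * q x) i) \<le> (\<Sum>k\<le>i. a k * b (i - k))" if "x \<in> space M" for x
      unfolding coeff_mult
      by (rule sum_norm_le, unfold norm_mult, rule mult_mono)
        (use ab that in \<open>auto intro: order_trans[OF norm_ge_zero]\<close>)
    then show ?thesis by blast
  qed
  ultimately show ?thesis unfolding poly_family_def by blast
qed

lemma poly_family_linear:
  assumes "a \<in> borel_measurable M" "\<And>x. x \<in> space M \<Longrightarrow> norm (a x) \<le> C"
  shows "poly_family M (\<lambda>x. [:a x, b:])"
proof -
  have "(\<lambda>x. coeff [:a x, b:] i) \<in> borel_measurable M" for i
    using assms by (cases i) (auto simp: coeff_pCons split: nat.splits)
  moreover have "\<exists>C. \<forall>x\<in>space M. norm (coeff [:a x, b:] i) \<le> C" for i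
  proof (cases i)
    case 0
    then show ?thesis using assms(2) by auto
  next
    case (Suc k)
    then show ?thesis by (intro exI[of _ "norm (coeff [:b:] k)"]) auto
  qed
  moreover have "degree [:a x, b:] \<le> 1" for x by simp
  ultimately show ?thesis unfolding poly_family_def by blast
qed

lemma poly_family_power: "poly_family M p \<Longrightarrow> poly_family M (\<lambda>x. p x ^ n)"
proof (induction n)
  case 0
  have "poly_family M (\<lambda>_. [:1, 0:])" by (rule poly_family_linear[of _ _ 1]) auto
  then show ?case by (simp add: one_pCons)
qed (auto intro: poly_family_mult)

lemma poly_family_prod: "(\<And>s. s \<in> I \<Longrightarrow> poly_family M (p s)) \<Longrightarrow> poly_family M (\<lambda>x. \<Prod>s\<in>I. p s x)"
proof (induction I rule: infinite_finite_induct)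
  have "poly_family M (\<lambda>_. [:1, 0:])" by (rule poly_family_linear[of _ _ 1]) auto
  then show "poly_family M (\<lambda>x. \<Prod>s\<in>I. p s x)" if "infinite I" for I using that by (simp add: one_pCons)
  show "poly_family M (\<lambda>x. \<Prod>s\<in>{}. p s x)" using \<open>poly_family M (\<lambda>_. [:1, 0:])\<close> by (simp add: one_pCons)
qed (auto intro: poly_family_mult)

lemma poly_family_integral:
  assumes "prob_space M" "poly_family M p"
  shows "(\<lambda>z. \<integral>x. poly (p x) z \<partial>M) holomorphic_on UNIV"
proof -
  interpret prob_space M by fact
  obtain N where N: "\<And>x. degree (p x) \<le> N" using assms by (auto simp: poly_family_def)
  have int: "integrable M (\<lambda>x. coeff (p x) i)" for i
    using assms(2) unfolding poly_family_def by (metis (no_types, lifting) AE_I2 integrable_const_bound)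
  have "poly (p x) z = (\<Sum>i\<le>N. coeff (p x) i * z ^ i)" for x z
    unfolding poly_altdef by (rule sum.mono_neutral_left) (use N[of x] in \<open>auto simp: coeff_eq_0\<close>)
  then have "(\<lambda>z. \<integral>x. poly (p x) z \<partial>M) = (\<lambda>z. \<Sum>i\<le>N. (\<integral>x. coeff (p x) i \<partial>M) * z ^ i)"
    using int by (simp add: Bochner_Integration.integral_sum)
  then show ?thesis by (auto intro!: holomorphic_intros)
qed

section \<open>Windows of outputs\<close>

lemma merge_window_bij:
  fixes I J :: "int set"
  assumes "I \<inter> J = {}"
  shows "bij_betw (\<lambda>(y, u). \<lambda>s. if s \<in> J then u s else y s)
    (PiE I (\<lambda>_. UNIV :: nat set) \<times> PiE J (\<lambda>_. UNIV)) (PiE (I \<union> J) (\<lambda>_. UNIV))"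
proof (rule bij_betwI[where g="\<lambda>w. (restrict w I, restrict w J)"])
  show "(\<lambda>(y, u). \<lambda>s. if s \<in> J then u s else y s) \<in> PiE I (\<lambda>_. UNIV) \<times> PiE J (\<lambda>_. UNIV) \<rightarrow> PiE (I \<union> J) (\<lambda>_. UNIV :: nat set)"
    by (auto simp: PiE_iff extensional_def)
  show "(\<lambda>w. (restrict w I, restrict w J)) \<in> PiE (I \<union> J) (\<lambda>_. UNIV :: nat set) \<rightarrow> PiE I (\<lambda>_. UNIV) \<times> PiE J (\<lambda>_. UNIV)"
    by auto
next
  fix p :: "(int \<Rightarrow> nat) \<times> (int \<Rightarrow> nat)" assume p: "p \<in> PiE I (\<lambda>_. UNIV) \<times> PiE J (\<lambda>_. UNIV)"
  then show "(\<lambda>w. (restrict w I, restrict w J)) ((\<lambda>(y, u). \<lambda>s. if s \<in> J then u s else y s) p) = p"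
    using assms by (auto simp: fun_eq_iff PiE_iff extensional_def)
next
  fix w :: "int \<Rightarrow> nat" assume "w \<in> PiE (I \<union> J) (\<lambda>_. UNIV)"
  then show "(\<lambda>(y, u). \<lambda>s. if s \<in> J then u s else y s) ((\<lambda>w. (restrict w I, restrict w J)) w) = w"
    by (auto simp: fun_eq_iff PiE_iff extensional_def)
qed

lemma window_shift_bij:
  "bij_betw (\<lambda>y s. if s \<in> {a - c..b - c} then y (s + c) else undefined) (window a b) (window (a - c) (b - c))"
  by (rule bij_betwI[where g="\<lambda>y s. if s \<in> {a..b} then y (s - c) else undefined"])
    (auto simp: window_def PiE_iff extensional_def fun_eq_iff)

lemma countable_window: "countable (window a b)"
  unfolding window_def by (rule countable_PiE) auto

lemma infinite_window: "n \<ge> 1 \<Longrightarrow> infinite (window 1 (int n))"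
  unfolding window_def finite_PiE_iff by (auto simp: PiE_eq_empty_iff intro: exI[of _ 1])

abbreviation inputs :: "real measure \<Rightarrow> (int \<Rightarrow> real) measure" where
  "inputs F \<equiv> (\<Pi>\<^sub>M k\<in>(UNIV :: int set). F)"

abbreviation outputs :: "(int \<Rightarrow> nat) measure" where
  "outputs \<equiv> (\<Pi>\<^sub>M s\<in>(UNIV :: int set). count_space UNIV)"

lemma cylinder_sets: "finite I \<Longrightarrow> cylinder I y \<in> sets outputs"
proof -
  assume I: "finite I"
  have "cylinder I y = (\<Inter>s\<in>I. {w \<in> space outputs. w s = y s}) \<inter> space outputs"
    by (auto simp: cylinder_def space_PiM)
  also have "\<dots> \<in> sets outputs"
  proof (cases "I = {}")
    case False
    have "{w \<in> space outputs. w s = y s} \<in> sets outputs" for s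
      by measurable
    then show ?thesis using I False by (intro sets.Int sets.finite_INT) auto
  qed simp
  finally show ?thesis .
qed

lemma measurable_restrict_window:
  assumes H: "finite H" and c: "\<And>s. s \<in> H \<Longrightarrow> (\<lambda>w. w s) \<in> M \<rightarrow>\<^sub>M count_space (UNIV :: nat set)"
  shows "(\<lambda>w. restrict w H) \<in> M \<rightarrow>\<^sub>M count_space (PiE H (\<lambda>_. UNIV))"
proof (subst measurable_count_space_eq_countable)
  show "countable (PiE H (\<lambda>_. UNIV :: nat set))" by (rule countable_PiE[OF H]) auto
  have "(\<lambda>w. restrict w H) -` {a} \<inter> space M \<in> sets M" if a: "a \<in> PiE H (\<lambda>_. UNIV)" for a
  proof -
    have "{w \<in> space M. \<forall>s\<in>H. w s = a s} \<in> sets M"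
    proof (rule sets.sets_Collect_finite_All[OF _ H])
      fix s assume "s \<in> H"
      from c[OF this] have "(\<lambda>w. w s) -` {a s} \<inter> space M \<in> sets M" by (rule measurable_sets) simp
      then show "{w \<in> space M. w s = a s} \<in> sets M" by (simp add: vimage_def Int_def conj_commute)
    qed
    moreover have "(\<lambda>w. restrict w H) -` {a} \<inter> space M = {w \<in> space M. \<forall>s\<in>H. w s = a s}"
      using a by (auto simp: fun_eq_iff PiE_iff extensional_def restrict_def)
    ultimately show ?thesis by simp
  qed
  then show "(\<lambda>w. restrict w H) \<in> space M \<rightarrow> PiE H (\<lambda>_. UNIV) \<and>
      (\<forall>a\<in>PiE H (\<lambda>_. UNIV). (\<lambda>w. restrict w H) -` {a} \<inter> space M \<in> sets M)" by auto
qed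

text \<open>A function of finitely many counts factors through a countable discrete space, where
  every function is measurable.\<close>

lemma measurable_finite_dependence:
  fixes g :: "(int \<Rightarrow> nat) \<Rightarrow> 'b::topological_space"
  assumes H: "finite H" and c: "\<And>s. s \<in> H \<Longrightarrow> (\<lambda>w. w s) \<in> M \<rightarrow>\<^sub>M count_space UNIV"
    and dep: "\<And>w. g (restrict w H) = g w"
  shows "g \<in> borel_measurable M"
proof -
  have "g \<in> count_space (PiE H (\<lambda>_. UNIV)) \<rightarrow>\<^sub>M borel" by simp
  from measurable_compose[OF measurable_restrict_window[OF H c] this] show ?thesis by (simp add: dep)
qed

lemma measurable_output_coord: "sets M = sets outputs \<Longrightarrow> (\<lambda>w. w s) \<in> M \<rightarrow>\<^sub>M count_space (UNIV :: nat set)"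
  using measurable_component_singleton[of s UNIV "\<lambda>_. count_space (UNIV :: nat set)"] by (simp cong: measurable_cong_sets)

text \<open>The bridge from sums over windows to integrals over path space: restriction to
  \<open>H\<close> pushes \<open>Q\<close> to a measure on a countable set with masses given by
  cylinders. \<open>Q\<close> need not have mass one, because it is also used for a law restricted
  to an event.\<close>

lemma window_expectation:
  fixes \<phi> :: "(int \<Rightarrow> nat) \<Rightarrow> real"
  assumes Q: "finite_measure Q" "sets Q = sets outputs" and H: "finite H"
    and dep: "\<And>w. \<phi> (restrict w H) = \<phi> w"
    and sum: "(\<lambda>y. norm (\<phi> y * measure Q (cylinder H y))) summable_on PiE H (\<lambda>_. UNIV)"
  shows "integrable Q \<phi>"
    and "((\<lambda>y. \<phi> y * measure Q (cylinder H y)) has_sum (\<integral>w. \<phi> w \<partial>Q)) (PiE H (\<lambda>_. UNIV))"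
proof -
  interpret finite_measure Q by fact
  let ?W = "PiE H (\<lambda>_. UNIV :: nat set)"
  let ?p = "\<lambda>y. measure Q (cylinder H y)"
  have sp: "space Q = UNIV" using sets_eq_imp_space_eq[OF Q(2)] by (simp add: space_PiM)
  have r: "(\<lambda>w. restrict w H) \<in> Q \<rightarrow>\<^sub>M count_space ?W"
    by (rule measurable_restrict_window[OF H measurable_output_coord[OF Q(2)]])
  define N where "N = distr Q (count_space ?W) (\<lambda>w. restrict w H)"
  have N: "N = density (count_space ?W) (\<lambda>y. ennreal (?p y))"
  proof (rule measure_eqI_countable)
    show "countable ?W" by (rule countable_PiE[OF H]) auto
    fix y assume y: "y \<in> ?W"
    have "(\<lambda>w. restrict w H) -` {y} \<inter> space Q = cylinder H y"
      using y by (auto simp: sp cylinder_def fun_eq_iff PiE_iff extensional_def restrict_def)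
    then have "emeasure N {y} = emeasure Q (cylinder H y)"
      unfolding N_def using y by (subst emeasure_distr[OF r]) auto
    also have "\<dots> = emeasure (density (count_space ?W) (\<lambda>y. ennreal (?p y))) {y}"
      using y by (simp add: emeasure_density nn_integral_indicator_singleton emeasure_eq_measure)
    finally show "emeasure N {y} = emeasure (density (count_space ?W) (\<lambda>y. ennreal (?p y))) {y}" .
  qed (simp_all add: N_def)
  have a: "Infinite_Set_Sum.abs_summable_on (\<lambda>y. \<phi> y * ?p y) ?W" using sum by (simp only: abs_summable_equivalent)
  have f: "\<phi> \<in> borel_measurable (count_space ?W)" by simp
  have "integrable N \<phi>"
    unfolding N using a by (subst integrable_density) (auto simp: abs_summable_on_def mult.commute)
  then show "integrable Q \<phi>"
    unfolding N_def by (subst (asm) integrable_distr_eq[OF r f]) (simp add: dep)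
  have "(\<integral>w. \<phi> w \<partial>Q) = (\<integral>y. \<phi> y \<partial>N)"
    unfolding N_def by (subst integral_distr[OF r f]) (simp add: dep)
  also have "\<dots> = infsetsum (\<lambda>y. \<phi> y * ?p y) ?W"
    unfolding N infsetsum_def by (subst integral_density) (auto simp: mult.commute)
  also have "\<dots> = infsum (\<lambda>y. \<phi> y * ?p y) ?W" by (rule infsetsum_infsum[OF a])
  finally show "((\<lambda>y. \<phi> y * ?p y) has_sum (\<integral>w. \<phi> w \<partial>Q)) ?W"
    using has_sum_infsum[OF abs_summable_summable[OF sum]] by simp
qed

text \<open>If coordinate \<open>k\<close> charges every value, then almost every section of a null
  set in that coordinate is empty, and an empty section is null for any other law of the
  coordinate.\<close>

lemma null_set_change_pmf:
  fixes p q :: "int \<Rightarrow> nat pmf"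
  assumes full: "set_pmf (p k) = UNIV" and eq: "\<And>s. s \<noteq> k \<Longrightarrow> q s = p s"
    and E: "E \<in> sets outputs" and null: "emeasure (\<Pi>\<^sub>M s\<in>UNIV. measure_pmf (p s)) E = 0"
  shows "emeasure (\<Pi>\<^sub>M s\<in>UNIV. measure_pmf (q s)) E = 0"
proof -
  let ?R = "\<Pi>\<^sub>M s\<in>UNIV - {k}. measure_pmf (p s)" let ?f = "indicator E :: (int \<Rightarrow> nat) \<Rightarrow> ennreal"
  have s: "sets (\<Pi>\<^sub>M s\<in>UNIV. measure_pmf (r s)) = sets outputs" for r :: "int \<Rightarrow> nat pmf"
    by (rule sets_PiM_cong) auto
  have R: "(\<Pi>\<^sub>M s\<in>UNIV - {k}. measure_pmf (q s)) = ?R" by (rule PiM_cong) (use eq in auto)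
  have fm: "?f \<in> borel_measurable (\<Pi>\<^sub>M s\<in>UNIV. measure_pmf (r s))" for r :: "int \<Rightarrow> nat pmf"
    using E s[of r] by (simp cong: measurable_cong_sets)
  have int: "emeasure (\<Pi>\<^sub>M s\<in>UNIV. measure_pmf (r s)) E
      = (\<integral>\<^sup>+X. \<integral>\<^sup>+v. ?f (X(k := v)) \<partial>measure_pmf (r k) \<partial>(\<Pi>\<^sub>M s\<in>UNIV - {k}. measure_pmf (r s)))" for r :: "int \<Rightarrow> nat pmf"
  proof -
    have "emeasure (\<Pi>\<^sub>M s\<in>UNIV. measure_pmf (r s)) E = (\<integral>\<^sup>+w. ?f w \<partial>(\<Pi>\<^sub>M s\<in>UNIV. measure_pmf (r s)))"
      using E s[of r] by simp
    then show ?thesis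
      using nn_integral_PiM_coordinate(1)[of "\<lambda>s. measure_pmf (r s)" ?f k, OF prob_space_measure_pmf fm] by simp
  qed
  have m: "(\<lambda>X. \<integral>\<^sup>+v. ?f (X(k := v)) \<partial>measure_pmf (p k)) \<in> borel_measurable ?R"
  proof -
    have pm: "(\<lambda>(v, X). ?f (X(k := v))) \<in> borel_measurable (measure_pmf (p k) \<Otimes>\<^sub>M ?R)"
      using nn_integral_PiM_coordinate(2)[of "\<lambda>s. measure_pmf (p s)" ?f k, OF prob_space_measure_pmf fm] .
    have "case_prod (\<lambda>X v. ?f (X(k := v))) \<in> borel_measurable (?R \<Otimes>\<^sub>M measure_pmf (p k))"
      using measurable_pair_swap[OF pm] by (simp add: case_prod_unfold)
    then show ?thesis by (rule measure_pmf.borel_measurable_nn_integral)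
  qed
  have "AE X in ?R. (\<integral>\<^sup>+v. ?f (X(k := v)) \<partial>measure_pmf (p k)) = 0"
    using null int[of p] m by (simp add: nn_integral_0_iff_AE)
  then have "AE X in ?R. (\<integral>\<^sup>+v. ?f (X(k := v)) \<partial>measure_pmf (q k)) = 0"
  proof eventually_elim
    case (elim X)
    then have "\<forall>v. ?f (X(k := v)) = 0"
      using full by (simp add: nn_integral_0_iff_AE AE_measure_pmf_iff)
    then show ?case by simp
  qed
  then have "(\<integral>\<^sup>+X. \<integral>\<^sup>+v. ?f (X(k := v)) \<partial>measure_pmf (q k) \<partial>?R) = (\<integral>\<^sup>+X. 0 \<partial>?R)"
    by (rule nn_integral_cong_AE)
  then show ?thesis using int[of q] R by simp
qed

lemma null_set_change_finite:
  fixes p q :: "int \<Rightarrow> nat pmf"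
  assumes J: "finite J" and full: "\<And>s. set_pmf (p s) = UNIV" "\<And>s. set_pmf (q s) = UNIV"
    and eq: "\<And>s. s \<notin> J \<Longrightarrow> q s = p s"
    and E: "E \<in> sets outputs" and null: "emeasure (\<Pi>\<^sub>M s\<in>UNIV. measure_pmf (p s)) E = 0"
  shows "emeasure (\<Pi>\<^sub>M s\<in>UNIV. measure_pmf (q s)) E = 0"
  using J full(1) eq null
proof (induction J arbitrary: p rule: finite_induct)
  case empty
  then have "q = p" by auto
  then show ?case using empty by simp
next
  case (insert k J)
  let ?p = "p(k := q k)"
  have "emeasure (\<Pi>\<^sub>M s\<in>UNIV. measure_pmf (?p s)) E = 0"
    by (rule null_set_change_pmf[OF _ _ E insert.prems(3), of k]) (use insert.prems in auto)
  then show ?case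
    by (intro insert.IH[of ?p]) (use insert.prems full(2) in auto)
qed

lemma past_coord: "s < t \<Longrightarrow> (\<lambda>w. w s) \<in> past t \<rightarrow>\<^sub>M count_space UNIV"
proof -
  assume s: "s < t"
  have "(\<lambda>w. restrict w {..<t}) \<in> past t \<rightarrow>\<^sub>M (\<Pi>\<^sub>M s\<in>{..<t}. count_space UNIV)"
    unfolding past_def by (rule measurable_vimage_algebra1) (auto simp: space_PiM)
  from measurable_compose[OF this measurable_component_singleton[of s]] s show ?thesis by simp
qed

lemma measurable_restrict_past: "sets M = sets outputs \<Longrightarrow>
    (\<lambda>w. restrict w {..<t}) \<in> M \<rightarrow>\<^sub>M (\<Pi>\<^sub>M s\<in>{..<t}. count_space (UNIV :: nat set))"
  by (rule measurable_restrict) (rule measurable_output_coord)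

section \<open>Poisson kernels and input laws\<close>

definition poisson_weight :: "real \<Rightarrow> nat \<Rightarrow> real" where
  "poisson_weight r k = exp (- r) * r ^ k / fact k"

lemma exp_series_has_sum: "((\<lambda>k. r ^ k / fact k) has_sum exp r) UNIV"
  for r :: "'a::{real_normed_field,banach}"
proof -
  have "summable (\<lambda>k. norm (r ^ k / fact k))"
    using summable_norm_exp[of r] by (simp add: divide_inverse scaleR_conv_of_real mult.commute of_real_inverse)
  moreover have "(\<lambda>k. r ^ k / fact k) sums exp r"
    using exp_converges[of r] by (simp add: divide_inverse scaleR_conv_of_real mult.commute of_real_inverse)
  ultimately show ?thesis by (rule norm_summable_imp_has_sum)
qed

lemma poisson_weight_nonneg: "r \<ge> 0 \<Longrightarrow> poisson_weight r k \<ge> 0"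
  by (simp add: poisson_weight_def)

lemma power_poisson_weight_has_sum:
  "((\<lambda>k. b ^ k * poisson_weight r k) has_sum exp ((b - 1) * r)) UNIV"
proof -
  have "((\<lambda>k. exp (- r) * ((b * r) ^ k / fact k)) has_sum exp (- r) * exp (b * r)) UNIV"
    by (intro has_sum_cmult_right exp_series_has_sum)
  then show ?thesis
    by (simp add: poisson_weight_def power_mult_distrib exp_add[symmetric] algebra_simps)
qed

lemma poisson_weight_has_sum: "(poisson_weight r has_sum 1) UNIV"
  using power_poisson_weight_has_sum[of 1 r] by simp

lemma poisson_kernel_has_sum: "(poisson_kernel \<zeta> has_sum 1) UNIV"
proof -
  have "((\<lambda>k. exp (- \<zeta>) * (\<zeta> ^ k / fact k)) has_sum exp (- \<zeta>) * exp \<zeta>) UNIV"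
    by (intro has_sum_cmult_right exp_series_has_sum)
  then show ?thesis by (simp add: poisson_kernel_def[abs_def] exp_minus)
qed

lemma poisson_kernel_of_real: "poisson_kernel (of_real r) k = of_real (poisson_weight r k)"
  by (simp add: poisson_kernel_def poisson_weight_def exp_minus exp_of_real)

lemma norm_poisson_kernel:
  "norm (poisson_kernel \<zeta> k) = exp (norm \<zeta> - Re \<zeta>) * poisson_weight (norm \<zeta>) k"
  by (simp add: poisson_kernel_def poisson_weight_def norm_mult norm_divide norm_power exp_diff exp_minus field_simps)

lemma pmf_poisson_weight: "r > 0 \<Longrightarrow> pmf (poisson_pmf r) k = poisson_weight r k"
  by (simp add: poisson_weight_def mult_ac)

text \<open>Mixing with a point mass can raise the mean, so the class on which uniform estimates are
  proved is that of all laws on [0, A], which is closed under mixing.\<close>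

definition laws_upto :: "real \<Rightarrow> real measure set" where
  "laws_upto A = space (prob_algebra (restrict_space borel {0..A}))"

lemma laws_uptoD:
  assumes "F \<in> laws_upto A"
  shows "prob_space F" "sets F = sets (restrict_space borel {0..A})" "space F = {0..A}"
    "(\<lambda>u. u) \<in> borel_measurable F"
proof -
  show "prob_space F" and s: "sets F = sets (restrict_space borel {0..A})"
    using assms by (auto simp: laws_upto_def space_prob_algebra)
  then show "space F = {0..A}" by (auto dest: sets_eq_imp_space_eq simp: space_restrict_space)
  show "(\<lambda>u. u) \<in> borel_measurable F"
    by (subst measurable_cong_sets[OF s refl]) (rule measurable_restrict_space1, simp)
qed

locale poisson_channel =
  fixes L :: nat and lam0 A :: real and h :: "nat \<Rightarrow> real"
  assumes lam0: "lam0 > 0" and h_nonneg: "l \<le> L \<Longrightarrow> h l \<ge> 0"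
    and h_sum: "(\<Sum>l\<le>L. h l) = 1" and A: "A \<ge> 0"
begin

abbreviation "rt \<equiv> rate L lam0 h"
abbreviation "cr j z x \<equiv> crate L lam0 h ((\<lambda>k. complex_of_real (x k))(j := z))"
abbreviation "laws \<equiv> laws_upto A"
abbreviation "olaw \<equiv> output_law L lam0 h"
abbreviation "olawx \<equiv> output_law_fixed L lam0 h"
abbreviation "okernel \<equiv> output_kernel L lam0 h"

lemma h_le_1: "l \<le> L \<Longrightarrow> h l \<le> 1"
  using member_le_sum[of l "{..L}" h] h_nonneg h_sum by auto

lemma space_inputs: "F \<in> laws \<Longrightarrow> space (inputs F) = {x. \<forall>k. 0 \<le> x k \<and> x k \<le> A}"
  by (auto simp: space_PiM laws_uptoD PiE_iff)

lemma prob_inputs: "F \<in> laws \<Longrightarrow> prob_space (inputs F)"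
  by (intro prob_space_PiM laws_uptoD)

lemma rate_bounds:
  assumes "\<And>k. 0 \<le> x k \<and> x k \<le> A"
  shows "lam0 \<le> rt x s" "rt x s \<le> lam0 + A" "0 < rt x s"
proof -
  have "0 \<le> (\<Sum>l\<le>L. h l * x (s - int l))"
    using assms h_nonneg by (intro sum_nonneg) auto
  then show "lam0 \<le> rt x s" by (simp add: rate_def)
  then show "0 < rt x s" using lam0 by linarith
  have "(\<Sum>l\<le>L. h l * x (s - int l)) \<le> (\<Sum>l\<le>L. h l * A)"
    using assms h_nonneg by (intro sum_mono mult_left_mono) auto
  then show "rt x s \<le> lam0 + A" by (simp add: rate_def h_sum sum_distrib_right[symmetric])
qed

text \<open>The rate is affine in \<open>z\<close> with a real slope that vanishes away from the L +
  1 outputs reached by symbol \<open>j\<close>. Both the size estimates and the polynomial form of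
  the kernels rest on this.\<close>

lemma crate_split:
  "cr j z x s = of_real (rt (x(j := 0)) s) + (if s \<in> {j..j + int L} then of_real (h (nat (s - j))) * z else 0)"
proof -
  have *: "of_real (h l) * ((\<lambda>k. complex_of_real (x k))(j := z)) (s - int l) =
      of_real (h l * (x(j := 0)) (s - int l)) + (if l = nat (s - j) \<and> s \<ge> j then of_real (h l) * z else 0)" for l
    by auto
  have "(\<Sum>l\<le>L. if l = nat (s - j) \<and> s \<ge> j then of_real (h l) * z else 0)
      = (if s \<in> {j..j + int L} then of_real (h (nat (s - j))) * z else 0)"
  proof (cases "s \<ge> j")
    case True
    then show ?thesis by (auto simp: sum.delta)
  qed auto
  then show ?thesis
    unfolding crate_def rate_def * sum.distrib by simp
qed

lemma crate_unaffected: "s \<notin> {j..j + int L} \<Longrightarrow> cr j z x s = of_real (rt x s)"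
  by (auto simp: crate_def rate_def intro!: sum.cong)

lemma crate_of_real: "cr j (of_real u) x s = of_real (rt (x(j := u)) s)"
  by (auto simp: crate_def rate_def intro!: sum.cong)

text \<open>The last quantity is the exponent by which the modulus of a complex kernel exceeds a
  Poisson weight. Its support in \<open>{j..j + int L}\<close> keeps the total variation of the
  complexified laws bounded uniformly in the window.\<close>

lemma crate_bounds:
  assumes x: "\<And>k. 0 \<le> x k \<and> x k \<le> A" and z: "norm z \<le> B"
  shows "norm (cr j z x s) \<le> lam0 + A + B"
    and "Re (cr j z x s) \<ge> - B"
    and "norm (cr j z x s) - Re (cr j z x s) \<le> (if s \<in> {j..j + int L} then 2 * B else 0)"
proof -
  define w where "w = (if s \<in> {j..j + int L} then of_real (h (nat (s - j))) * z else 0)"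
  have B: "B \<ge> 0" using z norm_ge_zero[of z] by linarith
  have "h (nat (s - j)) * norm z \<le> 1 * B" if "s \<in> {j..j + int L}"
    by (rule mult_mono) (use that z B h_le_1[of "nat (s - j)"] in auto)
  then have w: "norm w \<le> (if s \<in> {j..j + int L} then B else 0)"
    using h_nonneg[of "nat (s - j)"] by (auto simp: w_def norm_mult)
  then have w': "norm w \<le> B" using B by (auto split: if_splits)
  have r: "lam0 \<le> rt (x(j := 0)) s" "rt (x(j := 0)) s \<le> lam0 + A"
    using rate_bounds[of "x(j := 0)" s] x A by (auto simp: fun_upd_def)
  have e: "cr j z x s = of_real (rt (x(j := 0)) s) + w"
    using crate_split[of x j z s] by (simp add: w_def)
  have n: "norm (cr j z x s) \<le> rt (x(j := 0)) s + norm w"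
    unfolding e using norm_triangle_ineq[of "of_real (rt (x(j := 0)) s)" w] r lam0 by simp
  have "Re w \<ge> - norm w" using abs_Re_le_cmod[of w] by linarith
  then have R: "Re (cr j z x s) \<ge> rt (x(j := 0)) s - norm w" unfolding e by simp
  show "norm (cr j z x s) \<le> lam0 + A + B" using n r w' by linarith
  show "Re (cr j z x s) \<ge> - B" using R r lam0 w' by linarith
  show "norm (cr j z x s) - Re (cr j z x s) \<le> (if s \<in> {j..j + int L} then 2 * B else 0)"
    using n R w by (auto split: if_splits)
qed

text \<open>Bounds of a single kernel that depend on the channel only through \<open>lam0\<close>
  and \<open>A\<close>, hence are uniform over input laws: for |z| \<le> B, |exp(-\<zeta>)| is at
  most exp B and |\<zeta>| at most \<open>lam0 + A + B\<close>. The value \<open>B = 0\<close>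
  bounds real Poisson weights.\<close>

definition ubound :: "real \<Rightarrow> nat \<Rightarrow> real" where
  "ubound B k = exp B * (lam0 + A + B) ^ k / fact k"

definition lbound :: "nat \<Rightarrow> real" where
  "lbound k = exp (- (lam0 + A)) * lam0 ^ k / fact k"

lemma lbound_pos: "lbound k > 0"
  using lam0 by (simp add: lbound_def)

lemma ubound_pos: "B \<ge> 0 \<Longrightarrow> ubound B k > 0"
  using lam0 A by (simp add: ubound_def)

lemma norm_kernel_le_ubound:
  assumes x: "\<And>k. 0 \<le> x k \<and> x k \<le> A" and z: "norm z \<le> B"
  shows "norm (poisson_kernel (cr j z x s) k) \<le> ubound B k"
  unfolding poisson_kernel_def ubound_def norm_mult norm_divide norm_power norm_exp_eq_Re norm_fact
  by (intro divide_right_mono mult_mono power_mono) (use crate_bounds[where x=x and z=z and B=B and j=j and s=s, OF assms] in auto)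

lemma weight_bounds:
  assumes x: "\<And>k. 0 \<le> x k \<and> x k \<le> A"
  shows "lbound k \<le> poisson_weight (rt x s) k" "poisson_weight (rt x s) k \<le> ubound 0 k"
    "poisson_weight (rt x s) k \<ge> 0"
proof -
  note r = rate_bounds[of x s, OF x]
  show "lbound k \<le> poisson_weight (rt x s) k"
    unfolding lbound_def poisson_weight_def
    by (intro divide_right_mono mult_mono power_mono) (use r lam0 in auto)
  show "poisson_weight (rt x s) k \<le> ubound 0 k"
    unfolding ubound_def poisson_weight_def
    by (intro divide_right_mono mult_mono power_mono) (use r lam0 in auto)
  show "poisson_weight (rt x s) k \<ge> 0"
    using r by (intro poisson_weight_nonneg) auto
qed

lemma ubound_has_sum: "((\<lambda>k. b ^ k * ubound B k) has_sum exp B * exp (b * (lam0 + A + B))) UNIV"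
proof -
  have "((\<lambda>k. exp B * ((b * (lam0 + A + B)) ^ k / fact k)) has_sum exp B * exp (b * (lam0 + A + B))) UNIV"
    by (intro has_sum_cmult_right exp_series_has_sum)
  then show ?thesis by (simp add: ubound_def power_mult_distrib mult_ac)
qed

lemma measurable_coord:
  assumes "F \<in> laws" "k \<in> J"
  shows "(\<lambda>x. x k) \<in> borel_measurable (Pi\<^sub>M J (\<lambda>_. F))"
  using measurable_compose[OF measurable_component_singleton[OF assms(2)] laws_uptoD(4)[OF assms(1)]] .

lemma measurable_crate:
  assumes "F \<in> laws" "{s - int L..s} - {j} \<subseteq> J"
  shows "(\<lambda>x. cr j z x s) \<in> borel_measurable (Pi\<^sub>M J (\<lambda>_. F))"
  unfolding crate_def
proof (intro borel_measurable_add borel_measurable_const borel_measurable_sum borel_measurable_times)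
  fix l assume l: "l \<in> {..L}"
  show "(\<lambda>x. ((\<lambda>k. complex_of_real (x k))(j := z)) (s - int l)) \<in> borel_measurable (Pi\<^sub>M J (\<lambda>_. F))"
  proof (cases "s - int l = j")
    case False
    then have "(\<lambda>x. x (s - int l)) \<in> borel_measurable (Pi\<^sub>M J (\<lambda>_. F))"
      using l assms by (intro measurable_coord) auto
    then show ?thesis using False by simp
  qed simp
qed

lemma measurable_rate: "F \<in> laws \<Longrightarrow> (\<lambda>x. rt x s) \<in> borel_measurable (inputs F)"
  unfolding rate_def by (intro borel_measurable_add borel_measurable_const borel_measurable_sum borel_measurable_times measurable_coord) auto

lemma measurable_poisson_kernel: "(\<lambda>\<zeta>. poisson_kernel \<zeta> k) \<in> borel_measurable borel"
  unfolding poisson_kernel_def by (intro borel_measurable_continuous_onI continuous_intros) auto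

lemma measurable_poisson_weight: "(\<lambda>r. poisson_weight r k) \<in> borel_measurable borel"
  unfolding poisson_weight_def by (intro borel_measurable_continuous_onI continuous_intros) auto

definition ckernel :: "int set \<Rightarrow> int \<Rightarrow> complex \<Rightarrow> (int \<Rightarrow> nat) \<Rightarrow> (int \<Rightarrow> real) \<Rightarrow> complex" where
  "ckernel I j z y x = (\<Prod>s\<in>I. poisson_kernel (cr j z x s) (y s))"

text \<open>The integral runs over the whole input process, with the symbol at \<open>j\<close>
  overwritten, instead of over the inputs of a window. All windows and all shifts then share one
  input space; \<open>fixed_prob_eq\<close> translates back.\<close>

definition cmass :: "real measure \<Rightarrow> int set \<Rightarrow> int \<Rightarrow> complex \<Rightarrow> (int \<Rightarrow> nat) \<Rightarrow> complex" where
  "cmass F I j z y = (\<integral>x. ckernel I j z y x \<partial>inputs F)"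

lemma measurable_ckernel:
  assumes "F \<in> laws" "\<And>s. s \<in> I \<Longrightarrow> {s - int L..s} - {j} \<subseteq> J"
  shows "ckernel I j z y \<in> borel_measurable (Pi\<^sub>M J (\<lambda>_. F))"
  unfolding ckernel_def[abs_def]
  by (intro borel_measurable_prod measurable_compose[OF measurable_crate measurable_poisson_kernel] assms)

lemma norm_ckernel_le:
  assumes "\<And>k. 0 \<le> x k \<and> x k \<le> A" "norm z \<le> B"
  shows "norm (ckernel I j z y x) \<le> (\<Prod>s\<in>I. ubound B (y s))"
  unfolding ckernel_def prod_norm[symmetric]
  by (intro prod_mono conjI norm_ge_zero norm_kernel_le_ubound assms)

lemma integrable_ckernel: "F \<in> laws \<Longrightarrow> integrable (inputs F) (ckernel I j z y)"
proof -
  assume F: "F \<in> laws"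
  interpret prob_space "inputs F" by (rule prob_inputs[OF F])
  show ?thesis
    by (rule integrable_const_bound[where B="\<Prod>s\<in>I. ubound (norm z) (y s)"])
      (use F norm_ckernel_le[of _ z "norm z"] in \<open>auto simp: space_inputs intro!: measurable_ckernel\<close>)
qed

lemma norm_cmass_le:
  assumes F: "F \<in> laws" and z: "norm z \<le> B"
  shows "norm (cmass F I j z y) \<le> (\<Prod>s\<in>I. ubound B (y s))"
proof -
  interpret prob_space "inputs F" by (rule prob_inputs[OF F])
  have "norm (cmass F I j z y) \<le> (\<integral>x. norm (ckernel I j z y x) \<partial>inputs F)"
    unfolding cmass_def by (rule integral_norm_bound)
  also have "\<dots> \<le> (\<integral>x. (\<Prod>s\<in>I. ubound B (y s)) \<partial>inputs F)"
    by (rule integral_mono) (use F z in \<open>auto simp: space_inputs intro!: integrable_ckernel norm_ckernel_le integrable_norm\<close>)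
  finally show ?thesis by (simp add: prob_space)
qed

lemma cmass_cong: "(\<And>s. s \<in> I \<Longrightarrow> y s = y' s) \<Longrightarrow> cmass F I j z y = cmass F I j z y'"
  unfolding cmass_def ckernel_def by (auto intro!: Bochner_Integration.integral_cong prod.cong)

lemma integral_PiM_restrict:
  fixes f :: "(int \<Rightarrow> real) \<Rightarrow> 'b::{banach,second_countable_topology}"
  assumes F: "F \<in> laws" and f: "f \<in> borel_measurable (Pi\<^sub>M J (\<lambda>_. F))"
    and dep: "\<And>x. f (restrict x J) = f x"
  shows "(\<integral>x. f x \<partial>Pi\<^sub>M J (\<lambda>_. F)) = (\<integral>x. f x \<partial>inputs F)"
    and "integrable (Pi\<^sub>M J (\<lambda>_. F)) f \<longleftrightarrow> integrable (inputs F) f"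
proof -
  have d: "distr (inputs F) (Pi\<^sub>M J (\<lambda>_. F)) (\<lambda>x. \<lambda>n\<in>J. x n) = Pi\<^sub>M J (\<lambda>_. F)"
    using distr_PiM_reindex[of UNIV "\<lambda>_. F" "\<lambda>x. x" J] laws_uptoD(1)[OF F] by simp
  have m: "(\<lambda>x. \<lambda>n\<in>J. x n) \<in> inputs F \<rightarrow>\<^sub>M Pi\<^sub>M J (\<lambda>_. F)"
    by (rule measurable_restrict) auto
  show "(\<integral>x. f x \<partial>Pi\<^sub>M J (\<lambda>_. F)) = (\<integral>x. f x \<partial>inputs F)"
    by (subst d[symmetric], subst integral_distr[OF m f]) (simp add: dep)
  show "integrable (Pi\<^sub>M J (\<lambda>_. F)) f \<longleftrightarrow> integrable (inputs F) f"
    by (subst d[symmetric], subst integrable_distr_eq[OF m f]) (simp add: dep)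
qed

lemma crate_restrict:
  assumes "{s - int L..s} - {j} \<subseteq> J"
  shows "cr j z (restrict x J) s = cr j z x s"
  unfolding crate_def using assms by (intro arg_cong2[where f="(+)"] sum.cong refl) (auto simp: subset_iff)

lemma window_kernel_eq: "window_kernel L lam0 h a b j z y = ckernel {a..b} j z y"
  by (rule ext) (simp add: window_kernel_def ckernel_def)

lemma fixed_prob_eq:
  assumes F: "F \<in> laws"
  shows "fixed_prob L lam0 h F a b j z y = cmass F {a..b} j z y"
    and "integrable (Pi\<^sub>M ({a - int L..b} - {j}) (\<lambda>_. F)) (window_kernel L lam0 h a b j z y)"
proof -
  let ?J = "{a - int L..b} - {j}"
  have sub: "{s - int L..s} - {j} \<subseteq> ?J" if "s \<in> {a..b}" for s using that by auto
  have m: "ckernel {a..b} j z y \<in> borel_measurable (Pi\<^sub>M ?J (\<lambda>_. F))"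
    by (rule measurable_ckernel[OF F sub])
  have d: "ckernel {a..b} j z y (restrict x ?J) = ckernel {a..b} j z y x" for x
    unfolding ckernel_def by (intro prod.cong refl arg_cong2[where f=poisson_kernel] crate_restrict sub)
  note * = integral_PiM_restrict[OF F m d]
  show "fixed_prob L lam0 h F a b j z y = cmass F {a..b} j z y"
    unfolding fixed_prob_def window_kernel_eq cmass_def by (rule *(1))
  show "integrable (Pi\<^sub>M ?J (\<lambda>_. F)) (window_kernel L lam0 h a b j z y)"
    unfolding window_kernel_eq *(2) by (rule integrable_ckernel[OF F])
qed

lemma prob_output_kernel: "prob_space (okernel x)" "sets (okernel x) = sets outputs" "space (okernel x) = UNIV"
  unfolding output_kernel_def
  by (auto intro!: prob_space_PiM prob_space_measure_pmf sets_PiM_cong simp: space_PiM)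

lemma emeasure_output_kernel_box:
  assumes x: "\<And>k. 0 \<le> x k \<and> x k \<le> A" and J: "finite J"
  shows "emeasure (okernel x) (prod_emb UNIV (\<lambda>_. count_space UNIV) J (Pi\<^sub>E J E))
    = (\<Prod>s\<in>J. emeasure (measure_pmf (poisson_pmf (rt x s))) (E s))"
proof -
  interpret product_prob_space "\<lambda>s. measure_pmf (poisson_pmf (rt x s))" "UNIV :: int set"
    by unfold_locales
  show ?thesis
    using emeasure_PiM_emb[of J E] J unfolding output_kernel_def
    by (simp add: prod_emb_def)
qed

lemma measure_output_kernel_cylinder:
  assumes x: "\<And>k. 0 \<le> x k \<and> x k \<le> A" and I: "finite I"
  shows "measure (okernel x) (cylinder I y) = (\<Prod>s\<in>I. poisson_weight (rt x s) (y s))"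
proof -
  have "cylinder I y = prod_emb UNIV (\<lambda>_. count_space UNIV) I (Pi\<^sub>E I (\<lambda>s. {y s}))"
    by (auto simp: cylinder_def prod_emb_def PiE_iff)
  then have "emeasure (okernel x) (cylinder I y) = (\<Prod>s\<in>I. ennreal (poisson_weight (rt x s) (y s)))"
    using emeasure_output_kernel_box[of x I "\<lambda>s. {y s}", OF x I] rate_bounds(3)[of x, OF x]
    by (simp add: emeasure_pmf_single pmf_poisson_weight del: pmf_poisson)
  then show ?thesis
    by (simp add: measure_def prod_ennreal weight_bounds[OF x] prod_nonneg)
qed

lemma measurable_output_kernel:
  assumes F: "F \<in> laws" shows "okernel \<in> inputs F \<rightarrow>\<^sub>M prob_algebra outputs"
proof (rule measurable_prob_algebra_generated[OF sets_PiM Int_stable_prod_algebra prod_algebra_sets_into_space])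
  fix E :: "(int \<Rightarrow> nat) set" assume "E \<in> prod_algebra UNIV (\<lambda>_. count_space UNIV)"
  then obtain J X where E: "(E :: (int \<Rightarrow> nat) set) = prod_emb UNIV (\<lambda>_. count_space UNIV) J (Pi\<^sub>E J X)" and J: "finite J"
    by (force elim!: prod_algebraE)
  have "(\<lambda>x. \<Prod>s\<in>J. emeasure (measure_pmf (poisson_pmf (rt x s))) (X s)) \<in> borel_measurable (inputs F)"
  proof (intro borel_measurable_prod_ennreal)
    fix s
    have "(\<lambda>x. \<integral>\<^sup>+k. ennreal (poisson_weight (rt x s) k) * indicator (X s) k \<partial>count_space UNIV)
        \<in> borel_measurable (inputs F)"
      by (subst nn_integral_count_space_nat)
         (intro borel_measurable_suminf_order borel_measurable_times_ennreal borel_measurable_const measurable_compose[OF _ measurable_ennreal]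
            measurable_compose[OF measurable_rate[OF F] measurable_poisson_weight])
    moreover have "emeasure (measure_pmf (poisson_pmf (rt x s))) (X s)
        = (\<integral>\<^sup>+k. ennreal (poisson_weight (rt x s) k) * indicator (X s) k \<partial>count_space UNIV)" if "x \<in> space (inputs F)" for x
    proof -
      have "rt x s > 0" using that rate_bounds(3)[of x s] by (auto simp: space_inputs[OF F])
      then show ?thesis
        by (subst nn_integral_pmf[symmetric]) (simp add: nn_integral_count_space_indicator pmf_poisson_weight del: pmf_poisson)
    qed
    ultimately show "(\<lambda>x. emeasure (measure_pmf (poisson_pmf (rt x s))) (X s)) \<in> borel_measurable (inputs F)"
      by (simp cong: measurable_cong)
  qed
  moreover have "emeasure (okernel x) E = (\<Prod>s\<in>J. emeasure (measure_pmf (poisson_pmf (rt x s))) (X s))" if "x \<in> space (inputs F)" for x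
    unfolding E by (rule emeasure_output_kernel_box[OF _ J]) (use that in \<open>auto simp: space_inputs[OF F]\<close>)
  ultimately show "(\<lambda>x. emeasure (okernel x) E) \<in> borel_measurable (inputs F)"
    by (simp cong: measurable_cong)
qed (auto simp: prob_output_kernel)

lemma measurable_fix_input:
  assumes F: "F \<in> laws" and u: "u \<in> {0..A}"
  shows "(\<lambda>x. x(j := u)) \<in> inputs F \<rightarrow>\<^sub>M inputs F"
proof (rule measurable_PiM_single')
  fix i show "(\<lambda>x. (x(j := u)) i) \<in> inputs F \<rightarrow>\<^sub>M F"
    using u laws_uptoD(3)[OF F] by (cases "i = j") (auto intro: measurable_component_singleton)
qed (use laws_uptoD(3)[OF F] u in \<open>auto simp: space_PiM PiE_iff\<close>)

lemma measurable_output_kernel_fix: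
  assumes F: "F \<in> laws" and u: "u \<in> {0..A}"
  shows "(\<lambda>x. okernel (x(j := u))) \<in> inputs F \<rightarrow>\<^sub>M prob_algebra outputs"
  by (rule measurable_compose[OF measurable_fix_input[OF assms] measurable_output_kernel[OF F]])

lemma output_law_basic:
  assumes F: "F \<in> laws"
  shows "prob_space (olaw F)" "sets (olaw F) = sets outputs" "space (olaw F) = UNIV"
proof -
  interpret prob_space "inputs F" by (rule prob_inputs[OF F])
  have i: "inputs F \<in> space (prob_algebra (inputs F))" by (simp add: space_prob_algebra prob_space_axioms)
  show "prob_space (olaw F)"
    unfolding output_law_def by (rule prob_space_bind'[OF i measurable_output_kernel[OF F]])
  show s: "sets (olaw F) = sets outputs"
    unfolding output_law_def by (rule sets_bind) (use not_empty in \<open>auto simp: prob_output_kernel\<close>)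
  show "space (olaw F) = UNIV" using sets_eq_imp_space_eq[OF s] by (simp add: space_PiM)
qed

lemma output_law_fixed_basic:
  assumes F: "F \<in> laws" and u: "u \<in> {0..A}"
  shows "prob_space (olawx F j u)" "sets (olawx F j u) = sets outputs" "space (olawx F j u) = UNIV"
proof -
  interpret prob_space "inputs F" by (rule prob_inputs[OF F])
  have i: "inputs F \<in> space (prob_algebra (inputs F))" by (simp add: space_prob_algebra prob_space_axioms)
  show "prob_space (olawx F j u)"
    unfolding output_law_fixed_def by (rule prob_space_bind'[OF i measurable_output_kernel_fix[OF assms]])
  show s: "sets (olawx F j u) = sets outputs"
    unfolding output_law_fixed_def by (rule sets_bind) (use not_empty in \<open>auto simp: prob_output_kernel\<close>)
  show "space (olawx F j u) = UNIV" using sets_eq_imp_space_eq[OF s] by (simp add: space_PiM)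
qed

definition bmass :: "real measure \<Rightarrow> int set \<Rightarrow> (int \<Rightarrow> nat) \<Rightarrow> real" where
  "bmass F I y = measure (olaw F) (cylinder I y)"

definition rkernel :: "int set \<Rightarrow> (int \<Rightarrow> nat) \<Rightarrow> (int \<Rightarrow> real) \<Rightarrow> real" where
  "rkernel I y x = (\<Prod>s\<in>I. poisson_weight (rt x s) (y s))"

lemma measurable_rkernel: "F \<in> laws \<Longrightarrow> rkernel I y \<in> borel_measurable (inputs F)"
  unfolding rkernel_def[abs_def]
  by (intro borel_measurable_prod measurable_compose[OF measurable_rate measurable_poisson_weight])

lemma rkernel_bounds:
  assumes "\<And>k. 0 \<le> x k \<and> x k \<le> A"
  shows "0 \<le> rkernel I y x" "(\<Prod>s\<in>I. lbound (y s)) \<le> rkernel I y x" "rkernel I y x \<le> (\<Prod>s\<in>I. ubound 0 (y s))"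
  unfolding rkernel_def
  by (intro prod_nonneg prod_mono ballI conjI weight_bounds assms less_imp_le[OF lbound_pos])+

lemma integrable_rkernel: "F \<in> laws \<Longrightarrow> integrable (inputs F) (rkernel I y)"
proof -
  assume F: "F \<in> laws"
  interpret prob_space "inputs F" by (rule prob_inputs[OF F])
  show ?thesis
    by (rule integrable_const_bound[where B="\<Prod>s\<in>I. ubound 0 (y s)"])
      (use F rkernel_bounds in \<open>auto simp: space_inputs intro!: measurable_rkernel\<close>)
qed

lemma bmass_eq:
  assumes F: "F \<in> laws" and I: "finite I"
  shows "bmass F I y = (\<integral>x. rkernel I y x \<partial>inputs F)"
proof -
  interpret prob_space "inputs F" by (rule prob_inputs[OF F])
  have "bmass F I y = (\<integral>x. measure (okernel x) (cylinder I y) \<partial>inputs F)"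
    unfolding bmass_def output_law_def
    by (rule measure_bind[OF measurable_prob_algebraD[OF measurable_output_kernel[OF F]] cylinder_sets[OF I]])
  also have "\<dots> = (\<integral>x. rkernel I y x \<partial>inputs F)"
    by (rule Bochner_Integration.integral_cong)
      (auto simp: rkernel_def space_inputs[OF F] intro!: measure_output_kernel_cylinder I)
  finally show ?thesis .
qed

lemma block_prob_eq: "block_prob L lam0 h F a b y = bmass F {a..b} y"
  by (simp add: block_prob_def bmass_def)

lemma ckernel_unaffected:
  assumes "I \<inter> {j..j + int L} = {}"
  shows "ckernel I j z y x = of_real (rkernel I y x)"
  unfolding ckernel_def rkernel_def of_real_prod
  by (rule prod.cong[OF refl]) (use assms in \<open>auto simp: poisson_kernel_of_real[symmetric] intro!: arg_cong2[where f=poisson_kernel] crate_unaffected\<close>)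

text \<open>Placing the fixed symbol out of reach makes the baseline law a special case of a
  complexified law, so each estimate for the latter covers the former.\<close>

lemma cmass_unaffected:
  assumes F: "F \<in> laws" and I: "finite I" "I \<inter> {j..j + int L} = {}"
  shows "cmass F I j z y = of_real (bmass F I y)"
  unfolding cmass_def ckernel_unaffected[OF I(2)] bmass_eq[OF F I(1)] by simp

lemma cmass_of_real:
  assumes F: "F \<in> laws" and u: "u \<in> {0..A}" and I: "finite I"
  shows "cmass F I j (of_real u) y = of_real (measure (olawx F j u) (cylinder I y))"
proof -
  interpret prob_space "inputs F" by (rule prob_inputs[OF F])
  have "measure (olawx F j u) (cylinder I y) = (\<integral>x. measure (okernel (x(j := u))) (cylinder I y) \<partial>inputs F)"
    unfolding output_law_fixed_def
    by (rule measure_bind[OF measurable_prob_algebraD[OF measurable_output_kernel_fix[OF F u]] cylinder_sets[OF I]])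
  also have "\<dots> = (\<integral>x. rkernel I y (x(j := u)) \<partial>inputs F)"
    by (rule Bochner_Integration.integral_cong)
      (use u in \<open>auto simp: rkernel_def space_inputs[OF F] intro!: measure_output_kernel_cylinder I\<close>)
  also have "of_real \<dots> = cmass F I j (of_real u) y"
    unfolding cmass_def ckernel_def crate_of_real poisson_kernel_of_real rkernel_def
    by (simp flip: of_real_prod)
  finally show ?thesis ..
qed

lemma bmass_bounds:
  assumes F: "F \<in> laws" and I: "finite I"
  shows "(\<Prod>s\<in>I. lbound (y s)) \<le> bmass F I y" "bmass F I y \<le> (\<Prod>s\<in>I. ubound 0 (y s))" "bmass F I y > 0" "bmass F I y \<le> 1"
proof -
  interpret prob_space "inputs F" by (rule prob_inputs[OF F])
  have "(\<integral>x. (\<Prod>s\<in>I. lbound (y s)) \<partial>inputs F) \<le> (\<integral>x. rkernel I y x \<partial>inputs F)"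
    by (rule integral_mono) (use F rkernel_bounds in \<open>auto simp: space_inputs intro!: integrable_rkernel\<close>)
  then show l: "(\<Prod>s\<in>I. lbound (y s)) \<le> bmass F I y" by (simp add: bmass_eq[OF assms] prob_space)
  then show "bmass F I y > 0" using lbound_pos by (smt (verit) prod_pos)
  have "(\<integral>x. rkernel I y x \<partial>inputs F) \<le> (\<integral>x. (\<Prod>s\<in>I. ubound 0 (y s)) \<partial>inputs F)"
    by (rule integral_mono) (use F rkernel_bounds in \<open>auto simp: space_inputs intro!: integrable_rkernel\<close>)
  then show "bmass F I y \<le> (\<Prod>s\<in>I. ubound 0 (y s))" by (simp add: bmass_eq[OF assms] prob_space)
  show "bmass F I y \<le> 1" unfolding bmass_def
    using output_law_basic(1)[OF F] prob_space.prob_le_1 by blast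
qed

section \<open>Marginals of the complexified laws\<close>

lemma ubound_norm_summable: "B \<ge> 0 \<Longrightarrow> b \<ge> 0 \<Longrightarrow> (\<lambda>k. norm (b ^ k * ubound B k)) summable_on UNIV"
  using ubound_has_sum[of b B] ubound_pos[of B] by (auto simp: has_sum_imp_summable less_imp_le)

lemma prod_ubound_summable:
  assumes "finite I" "B \<ge> 0" "b \<ge> 0"
  shows "(\<lambda>y. \<Prod>s\<in>I. b ^ y s * ubound B (y s)) summable_on PiE I (\<lambda>_. UNIV)"
  using has_sum_prod_PiE(2)[OF assms(1), of "\<lambda>_ k. b ^ k * ubound B k"] ubound_norm_summable[OF assms(2,3)]
  by (auto simp: has_sum_imp_summable)

text \<open>Consistency of the complexified laws: exp(-\<zeta>) times the exponential series is 1
  for every complex \<zeta>, so summing out the outputs in \<open>J\<close> leaves exactly the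
  kernels on \<open>I\<close>.\<close>

lemma cmass_marginal:
  assumes F: "F \<in> laws" and fin: "finite I" "finite J" and disj: "I \<inter> J = {}"
  shows "((\<lambda>u. cmass F (I \<union> J) j z (\<lambda>s. if s \<in> J then u s else y s)) has_sum cmass F I j z y) (PiE J (\<lambda>_. UNIV))"
proof -
  define B where "B = norm z"
  have B: "B \<ge> 0" "norm z \<le> B" by (auto simp: B_def)
  let ?m = "\<lambda>u s. if s \<in> J then u s else y s"
  have split: "(\<Prod>s\<in>I \<union> J. c s (?m u s)) = (\<Prod>s\<in>I. c s (y s)) * (\<Prod>s\<in>J. c s (u s))"
    for c :: "int \<Rightarrow> nat \<Rightarrow> 'c::comm_monoid_mult" and u
  proof -
    have "(\<Prod>s\<in>I \<union> J. c s (?m u s)) = (\<Prod>s\<in>I. c s (?m u s)) * (\<Prod>s\<in>J. c s (?m u s))"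
      by (rule prod.union_disjoint) (use fin disj in auto)
    also have "(\<Prod>s\<in>I. c s (?m u s)) = (\<Prod>s\<in>I. c s (y s))"
      by (rule prod.cong) (use disj in auto)
    also have "(\<Prod>s\<in>J. c s (?m u s)) = (\<Prod>s\<in>J. c s (u s))"
      by (rule prod.cong) auto
    finally show ?thesis .
  qed
  show ?thesis unfolding cmass_def
  proof (rule has_sum_integral[OF prob_inputs[OF F]])
    fix x u assume x: "x \<in> space (inputs F)"
    then have "norm (ckernel (I \<union> J) j z (?m u) x) \<le> (\<Prod>s\<in>I \<union> J. ubound B (?m u s))"
      using B by (intro norm_ckernel_le) (auto simp: space_inputs[OF F])
    also have "\<dots> = (\<Prod>s\<in>I. ubound B (y s)) * (\<Prod>s\<in>J. ubound B (u s))" by (rule split)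
    finally show "norm (ckernel (I \<union> J) j z (?m u) x) \<le> (\<Prod>s\<in>I. ubound B (y s)) * (\<Prod>s\<in>J. ubound B (u s))" .
  next
    show "(\<lambda>u. (\<Prod>s\<in>I. ubound B (y s)) * (\<Prod>s\<in>J. ubound B (u s))) summable_on PiE J (\<lambda>_. UNIV)"
      using prod_ubound_summable[OF fin(2) B(1), of 1] by (intro summable_on_cmult_right) simp
  next
    fix x assume "x \<in> space (inputs F)"
    then have x: "0 \<le> x k \<and> x k \<le> A" for k by (auto simp: space_inputs[OF F])
    have abs: "(\<lambda>k. norm (poisson_kernel (cr j z x s) k)) summable_on UNIV" for s
      by (rule Infinite_Sum.summable_on_comparison_test[where f="ubound B"])
        (use norm_kernel_le_ubound[OF x B(2)] ubound_norm_summable[OF B(1), of 1] ubound_pos[OF B(1)] in \<open>auto simp: less_imp_le\<close>)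
    have "((\<lambda>u. \<Prod>s\<in>J. poisson_kernel (cr j z x s) (u s)) has_sum (\<Prod>s\<in>J. infsum (poisson_kernel (cr j z x s)) UNIV)) (PiE J (\<lambda>_. UNIV))"
      by (rule has_sum_prod_PiE(2)[OF fin(2) abs])
    then have "((\<lambda>u. \<Prod>s\<in>J. poisson_kernel (cr j z x s) (u s)) has_sum 1) (PiE J (\<lambda>_. UNIV))"
      by (simp add: infsumI[OF poisson_kernel_has_sum])
    from has_sum_cmult_right[OF this, of "ckernel I j z y x"]
    show "((\<lambda>u. ckernel (I \<union> J) j z (?m u) x) has_sum ckernel I j z y x) (PiE J (\<lambda>_. UNIV))"
      unfolding ckernel_def split[of "\<lambda>s. poisson_kernel (cr j z x s)"] by simp
  qed (intro measurable_ckernel F subset_UNIV)+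
qed

lemma cmass_weighted_summable:
  assumes F: "F \<in> laws" and fin: "finite I" and b: "b \<ge> 0"
    and dom: "\<And>y. \<bar>\<phi> y\<bar> \<le> c * (\<Prod>s\<in>I. b ^ y s)"
  shows "(\<lambda>y. norm (of_real (\<phi> y) * cmass F I j z y)) summable_on PiE I (\<lambda>_. UNIV)"
proof (rule Infinite_Sum.summable_on_comparison_test)
  show "(\<lambda>y. c * (\<Prod>s\<in>I. b ^ y s * ubound (norm z) (y s))) summable_on PiE I (\<lambda>_. UNIV)"
    by (intro summable_on_cmult_right prod_ubound_summable fin b) auto
  fix y
  have "norm (of_real (\<phi> y) * cmass F I j z y) \<le> (c * (\<Prod>s\<in>I. b ^ y s)) * (\<Prod>s\<in>I. ubound (norm z) (y s))"
    unfolding norm_mult by (intro mult_mono) (use dom[of y] norm_cmass_le[OF F, of z "norm z"] in \<open>auto intro: order_trans[OF abs_ge_zero dom]\<close>)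
  then show "norm (of_real (\<phi> y) * cmass F I j z y) \<le> c * (\<Prod>s\<in>I. b ^ y s * ubound (norm z) (y s))"
    by (simp add: prod.distrib mult.assoc)
qed auto

lemma cmass_weighted_marginal:
  assumes F: "F \<in> laws" and fin: "finite I" "finite J" and disj: "I \<inter> J = {}" and b: "b \<ge> 1"
    and dom: "\<And>y. \<bar>\<phi> y\<bar> \<le> c * (\<Prod>s\<in>I. b ^ y s)"
    and dep: "\<And>y y'. (\<And>s. s \<in> I \<Longrightarrow> y s = y' s) \<Longrightarrow> \<phi> y = \<phi> y'"
  shows "(\<Sum>\<^sub>\<infinity>y\<in>PiE (I \<union> J) (\<lambda>_. UNIV). of_real (\<phi> y) * cmass F (I \<union> J) j z y)
    = (\<Sum>\<^sub>\<infinity>y\<in>PiE I (\<lambda>_. UNIV). of_real (\<phi> y) * cmass F I j z y)"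
proof -
  let ?m = "\<lambda>(y, u). \<lambda>s. if s \<in> J then u s else (y s :: nat)"
  let ?f = "\<lambda>y. of_real (\<phi> y) * cmass F (I \<union> J) j z y"
  have c: "c \<ge> 0"
  proof -
    have "0 \<le> c * (\<Prod>s\<in>I. b ^ 0)" using dom[of "\<lambda>_. 0"] abs_ge_zero order_trans by blast
    then show ?thesis by simp
  qed
  have dom': "\<bar>\<phi> y\<bar> \<le> c * (\<Prod>s\<in>I \<union> J. b ^ y s)" for y
  proof -
    have "(\<Prod>s\<in>I. b ^ y s) \<le> (\<Prod>s\<in>I \<union> J. b ^ y s)"
      by (rule prod_mono2) (use fin b in auto)
    then show ?thesis using dom[of y] c by (meson mult_left_mono order_trans)
  qed
  have "?f summable_on PiE (I \<union> J) (\<lambda>_. UNIV)"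
    by (rule abs_summable_summable, rule cmass_weighted_summable[OF F _ _ dom']) (use fin b in auto)
  then have "(?f has_sum infsum ?f (PiE (I \<union> J) (\<lambda>_. UNIV))) (PiE (I \<union> J) (\<lambda>_. UNIV))" by simp
  then have 1: "((\<lambda>p. ?f (?m p)) has_sum infsum ?f (PiE (I \<union> J) (\<lambda>_. UNIV)))
      (PiE I (\<lambda>_. UNIV) \<times> PiE J (\<lambda>_. UNIV))"
    using has_sum_reindex_bij_betw[OF merge_window_bij[OF disj], of ?f] by simp
  have "((\<lambda>y. of_real (\<phi> y) * cmass F I j z y) has_sum infsum ?f (PiE (I \<union> J) (\<lambda>_. UNIV))) (PiE I (\<lambda>_. UNIV))"
  proof (rule has_sum_SigmaD[OF 1])
    fix y
    have p: "\<phi> (?m (y, u)) = \<phi> y" for u by (rule dep) (use disj in auto)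
    show "((\<lambda>u. ?f (?m (y, u))) has_sum of_real (\<phi> y) * cmass F I j z y) (PiE J (\<lambda>_. UNIV))"
      unfolding p using has_sum_cmult_right[OF cmass_marginal[OF F fin disj, of j z y]] by simp
  qed
  then show ?thesis by (simp add: infsumI)
qed

section \<open>Exchanging the futures of two independent input copies\<close>

definition swap_after :: "int \<Rightarrow> (int \<Rightarrow> real) \<times> (int \<Rightarrow> real) \<Rightarrow> (int \<Rightarrow> real) \<times> (int \<Rightarrow> real)" where
  "swap_after k = (\<lambda>(x, x'). (\<lambda>i. if i > k then x' i else x i, \<lambda>i. if i > k then x i else x' i))"

text \<open>A pair of copies is one i.i.d. family indexed by \<open>int \<times> bool\<close>. There
  the exchange of futures is a permutation of indices, and invariance of the product law under it is
  immediate.\<close>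

lemma distr_merge_copies:
  assumes F: "F \<in> laws"
  defines "N \<equiv> \<Pi>\<^sub>M p\<in>(UNIV :: (int \<times> bool) set). F"
  defines "mrg \<equiv> \<lambda>(x :: int \<Rightarrow> real, x'). \<lambda>(i, b). if b then x i else x' i"
  shows "mrg \<in> inputs F \<Otimes>\<^sub>M inputs F \<rightarrow>\<^sub>M N" "distr (inputs F \<Otimes>\<^sub>M inputs F) N mrg = N"
proof -
  interpret P: prob_space "inputs F" by (rule prob_inputs[OF F])
  interpret PP: pair_prob_space "inputs F" "inputs F" ..
  interpret N: prob_space N unfolding N_def by (intro prob_space_PiM laws_uptoD(1)[OF F])
  interpret Q: product_prob_space "\<lambda>_. F" "UNIV :: (int \<times> bool) set"
    by (intro product_prob_spaceI laws_uptoD(1)[OF F])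
  interpret Q1: product_prob_space "\<lambda>_. F" "UNIV :: int set"
    by (intro product_prob_spaceI laws_uptoD(1)[OF F])
  show m: "mrg \<in> inputs F \<Otimes>\<^sub>M inputs F \<rightarrow>\<^sub>M N"
    unfolding N_def
  proof (rule measurable_PiM_single')
    fix p :: "int \<times> bool"
    obtain i b where p: "p = (i, b)" by force
    have "(\<lambda>\<omega>. fst \<omega> i) \<in> inputs F \<Otimes>\<^sub>M inputs F \<rightarrow>\<^sub>M F" "(\<lambda>\<omega>. snd \<omega> i) \<in> inputs F \<Otimes>\<^sub>M inputs F \<rightarrow>\<^sub>M F"
      by (auto intro: measurable_compose[OF measurable_fst] measurable_compose[OF measurable_snd])
    then show "(\<lambda>\<omega>. mrg \<omega> p) \<in> inputs F \<Otimes>\<^sub>M inputs F \<rightarrow>\<^sub>M F"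
      by (cases b) (auto simp: mrg_def p case_prod_unfold)
  next
    show "mrg \<in> space (inputs F \<Otimes>\<^sub>M inputs F) \<rightarrow> UNIV \<rightarrow>\<^sub>E space F"
      by (auto simp: mrg_def space_pair_measure space_PiM PiE_iff)
  qed
  show "distr (inputs F \<Otimes>\<^sub>M inputs F) N mrg = N"
  proof (rule measure_eqI_PiM_infinite[where I=UNIV and M="\<lambda>_. F"])
    fix E :: "int \<times> bool \<Rightarrow> real set" and J :: "(int \<times> bool) set"
    assume J: "finite J" and E: "\<And>p. p \<in> J \<Longrightarrow> E p \<in> sets F"
    let ?J = "\<lambda>b. {i. (i, b) \<in> J}"
    have fJ: "finite (?J b)" for b
      using finite_imageI[OF J, of fst] by (rule finite_subset[rotated]) force
    let ?X = "\<lambda>b. prod_emb UNIV (\<lambda>_. F) (?J b) (PiE (?J b) (\<lambda>i. E (i, b)))"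
    have sX: "?X b \<in> sets (inputs F)" for b
      by (rule sets_PiM_I) (use fJ E in auto)
    have eX: "emeasure (inputs F) (?X b) = (\<Prod>i\<in>?J b. emeasure F (E (i, b)))" for b
      by (rule Q1.emeasure_PiM_emb) (use fJ E in auto)
    have sub: "mrg -` prod_emb UNIV (\<lambda>_. F) J (Pi\<^sub>E J E) \<inter> space (inputs F \<Otimes>\<^sub>M inputs F) = ?X True \<times> ?X False"
    proof -
      have ball: "(\<forall>p\<in>J. Q p) \<longleftrightarrow> (\<forall>i\<in>?J True. Q (i, True)) \<and> (\<forall>i\<in>?J False. Q (i, False))" for Q
      proof (intro iffI ballI)
        fix p assume *: "(\<forall>i\<in>?J True. Q (i, True)) \<and> (\<forall>i\<in>?J False. Q (i, False))" and p: "p \<in> J"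
        obtain i b where ib: "p = (i, b)" by force
        show "Q p" using * p unfolding ib by (cases b) auto
      qed auto
      show ?thesis
        by (rule set_eqI) (auto simp: mrg_def prod_emb_def space_pair_measure space_PiM PiE_iff ball)
    qed
    have "emeasure (distr (inputs F \<Otimes>\<^sub>M inputs F) N mrg) (prod_emb UNIV (\<lambda>_. F) J (Pi\<^sub>E J E))
        = emeasure (inputs F \<Otimes>\<^sub>M inputs F) (?X True \<times> ?X False)"
      unfolding sub[symmetric] by (rule emeasure_distr[OF m]) (use J E in \<open>auto simp: N_def intro!: sets_PiM_I\<close>)
    also have "\<dots> = emeasure (inputs F) (?X True) * emeasure (inputs F) (?X False)"
      by (rule P.emeasure_pair_measure_Times[OF sX sX])
    also have "\<dots> = (\<Prod>p\<in>J. emeasure F (E p))"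
    proof -
      have JU: "J = (\<lambda>i. (i, True)) ` ?J True \<union> (\<lambda>i. (i, False)) ` ?J False"
      proof (rule set_eqI)
        fix p :: "int \<times> bool"
        obtain i b where p: "p = (i, b)" by force
        show "p \<in> J \<longleftrightarrow> p \<in> (\<lambda>i. (i, True)) ` ?J True \<union> (\<lambda>i. (i, False)) ` ?J False"
          unfolding p by (cases b) auto
      qed
      have "(\<Prod>p\<in>J. emeasure F (E p)) = (\<Prod>p\<in>(\<lambda>i. (i, True)) ` ?J True. emeasure F (E p)) * (\<Prod>p\<in>(\<lambda>i. (i, False)) ` ?J False. emeasure F (E p))"
        by (subst JU, rule prod.union_disjoint) (use fJ in auto)
      then show ?thesis unfolding eX by (simp add: prod.reindex inj_on_def)
    qed
    also have "\<dots> = emeasure N (prod_emb UNIV (\<lambda>_. F) J (Pi\<^sub>E J E))"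
      unfolding N_def by (rule Q.emeasure_PiM_emb[symmetric]) (use J E in auto)
    finally show "emeasure (distr (inputs F \<Otimes>\<^sub>M inputs F) N mrg) (prod_emb UNIV (\<lambda>_. F) J (Pi\<^sub>E J E))
        = emeasure N (prod_emb UNIV (\<lambda>_. F) J (Pi\<^sub>E J E))" .
  next
    show "finite_measure (distr (inputs F \<Otimes>\<^sub>M inputs F) N mrg)"
      by (intro prob_space.finite_measure PP.prob_space_distr m)
  qed (simp_all add: N_def)
qed

lemma measurable_swap_after:
  assumes F: "F \<in> laws"
  shows "swap_after k \<in> inputs F \<Otimes>\<^sub>M inputs F \<rightarrow>\<^sub>M inputs F \<Otimes>\<^sub>M inputs F"
proof -
  have f: "(\<lambda>\<omega>. fst \<omega> i) \<in> inputs F \<Otimes>\<^sub>M inputs F \<rightarrow>\<^sub>M F"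
    and s: "(\<lambda>\<omega>. snd \<omega> i) \<in> inputs F \<Otimes>\<^sub>M inputs F \<rightarrow>\<^sub>M F" for i
    by (auto intro: measurable_compose[OF measurable_fst] measurable_compose[OF measurable_snd])
  have "(\<lambda>\<omega>. (\<lambda>i. if i > k then snd \<omega> i else fst \<omega> i, \<lambda>i. if i > k then fst \<omega> i else snd \<omega> i))
      \<in> inputs F \<Otimes>\<^sub>M inputs F \<rightarrow>\<^sub>M inputs F \<Otimes>\<^sub>M inputs F"
    by (intro measurable_Pair measurable_PiM_single')
      (auto simp: f s space_pair_measure space_PiM PiE_iff)
  then show ?thesis by (simp add: swap_after_def case_prod_unfold)
qed

lemma distr_swap_after:
  assumes F: "F \<in> laws"
  shows "distr (inputs F \<Otimes>\<^sub>M inputs F) (inputs F \<Otimes>\<^sub>M inputs F) (swap_after k) = inputs F \<Otimes>\<^sub>M inputs F"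
proof -
  let ?MM = "inputs F \<Otimes>\<^sub>M inputs F"
  define N where "N = (\<Pi>\<^sub>M p\<in>(UNIV :: (int \<times> bool) set). F)"
  define mrg where "mrg = (\<lambda>(x :: int \<Rightarrow> real, x' :: int \<Rightarrow> real). \<lambda>(i, b). if b then x i else x' i)"
  define spl where "spl = (\<lambda>\<omega> :: int \<times> bool \<Rightarrow> real. (\<lambda>i. \<omega> (i, True), \<lambda>i. \<omega> (i, False)))"
  define f where "f = (\<lambda>(i, b). (i :: int, if i > k then \<not> b else b))"
  define R where "R = (\<lambda>\<omega> :: int \<times> bool \<Rightarrow> real. \<lambda>p\<in>UNIV. \<omega> (f p))"
  note m = distr_merge_copies[OF F, folded N_def mrg_def]
  have s: "spl \<in> N \<rightarrow>\<^sub>M ?MM"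
    unfolding spl_def N_def by (intro measurable_Pair measurable_PiM_single') (auto simp: space_PiM PiE_iff)
  have Rm: "R \<in> N \<rightarrow>\<^sub>M N"
    unfolding R_def N_def by (rule measurable_restrict) auto
  have RN: "distr N N R = N"
    unfolding R_def N_def using distr_PiM_reindex[of UNIV "\<lambda>_. F" f UNIV] laws_uptoD(1)[OF F]
    by (auto simp: f_def inj_on_def)
  have sw: "swap_after k \<omega> = spl (R (mrg \<omega>))" and id: "spl (mrg \<omega>) = \<omega>" for \<omega>
    by (auto simp: swap_after_def spl_def R_def mrg_def f_def fun_eq_iff case_prod_unfold)
  have "distr ?MM ?MM (swap_after k) = distr ?MM ?MM ((spl \<circ> R) \<circ> mrg)"
    by (rule distr_cong) (auto simp: sw)
  also have "\<dots> = distr (distr ?MM N mrg) ?MM (spl \<circ> R)"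
    by (rule distr_distr[OF measurable_comp[OF Rm s] m(1), symmetric])
  also have "\<dots> = distr N ?MM (spl \<circ> R)" unfolding m(2) ..
  also have "\<dots> = distr (distr N N R) ?MM spl" by (rule distr_distr[OF s Rm, symmetric])
  also have "\<dots> = distr (distr ?MM N mrg) ?MM spl" unfolding m(2) RN ..
  also have "\<dots> = distr ?MM ?MM (spl \<circ> mrg)" by (rule distr_distr[OF s m(1)])
  also have "\<dots> = distr ?MM ?MM (\<lambda>\<omega>. \<omega>)" by (rule distr_cong) (auto simp: id)
  also have "\<dots> = ?MM" by (rule distr_id)
  finally show ?thesis .
qed

text \<open>The integral equals its own negative.\<close>

lemma integral_swap_antisym:
  fixes G :: "(int \<Rightarrow> real) \<times> (int \<Rightarrow> real) \<Rightarrow> real"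
  assumes F: "F \<in> laws" and G: "G \<in> borel_measurable (inputs F \<Otimes>\<^sub>M inputs F)"
    and anti: "\<And>\<omega>. G (swap_after k \<omega>) = - G \<omega>"
  shows "(\<integral>\<omega>. G \<omega> \<partial>(inputs F \<Otimes>\<^sub>M inputs F)) = 0"
proof -
  have "(\<integral>\<omega>. G \<omega> \<partial>(inputs F \<Otimes>\<^sub>M inputs F)) = (\<integral>\<omega>. G (swap_after k \<omega>) \<partial>(inputs F \<Otimes>\<^sub>M inputs F))"
    by (subst distr_swap_after[OF F, of k, symmetric], rule integral_distr[OF measurable_swap_after[OF F] G])
  then show ?thesis by (simp add: anti)
qed

lemma rate_cong: "(\<And>i. s - int L \<le> i \<Longrightarrow> i \<le> s \<Longrightarrow> x i = x' i) \<Longrightarrow> rt x s = rt x' s"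
  unfolding rate_def by (intro arg_cong2[where f="(+)"] sum.cong refl arg_cong2[where f="(*)"]) auto

lemma rate_swap_before:
  "s \<le> k \<Longrightarrow> rt (fst (swap_after k \<omega>)) s = rt (fst \<omega>) s"
  "s \<le> k \<Longrightarrow> rt (snd (swap_after k \<omega>)) s = rt (snd \<omega>) s"
  by (auto intro!: rate_cong simp: swap_after_def case_prod_unfold)

lemma rate_swap_past:
  "s - int L > k \<Longrightarrow> rt (fst (swap_after k \<omega>)) s = rt (snd \<omega>) s"
  "s - int L > k \<Longrightarrow> rt (snd (swap_after k \<omega>)) s = rt (fst \<omega>) s"
  by (auto intro!: rate_cong simp: swap_after_def case_prod_unfold)

section \<open>Exponential forgetting\<close>

abbreviation copies :: "real measure \<Rightarrow> ((int \<Rightarrow> real) \<times> (int \<Rightarrow> real)) measure" where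
  "copies F \<equiv> inputs F \<Otimes>\<^sub>M inputs F"

definition bdd_fun :: "real measure \<Rightarrow> ((int \<Rightarrow> real) \<times> (int \<Rightarrow> real) \<Rightarrow> real) \<Rightarrow> bool" where
  "bdd_fun F G \<longleftrightarrow> G \<in> borel_measurable (copies F) \<and> (\<exists>C. \<forall>\<omega>\<in>space (copies F). \<bar>G \<omega>\<bar> \<le> C)"

lemma bdd_fun_const: "bdd_fun F (\<lambda>_. c)"
  by (auto simp: bdd_fun_def)

lemma bdd_fun_diff: "bdd_fun F G \<Longrightarrow> bdd_fun F H \<Longrightarrow> bdd_fun F (\<lambda>\<omega>. G \<omega> - H \<omega>)"
proof -
  assume G: "bdd_fun F G" and H: "bdd_fun F H"
  obtain C D where "\<forall>\<omega>\<in>space (copies F). \<bar>G \<omega>\<bar> \<le> C" "\<forall>\<omega>\<in>space (copies F). \<bar>H \<omega>\<bar> \<le> D"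
    using G H by (auto simp: bdd_fun_def)
  then have "\<forall>\<omega>\<in>space (copies F). \<bar>G \<omega> - H \<omega>\<bar> \<le> C + D" by fastforce
  then show ?thesis using G H by (auto simp: bdd_fun_def)
qed

lemma bdd_fun_mult: "bdd_fun F G \<Longrightarrow> bdd_fun F H \<Longrightarrow> bdd_fun F (\<lambda>\<omega>. G \<omega> * H \<omega>)"
proof -
  assume G: "bdd_fun F G" and H: "bdd_fun F H"
  obtain C D where CD: "\<forall>\<omega>\<in>space (copies F). \<bar>G \<omega>\<bar> \<le> C" "\<forall>\<omega>\<in>space (copies F). \<bar>H \<omega>\<bar> \<le> D"
    using G H by (auto simp: bdd_fun_def)
  have "\<bar>G \<omega> * H \<omega>\<bar> \<le> C * D" if "\<omega> \<in> space (copies F)" for \<omega>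
    unfolding abs_mult by (intro mult_mono) (use CD that in \<open>auto intro: order_trans[OF abs_ge_zero]\<close>)
  then show ?thesis using G H unfolding bdd_fun_def by (intro conjI exI[of _ "C * D"]) auto
qed

lemma bdd_fun_prod: "(\<And>i. i \<in> I \<Longrightarrow> bdd_fun F (G i)) \<Longrightarrow> bdd_fun F (\<lambda>\<omega>. \<Prod>i\<in>I. G i \<omega>)"
  by (induction I rule: infinite_finite_induct) (auto intro: bdd_fun_const bdd_fun_mult)

lemma prob_copies: "F \<in> laws \<Longrightarrow> prob_space (copies F)"
proof -
  assume F: "F \<in> laws"
  interpret P: prob_space "inputs F" by (rule prob_inputs[OF F])
  interpret PP: pair_prob_space "inputs F" "inputs F" ..
  show ?thesis by (rule PP.prob_space_axioms)
qed

lemma bdd_fun_integrable: "F \<in> laws \<Longrightarrow> bdd_fun F G \<Longrightarrow> integrable (copies F) G"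
proof -
  assume F: "F \<in> laws" and G: "bdd_fun F G"
  interpret prob_space "copies F" by (rule prob_copies[OF F])
  obtain C where "\<forall>\<omega>\<in>space (copies F). \<bar>G \<omega>\<bar> \<le> C" using G by (auto simp: bdd_fun_def)
  then show ?thesis using G by (intro integrable_const_bound[where B=C]) (auto simp: bdd_fun_def)
qed

lemma space_copies:
  "F \<in> laws \<Longrightarrow> \<omega> \<in> space (copies F) \<Longrightarrow> 0 \<le> fst \<omega> k \<and> fst \<omega> k \<le> A"
  "F \<in> laws \<Longrightarrow> \<omega> \<in> space (copies F) \<Longrightarrow> 0 \<le> snd \<omega> k \<and> snd \<omega> k \<le> A"
  by (auto simp: space_pair_measure space_inputs)

lemma bdd_fun_rkernel:
  assumes F: "F \<in> laws"
  shows "bdd_fun F (\<lambda>\<omega>. rkernel I y (fst \<omega>))" "bdd_fun F (\<lambda>\<omega>. rkernel I y (snd \<omega>))"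
  using rkernel_bounds[of "fst _", OF space_copies(1)[OF F]] rkernel_bounds[of "snd _", OF space_copies(2)[OF F]]
  by (auto simp: bdd_fun_def intro!: exI[of _ "\<Prod>s\<in>I. ubound 0 (y s)"]
      measurable_compose[OF measurable_fst measurable_rkernel[OF F]]
      measurable_compose[OF measurable_snd measurable_rkernel[OF F]])

lemma integral_copies_mult:
  assumes F: "F \<in> laws"
  shows "(\<integral>\<omega>. rkernel I y (fst \<omega>) * rkernel J y (snd \<omega>) \<partial>copies F)
    = (\<integral>x. rkernel I y x \<partial>inputs F) * (\<integral>x. rkernel J y x \<partial>inputs F)"
proof -
  interpret P: prob_space "inputs F" by (rule prob_inputs[OF F])
  interpret PP: pair_prob_space "inputs F" "inputs F" ..
  have "integrable (copies F) (\<lambda>\<omega>. rkernel I y (fst \<omega>) * rkernel J y (snd \<omega>))"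
    by (intro bdd_fun_integrable bdd_fun_mult bdd_fun_rkernel F)
  then have "integrable (copies F) (\<lambda>(x, x'). rkernel I y x * rkernel J y x')"
    by (simp add: case_prod_unfold)
  from PP.integral_fst'[OF this] show ?thesis
    by (simp add: case_prod_unfold)
qed

abbreviation blen :: int where "blen \<equiv> int L + 1"

text \<open>Blocks are counted backwards from \<open>t\<close>, block 0 ending at
  \<open>t - 1\<close>. Exchanging inputs just before a block leaves L outputs that mix old and
  exchanged inputs, all inside the block; the length L + 1 keeps blocks nonempty when L = 0.\<close>

definition block :: "int \<Rightarrow> nat \<Rightarrow> int set" where
  "block t i = {t - (int i + 1) * blen..<t - int i * blen}"

text \<open>Squared because a block carries the Poisson weights of both copies, whose product lies
  between the squares of the two bounds.\<close>

definition ratio :: "nat \<Rightarrow> real" where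
  "ratio k = (lbound k / ubound 0 k)\<^sup>2"

text \<open>For A > 0 the ratios tend to 0 as counts grow, so a factor can be arbitrarily close to
  1; decay is obtained only after summation against a law.\<close>

definition theta :: "int \<Rightarrow> nat \<Rightarrow> (int \<Rightarrow> nat) \<Rightarrow> real" where
  "theta t N y = (\<Prod>i<N. 1 - (\<Prod>s\<in>block t i. ratio (y s)))"

lemma finite_block [simp]: "finite (block t i)"
  by (simp add: block_def)

lemma block_disjoint: "i \<noteq> i' \<Longrightarrow> block t i \<inter> block t i' = {}"
proof -
  have "block t i \<inter> block t i' = {}" if "i < i'" for i i'
  proof -
    have "(int i + 1) * blen \<le> int i' * blen" using that by (intro mult_right_mono) auto
    then show ?thesis by (auto simp: block_def)
  qed
  then show "i \<noteq> i' \<Longrightarrow> block t i \<inter> block t i' = {}" by (metis Int_commute linorder_neqE_nat)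
qed

lemma blocks_union: "(\<Union>i<N. block t i) = {t - int N * blen..<t}"
proof (induction N)
  case (Suc N)
  have "{t - int (Suc N) * blen..<t} = {t - (int N + 1) * blen..<t - int N * blen} \<union> {t - int N * blen..<t}"
    by (auto simp: algebra_simps) (smt (verit) mult_nonneg_nonneg of_nat_0_le_iff)
  then show ?case using Suc by (auto simp: lessThan_Suc block_def)
qed simp

lemma prod_blocks: "(\<Prod>i<N. \<Prod>s\<in>block t i. c s) = (\<Prod>s\<in>{t - int N * blen..<t}. c s)"
  unfolding blocks_union[symmetric]
  by (rule prod.UNION_disjoint[symmetric]) (use block_disjoint in auto)

lemma ratio_bounds: "0 < ratio k" "ratio k \<le> 1"
proof -
  have "lbound k \<le> ubound 0 k"
    using weight_bounds(1,2)[where x="\<lambda>_. 0" and k=k and s=0] A by auto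
  then have "lbound k / ubound 0 k \<le> 1" "0 < lbound k / ubound 0 k"
    using ubound_pos[of 0 k] lbound_pos[of k] by auto
  then show "0 < ratio k" "ratio k \<le> 1"
    by (auto simp: ratio_def power_le_one)
qed

lemma prod_ratio_bounds: "0 < (\<Prod>s\<in>S. ratio (y s))" "(\<Prod>s\<in>S. ratio (y s)) \<le> 1"
  by (intro prod_pos prod_le_1 ballI conjI less_imp_le[OF ratio_bounds(1)] ratio_bounds)+

lemma theta_bounds: "0 \<le> theta t N y" "theta t N y \<le> 1"
proof -
  have "0 \<le> 1 - (\<Prod>s\<in>block t i. ratio (y s)) \<and> 1 - (\<Prod>s\<in>block t i. ratio (y s)) \<le> 1" for i
    using prod_ratio_bounds[of y "block t i"] by linarith
  then show "0 \<le> theta t N y" "theta t N y \<le> 1"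
    unfolding theta_def by (intro prod_nonneg prod_le_1 ballI, blast)+
qed

text \<open>Two independent copies of the input agree in law after exchanging their futures at a block
  boundary. The exchange changes only the weight of one block of outputs; replacing that weight by a
  constant therefore makes the integrand below antisymmetric, so constants may be subtracted
  from the block weights one block at a time.\<close>

lemma forgetting:
  assumes F: "F \<in> laws" and fin: "finite E1" "finite E2"
    and E: "E1 \<subseteq> {..<t - int N * blen}" "E2 \<subseteq> {..<t - int N * blen}"
  defines "U \<equiv> {t - int N * blen..<t}"
  shows "\<bar>bmass F (insert t (E1 \<union> U)) y * bmass F (E2 \<union> U) y - bmass F (E1 \<union> U) y * bmass F (insert t (E2 \<union> U)) y\<bar>
    \<le> theta t N y * (bmass F (insert t (E1 \<union> U)) y * bmass F (E2 \<union> U) y + bmass F (E1 \<union> U) y * bmass F (insert t (E2 \<union> U)) y)"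
proof -
  define u where "u = (\<lambda>x s. poisson_weight (rt x s) (y s))"
  define V where "V = (\<lambda>\<omega>. rkernel E1 y (fst \<omega>) * rkernel E2 y (snd \<omega>))"
  define cb where "cb = (\<lambda>i \<omega>. rkernel (block t i) y (fst \<omega>) * rkernel (block t i) y (snd \<omega>))"
  \<comment> \<open>\<open>mb\<close> is the constant that replaces a block weight: the least value
    of the product of the two copies' weights allowed by \<open>lbound\<close>.\<close>
  define mb where "mb = (\<lambda>i. (\<Prod>s\<in>block t i. (lbound (y s))\<^sup>2))"
  define br where "br = (\<lambda>\<omega>. u (fst \<omega>) t - u (snd \<omega>) t)"
  define cs where "cs = (\<lambda>n i \<omega>. cb i \<omega> - (if i < n then mb i else 0))"
  let ?I = "\<lambda>G. \<integral>\<omega>. G \<omega> \<partial>copies F"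
  have u1: "rkernel {t} y x = u x t" for x by (simp add: rkernel_def u_def)
  have bV: "bdd_fun F V" unfolding V_def by (intro bdd_fun_mult bdd_fun_rkernel F)
  have bc: "bdd_fun F (cb i)" for i unfolding cb_def by (intro bdd_fun_mult bdd_fun_rkernel F)
  have bcs: "bdd_fun F (cs n i)" for n i unfolding cs_def by (intro bdd_fun_diff bdd_fun_const bc)
  have bb: "bdd_fun F br" unfolding br_def u1[symmetric] by (intro bdd_fun_diff bdd_fun_rkernel F)
  have missing: "?I (\<lambda>\<omega>. V \<omega> * (\<Prod>i\<in>{..<N} - {n}. cs n i \<omega>) * br \<omega>) = 0" if n: "n < N" for n
  proof (rule integral_swap_antisym[OF F])
    \<comment> \<open>Outputs up to \<open>k\<close> use inputs up to \<open>k\<close>, outputs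
      beyond \<open>k + L\<close> only inputs after \<open>k\<close>. The outputs in between lie in
      block \<open>n\<close>, the one block left out of the integrand.\<close>
    define k where "k = t - (int n + 1) * blen - 1"
    show "(\<lambda>\<omega>. V \<omega> * (\<Prod>i\<in>{..<N} - {n}. cs n i \<omega>) * br \<omega>) \<in> borel_measurable (copies F)"
      using bdd_fun_mult[OF bdd_fun_mult[OF bV bdd_fun_prod[of "{..<N} - {n}" F "cs n", OF bcs]] bb] by (simp add: bdd_fun_def)
    fix \<omega>
    have kN: "t - int N * blen \<le> k + 1"
    proof -
      have "(int n + 1) * blen \<le> int N * blen" using n by (intro mult_right_mono) auto
      then show ?thesis by (simp add: k_def)
    qed
    have before: "rkernel S y (fst (swap_after k \<omega>)) = rkernel S y (fst \<omega>)"
        "rkernel S y (snd (swap_after k \<omega>)) = rkernel S y (snd \<omega>)" if "S \<subseteq> {..k}" for S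
      unfolding rkernel_def using that by (auto intro!: prod.cong simp: rate_swap_before)
    have past: "rkernel S y (fst (swap_after k \<omega>)) = rkernel S y (snd \<omega>)"
        "rkernel S y (snd (swap_after k \<omega>)) = rkernel S y (fst \<omega>)" if "S \<subseteq> {k + int L<..}" for S
      unfolding rkernel_def using that by (auto intro!: prod.cong simp: rate_swap_past)
    have V: "V (swap_after k \<omega>) = V \<omega>"
    proof -
      have "E1 \<subseteq> {..k}" "E2 \<subseteq> {..k}" using E kN by fastforce+
      then show ?thesis by (simp add: V_def before)
    qed
    have "{t} \<subseteq> {k + int L<..}"
      by (simp add: k_def algebra_simps)
         (smt (verit) mult_nonneg_nonneg of_nat_0_le_iff)
    then have br: "br (swap_after k \<omega>) = - br \<omega>"
      unfolding br_def u1[symmetric] by (simp add: past)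
    \<comment> \<open>Blocks nearer to \<open>t\<close> have their two copies interchanged, and
      \<open>cb\<close> is symmetric in them; earlier blocks do not see the exchange.\<close>
    have c: "cs n i (swap_after k \<omega>) = cs n i \<omega>" if "i \<noteq> n" for i
    proof (cases "i < n")
      case True
      then have "(int i + 1) * blen \<le> int n * blen" by (intro mult_right_mono) auto
      then have "block t i \<subseteq> {k + int L<..}" by (auto simp: block_def k_def algebra_simps)
      then show ?thesis by (simp add: cs_def cb_def past)
    next
      case False
      then have "(int n + 1) * blen \<le> int i * blen" using that by (intro mult_right_mono) auto
      then have "block t i \<subseteq> {..k}" unfolding block_def k_def by (intro subsetI) (unfold atLeastLessThan_iff atMost_iff, linarith)
      then show ?thesis by (simp add: cs_def cb_def before)
    qed
    then have "(\<Prod>i\<in>{..<N} - {n}. cs n i (swap_after k \<omega>)) = (\<Prod>i\<in>{..<N} - {n}. cs n i \<omega>)"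
      by (intro prod.cong) auto
    then show "V (swap_after k \<omega>) * (\<Prod>i\<in>{..<N} - {n}. cs n i (swap_after k \<omega>)) * br (swap_after k \<omega>)
        = - (V \<omega> * (\<Prod>i\<in>{..<N} - {n}. cs n i \<omega>) * br \<omega>)"
      by (simp add: V br)
  qed
  have int: "integrable (copies F) (\<lambda>\<omega>. V \<omega> * (\<Prod>i\<in>S. cs n i \<omega>) * br \<omega>)" for S n
    by (intro bdd_fun_integrable F bdd_fun_mult bV bdd_fun_prod bcs bb)
  \<comment> \<open>Subtracting \<open>mb n\<close> from the weight of block \<open>n\<close>
    changes the integral by a multiple of the vanishing integral \<open>missing\<close>.\<close>
  have step: "?I (\<lambda>\<omega>. V \<omega> * (\<Prod>i<N. cs n i \<omega>) * br \<omega>) = ?I (\<lambda>\<omega>. V \<omega> * (\<Prod>i<N. cb i \<omega>) * br \<omega>)" if "n \<le> N" for n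
    using that
  proof (induction n)
    case (Suc n)
    then have n: "n < N" by simp
    have eq: "V \<omega> * (\<Prod>i<N. cs (Suc n) i \<omega>) * br \<omega> =
        V \<omega> * (\<Prod>i<N. cs n i \<omega>) * br \<omega> - mb n * (V \<omega> * (\<Prod>i\<in>{..<N} - {n}. cs n i \<omega>) * br \<omega>)" for \<omega>
    proof -
      have "(\<Prod>i<N. cs (Suc n) i \<omega>) = cs (Suc n) n \<omega> * (\<Prod>i\<in>{..<N} - {n}. cs (Suc n) i \<omega>)"
        using n by (subst prod.remove[of _ n]) auto
      also have "(\<Prod>i\<in>{..<N} - {n}. cs (Suc n) i \<omega>) = (\<Prod>i\<in>{..<N} - {n}. cs n i \<omega>)"
        by (rule prod.cong) (auto simp: cs_def)
      also have "cs (Suc n) n \<omega> = cs n n \<omega> - mb n" by (simp add: cs_def)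
      finally have *: "(\<Prod>i<N. cs (Suc n) i \<omega>) = (cs n n \<omega> - mb n) * (\<Prod>i\<in>{..<N} - {n}. cs n i \<omega>)" .
      have **: "(\<Prod>i<N. cs n i \<omega>) = cs n n \<omega> * (\<Prod>i\<in>{..<N} - {n}. cs n i \<omega>)"
        using n by (subst prod.remove[of _ n]) auto
      show ?thesis unfolding * ** by (simp add: algebra_simps)
    qed
    have "?I (\<lambda>\<omega>. V \<omega> * (\<Prod>i<N. cs (Suc n) i \<omega>) * br \<omega>) = ?I (\<lambda>\<omega>. V \<omega> * (\<Prod>i<N. cs n i \<omega>) * br \<omega>)"
      unfolding eq by (subst Bochner_Integration.integral_diff) (use int missing[OF n] in auto)
    with Suc show ?case by simp
  qed (simp add: cs_def)
  have comb: "rkernel (E1 \<union> U) y (fst \<omega>) * rkernel (E2 \<union> U) y (snd \<omega>) = V \<omega> * (\<Prod>i<N. cb i \<omega>)" for \<omega>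
  proof -
    have e: "rkernel (E' \<union> U) y x = rkernel E' y x * (\<Prod>i<N. rkernel (block t i) y x)"
      if "finite E'" "E' \<subseteq> {..<t - int N * blen}" for E' x
    proof -
      have "E' \<inter> U = {}" using that by (force simp: U_def)
      then have "rkernel (E' \<union> U) y x = rkernel E' y x * rkernel U y x"
        unfolding rkernel_def by (intro prod.union_disjoint) (use that in \<open>auto simp: U_def\<close>)
      then show ?thesis unfolding U_def rkernel_def by (simp add: prod_blocks)
    qed
    show ?thesis unfolding e[OF fin(1) E(1)] e[OF fin(2) E(2)] by (simp add: V_def cb_def prod.distrib mult_ac)
  qed
  have tU: "rkernel (insert t (E' \<union> U)) y x = u x t * rkernel (E' \<union> U) y x"
    if "finite E'" "E' \<subseteq> {..<t - int N * blen}" for E' x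
  proof -
    have "\<not> int N * blen < 0" by (simp add: not_less)
    then have "t \<notin> {..<t - int N * blen}" by simp
    then have "t \<notin> E' \<union> U" using that by (auto simp: U_def)
    then show ?thesis unfolding rkernel_def u_def using that by (subst prod.insert) (auto simp: U_def)
  qed
  have f: "finite (E1 \<union> U)" "finite (E2 \<union> U)" using fin by (auto simp: U_def)
  have p1: "bmass F (insert t (E1 \<union> U)) y * bmass F (E2 \<union> U) y = ?I (\<lambda>\<omega>. V \<omega> * (\<Prod>i<N. cb i \<omega>) * u (fst \<omega>) t)"
  proof -
    have "bmass F (insert t (E1 \<union> U)) y * bmass F (E2 \<union> U) y
        = ?I (\<lambda>\<omega>. rkernel (insert t (E1 \<union> U)) y (fst \<omega>) * rkernel (E2 \<union> U) y (snd \<omega>))"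
      using f by (simp add: bmass_eq[OF F] integral_copies_mult[OF F])
    then show ?thesis by (simp add: comb[symmetric] tU[OF fin(1) E(1)] mult_ac)
  qed
  have p2: "bmass F (E1 \<union> U) y * bmass F (insert t (E2 \<union> U)) y = ?I (\<lambda>\<omega>. V \<omega> * (\<Prod>i<N. cb i \<omega>) * u (snd \<omega>) t)"
  proof -
    have "bmass F (E1 \<union> U) y * bmass F (insert t (E2 \<union> U)) y
        = ?I (\<lambda>\<omega>. rkernel (E1 \<union> U) y (fst \<omega>) * rkernel (insert t (E2 \<union> U)) y (snd \<omega>))"
      using f by (simp add: bmass_eq[OF F] integral_copies_mult[OF F])
    then show ?thesis by (simp add: comb[symmetric] tU[OF fin(2) E(2)] mult_ac)
  qed
  have i1: "integrable (copies F) (\<lambda>\<omega>. V \<omega> * (\<Prod>i<N. cb i \<omega>) * u (fst \<omega>) t)"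
    and i2: "integrable (copies F) (\<lambda>\<omega>. V \<omega> * (\<Prod>i<N. cb i \<omega>) * u (snd \<omega>) t)"
    unfolding u1[symmetric] by (intro bdd_fun_integrable F bdd_fun_mult bV bdd_fun_prod bc bdd_fun_rkernel)+
  have "bmass F (insert t (E1 \<union> U)) y * bmass F (E2 \<union> U) y - bmass F (E1 \<union> U) y * bmass F (insert t (E2 \<union> U)) y
      = ?I (\<lambda>\<omega>. V \<omega> * (\<Prod>i<N. cb i \<omega>) * br \<omega>)"
    unfolding p1 p2 by (subst Bochner_Integration.integral_diff[symmetric]) (use i1 i2 in \<open>auto simp: br_def algebra_simps\<close>)
  also have "\<dots> = ?I (\<lambda>\<omega>. V \<omega> * (\<Prod>i<N. cs N i \<omega>) * br \<omega>)" using step[of N] by simp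
  also have "\<bar>\<dots>\<bar> \<le> ?I (\<lambda>\<omega>. \<bar>V \<omega> * (\<Prod>i<N. cs N i \<omega>) * br \<omega>\<bar>)" by (rule integral_abs_bound)
  also have "\<dots> \<le> ?I (\<lambda>\<omega>. theta t N y * (V \<omega> * (\<Prod>i<N. cb i \<omega>) * u (fst \<omega>) t + V \<omega> * (\<Prod>i<N. cb i \<omega>) * u (snd \<omega>) t))"
  proof (rule integral_mono)
    show "integrable (copies F) (\<lambda>\<omega>. \<bar>V \<omega> * (\<Prod>i<N. cs N i \<omega>) * br \<omega>\<bar>)" using int by auto
    show "integrable (copies F) (\<lambda>\<omega>. theta t N y * (V \<omega> * (\<Prod>i<N. cb i \<omega>) * u (fst \<omega>) t + V \<omega> * (\<Prod>i<N. cb i \<omega>) * u (snd \<omega>) t))"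
      using i1 i2 by auto
    fix \<omega> assume w: "\<omega> \<in> space (copies F)"
    note x = space_copies(1)[OF F w] and x' = space_copies(2)[OF F w]
    have V0: "V \<omega> \<ge> 0" unfolding V_def using rkernel_bounds(1)[OF x] rkernel_bounds(1)[OF x'] by simp
    have u0: "u (fst \<omega>) t \<ge> 0" "u (snd \<omega>) t \<ge> 0" unfolding u_def using weight_bounds(3)[OF x] weight_bounds(3)[OF x'] by auto
    \<comment> \<open>The block weight lies between \<open>mb i\<close> and \<open>mb i\<close>
      divided by the product of ratios. What remains after subtracting \<open>mb i\<close> is thus
      nonnegative and at most the proportion \<open>1 -\<close> (product of ratios) of the
      weight.\<close>
    have c: "0 \<le> cs N i \<omega> \<and> cs N i \<omega> \<le> (1 - (\<Prod>s\<in>block t i. ratio (y s))) * cb i \<omega>" if "i < N" for i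
    proof -
      have e: "cb i \<omega> = (\<Prod>s\<in>block t i. u (fst \<omega>) s * u (snd \<omega>) s)" by (simp add: cb_def rkernel_def u_def prod.distrib)
      have "mb i \<le> cb i \<omega>" unfolding e mb_def power2_eq_square u_def
        by (intro prod_mono conjI mult_mono) (use weight_bounds[OF x] weight_bounds[OF x'] lbound_pos in \<open>auto simp: less_imp_le\<close>)
      moreover have "(\<Prod>s\<in>block t i. ratio (y s)) * cb i \<omega> \<le> mb i"
      proof -
        have "(\<Prod>s\<in>block t i. ratio (y s) * (u (fst \<omega>) s * u (snd \<omega>) s)) \<le> (\<Prod>s\<in>block t i. (lbound (y s))\<^sup>2)"
        proof (rule prod_mono, rule conjI)
          fix s
          have "u (fst \<omega>) s * u (snd \<omega>) s \<le> ubound 0 (y s) * ubound 0 (y s)"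
            unfolding u_def by (intro mult_mono) (use weight_bounds[OF x] weight_bounds[OF x'] ubound_pos[of 0] in \<open>auto simp: less_imp_le\<close>)
          then have "ratio (y s) * (u (fst \<omega>) s * u (snd \<omega>) s) \<le> ratio (y s) * (ubound 0 (y s) * ubound 0 (y s))"
            using ratio_bounds[of "y s"] by (intro mult_left_mono) auto
          also have "\<dots> = (lbound (y s))\<^sup>2"
            using ubound_pos[of 0 "y s"] by (simp add: ratio_def power_divide power2_eq_square)
          finally show "ratio (y s) * (u (fst \<omega>) s * u (snd \<omega>) s) \<le> (lbound (y s))\<^sup>2" .
          show "0 \<le> ratio (y s) * (u (fst \<omega>) s * u (snd \<omega>) s)"
            using ratio_bounds[of "y s"] weight_bounds(3)[OF x] weight_bounds(3)[OF x'] by (simp add: u_def)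
        qed
        then show ?thesis unfolding e mb_def by (simp add: prod.distrib)
      qed
      ultimately show ?thesis using that by (simp add: cs_def algebra_simps)
    qed
    have c1: "0 \<le> (\<Prod>i<N. cs N i \<omega>)" using c by (intro prod_nonneg) auto
    have c2: "(\<Prod>i<N. cs N i \<omega>) \<le> theta t N y * (\<Prod>i<N. cb i \<omega>)"
      unfolding theta_def prod.distrib[symmetric] by (rule prod_mono) (use c in auto)
    have "\<bar>V \<omega> * (\<Prod>i<N. cs N i \<omega>) * br \<omega>\<bar> = (V \<omega> * (\<Prod>i<N. cs N i \<omega>)) * \<bar>br \<omega>\<bar>"
      using V0 c1 by (simp add: abs_mult)
    also have "\<dots> \<le> (V \<omega> * (theta t N y * (\<Prod>i<N. cb i \<omega>))) * (u (fst \<omega>) t + u (snd \<omega>) t)"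
      by (rule mult_mono[OF mult_left_mono[OF c2 V0] _ mult_nonneg_nonneg[OF V0 order_trans[OF c1 c2]]])
        (use u0 in \<open>auto simp: br_def\<close>)
    finally show "\<bar>V \<omega> * (\<Prod>i<N. cs N i \<omega>) * br \<omega>\<bar>
        \<le> theta t N y * (V \<omega> * (\<Prod>i<N. cb i \<omega>) * u (fst \<omega>) t + V \<omega> * (\<Prod>i<N. cb i \<omega>) * u (snd \<omega>) t)"
      by (simp add: algebra_simps)
  qed
  also have "\<dots> = theta t N y * (bmass F (insert t (E1 \<union> U)) y * bmass F (E2 \<union> U) y + bmass F (E1 \<union> U) y * bmass F (insert t (E2 \<union> U)) y)"
    unfolding p1 p2 using i1 i2 by simp
  finally show ?thesis .
qed

section \<open>Forgetting for conditional probabilities and their logarithms\<close>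

definition cprob :: "real measure \<Rightarrow> int \<Rightarrow> nat \<Rightarrow> (int \<Rightarrow> nat) \<Rightarrow> real" where
  "cprob F t m y = bmass F {t - int m..t} y / bmass F {t - int m..<t} y"

definition info :: "real measure \<Rightarrow> int \<Rightarrow> nat \<Rightarrow> (int \<Rightarrow> nat) \<Rightarrow> real" where
  "info F t m y = - ln (cprob F t m y)"

lemma insert_hist: "{t - int m..t} = insert t {t - int m..<t}"
  by auto

lemma cprob_bounds:
  assumes F: "F \<in> laws"
  shows "lbound (y t) \<le> cprob F t m y" "cprob F t m y \<le> ubound 0 (y t)" "0 < cprob F t m y" "cprob F t m y \<le> 1"
proof -
  let ?H = "{t - int m..<t}"
  have pos: "bmass F ?H y > 0" by (rule bmass_bounds(3)[OF F]) simp
  have split: "rkernel {t - int m..t} y x = poisson_weight (rt x t) (y t) * rkernel ?H y x" for x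
    unfolding insert_hist rkernel_def by simp
  have e: "bmass F {t - int m..t} y = (\<integral>x. poisson_weight (rt x t) (y t) * rkernel ?H y x \<partial>inputs F)"
    by (simp add: bmass_eq[OF F] split)
  have int: "integrable (inputs F) (\<lambda>x. poisson_weight (rt x t) (y t) * rkernel ?H y x)"
    unfolding split[symmetric] by (rule integrable_rkernel[OF F])
  have "(\<integral>x. lbound (y t) * rkernel ?H y x \<partial>inputs F) \<le> bmass F {t - int m..t} y"
    unfolding e by (rule integral_mono)
      (use int in \<open>auto simp: space_inputs[OF F] intro!: integrable_rkernel F mult_right_mono weight_bounds rkernel_bounds\<close>)
  then show 1: "lbound (y t) \<le> cprob F t m y"
    using pos by (simp add: cprob_def bmass_eq[OF F] field_simps)
  have "bmass F {t - int m..t} y \<le> (\<integral>x. ubound 0 (y t) * rkernel ?H y x \<partial>inputs F)"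
    unfolding e by (rule integral_mono)
      (use int in \<open>auto simp: space_inputs[OF F] intro!: integrable_rkernel F mult_right_mono weight_bounds rkernel_bounds\<close>)
  then show "cprob F t m y \<le> ubound 0 (y t)"
    using pos by (simp add: cprob_def bmass_eq[OF F] field_simps)
  show "0 < cprob F t m y" using 1 lbound_pos[of "y t"] by linarith
  have "bmass F {t - int m..t} y \<le> bmass F ?H y"
  proof -
    interpret prob_space "olaw F" by (rule output_law_basic[OF F])
    show ?thesis unfolding bmass_def
      by (rule finite_measure_mono) (auto simp: cylinder_def output_law_basic[OF F] cylinder_sets[unfolded cylinder_def])
  qed
  then show "cprob F t m y \<le> 1" using pos by (simp add: cprob_def)
qed

lemma history_info_eq: "history_info L lam0 h F t m y = info F (int t) m y" if F: "F \<in> laws"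
proof -
  have "{w. w (int t) = y (int t) \<and> (\<forall>s\<in>{int t - int m..<int t}. w s = y s)} = cylinder {int t - int m..int t} y"
    unfolding insert_hist cylinder_def by auto
  then show ?thesis
    by (simp add: history_info_def info_def cprob_def cond_prob_def bmass_def output_law_basic[OF F] cylinder_def)
qed

lemma cprob_cong: "(\<And>s. s \<in> {t - int m..t} \<Longrightarrow> y s = y' s) \<Longrightarrow> cprob F t m y = cprob F t m y'"
  unfolding cprob_def bmass_def cylinder_def by (intro arg_cong2[where f="(/)"] arg_cong2[where f=measure] refl) auto

text \<open>The parts of the two histories older than \<open>N\<close> blocks play the roles of
  \<open>E1\<close> and \<open>E2\<close>; dividing the cross-multiplied inequality of
  \<open>forgetting\<close> by the positive history masses gives the claim.\<close>

lemma cprob_forgetting: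
  assumes F: "F \<in> laws" and N: "N * (L + 1) \<le> m" and m: "m \<le> m'"
  shows "\<bar>cprob F t m' y - cprob F t m y\<bar> \<le> theta t N y * (cprob F t m' y + cprob F t m y)"
proof -
  let ?E = "\<lambda>m. {t - int m..<t - int N * blen}" and ?U = "{t - int N * blen..<t}"
  have N': "int N * blen \<le> int m" using N by (metis of_nat_1 of_nat_add of_nat_le_iff of_nat_mult)
  have H: "{t - int m..<t} = ?E m \<union> ?U" and H': "{t - int m'..<t} = ?E m' \<union> ?U"
    using N' m by auto (smt (verit) mult_nonneg_nonneg of_nat_0_le_iff)+
  have p: "bmass F {t - int m..<t} y > 0" "bmass F {t - int m'..<t} y > 0"
    by (auto intro: bmass_bounds(3)[OF F])
  let ?a = "bmass F {t - int m'..t} y" and ?b = "bmass F {t - int m'..<t} y" and ?c = "bmass F {t - int m..t} y" and ?d = "bmass F {t - int m..<t} y"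
  have *: "\<bar>?a * ?d - ?b * ?c\<bar> \<le> theta t N y * (?a * ?d + ?b * ?c)"
    unfolding insert_hist H H' by (rule forgetting[OF F]) auto
  have "cprob F t m' y - cprob F t m y = (?a * ?d - ?b * ?c) / (?b * ?d)"
    using p by (simp add: cprob_def field_simps)
  moreover have "cprob F t m' y + cprob F t m y = (?a * ?d + ?b * ?c) / (?b * ?d)"
    using p by (simp add: cprob_def field_simps)
  ultimately show ?thesis using * p by (simp add: abs_div divide_right_mono)
qed

text \<open>Both conditional probabilities are at least \<open>lbound (y t)\<close>, and on that
  range the logarithm is Lipschitz with constant \<open>1 / lbound (y t)\<close>.\<close>

lemma info_forgetting:
  assumes F: "F \<in> laws" and N: "N * (L + 1) \<le> m" and m: "m \<le> m'"
  shows "\<bar>info F t m' y - info F t m y\<bar> \<le> 2 * theta t N y * (ubound 0 (y t) / lbound (y t))"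
proof -
  have ln_diff: "\<bar>ln a - ln b\<bar> \<le> \<bar>a - b\<bar> / l" if "a \<ge> l" "b \<ge> l" "l > 0" for a b l :: real
  proof -
    have "ln a - ln b \<le> \<bar>a - b\<bar> / l" if "a \<ge> l" "b \<ge> l" for a b
    proof -
      have "ln a - ln b = ln (a / b)" using that \<open>l > 0\<close> by (subst ln_div) auto
      also have "\<dots> \<le> a / b - 1" using that \<open>l > 0\<close> by (intro ln_le_minus_one) auto
      also have "\<dots> = (a - b) / b" using that \<open>l > 0\<close> by (simp add: field_simps)
      also have "\<dots> \<le> \<bar>a - b\<bar> / l" by (rule frac_le) (use that \<open>l > 0\<close> in auto)
      finally show ?thesis .
    qed
    from this[of a b] this[of b a] that show ?thesis by (auto simp: abs_minus_commute)
  qed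
  have "\<bar>info F t m' y - info F t m y\<bar> \<le> \<bar>cprob F t m' y - cprob F t m y\<bar> / lbound (y t)"
    using ln_diff[of "lbound (y t)" "cprob F t m y" "cprob F t m' y"] cprob_bounds(1)[OF F] lbound_pos[of "y t"]
    by (simp add: info_def abs_minus_commute)
  also have "\<dots> \<le> (theta t N y * (ubound 0 (y t) + ubound 0 (y t))) / lbound (y t)"
    by (intro divide_right_mono order_trans[OF cprob_forgetting[OF assms]] mult_left_mono add_mono)
      (use cprob_bounds(2)[OF F] theta_bounds lbound_pos[of "y t"] in \<open>auto simp: less_imp_le\<close>)
  finally show ?thesis by (simp add: field_simps)
qed

text \<open>The factor (lam0 + A) / lam0 is the growth of \<open>ubound 0 k / lbound k\<close> in
  \<open>k\<close>; the factor 2 absorbs ln(k!) and k. In \<open>growth_const\<close>, the last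
  summand serves the increments of \<open>info\<close> and the others its size.\<close>

definition growth :: real where
  "growth = 2 * ((lam0 + A) / lam0)"

definition growth_const :: real where
  "growth_const = lam0 + A + \<bar>ln lam0\<bar> + 2 + 2 * exp (lam0 + A)"

lemma growth_ge: "growth \<ge> 2" "(lam0 + A) / lam0 \<le> growth" "growth_const \<ge> 1"
  using lam0 A by (auto simp: growth_def growth_const_def field_simps add_pos_nonneg)

lemma info_bounds:
  assumes F: "F \<in> laws"
  shows "0 \<le> info F t m y" "info F t m y \<le> growth_const * growth ^ y t"
proof -
  show "0 \<le> info F t m y"
    using cprob_bounds(3,4)[OF F, where t=t and m=m and y=y] by (simp add: info_def)
  let ?k = "y t"
  have "info F t m y \<le> - ln (lbound ?k)"
    unfolding info_def using cprob_bounds(1,3)[OF F, where t=t and m=m and y=y] lbound_pos[of ?k] by simp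
  also have "\<dots> = lam0 + A - real ?k * ln lam0 + ln (fact ?k)"
    using lam0 by (simp add: lbound_def ln_mult ln_div ln_realpow)
  \<comment> \<open>Using ln(k!) \<le> k^2 \<le> 2 * 2^k leaves only exponential moments to control,
    and these are explicit for Poisson weights.\<close>
  also have "\<dots> \<le> lam0 + A + 2 ^ ?k * \<bar>ln lam0\<bar> + 2 * 2 ^ ?k"
  proof -
    have k2: "real ?k \<le> 2 ^ ?k" by simp
    have "- (real ?k * ln lam0) \<le> real ?k * \<bar>ln lam0\<bar>"
      by (metis abs_ge_minus_self mult_left_mono mult_minus_right of_nat_0_le_iff)
    also have "\<dots> \<le> 2 ^ ?k * \<bar>ln lam0\<bar>" by (rule mult_right_mono[OF k2]) simp
    finally have 1: "- (real ?k * ln lam0) \<le> 2 ^ ?k * \<bar>ln lam0\<bar>" .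
    have sq: "k\<^sup>2 \<le> 2 * 2 ^ k" for k :: nat
    proof (induction k)
      case (Suc k)
      show ?case
      proof (cases "k < 3")
        case True
        then have "k = 0 \<or> k = 1 \<or> k = 2" by auto
        then show ?thesis by (auto simp: power2_eq_square)
      next
        case False
        then have "3 * k \<le> k * k" by (intro mult_right_mono) auto
        then have "2 * k + 1 \<le> k\<^sup>2" using False unfolding power2_eq_square by linarith
        then show ?thesis using Suc by (simp add: power2_eq_square algebra_simps)
      qed
    qed simp
    have "ln (fact ?k) \<le> ln (real ?k ^ ?k)" if "?k > 0"
      using that fact_le_power[of ?k, where 'a=real] by (subst ln_le_cancel_iff) auto
    also have "ln (real ?k ^ ?k) = real ?k * ln (real ?k)" if "?k > 0" using that by (simp add: ln_realpow)
    also have "real ?k * ln (real ?k) \<le> real ?k * real ?k" if "?k > 0"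
      using that ln_le_minus_one[of "real ?k"] by (intro mult_left_mono) auto
    finally have "ln (fact ?k) \<le> real ?k * real ?k" by (cases "?k > 0") auto
    also have "\<dots> \<le> 2 * 2 ^ ?k"
      using sq[of ?k] by (metis (mono_tags, lifting) of_nat_le_iff of_nat_mult of_nat_numeral of_nat_power power2_eq_square)
    finally show ?thesis using 1 by linarith
  qed
  also have "\<dots> \<le> (lam0 + A + \<bar>ln lam0\<bar> + 2) * 2 ^ ?k"
  proof -
    have "(lam0 + A) * 1 \<le> (lam0 + A) * 2 ^ ?k" using lam0 A by (intro mult_left_mono) auto
    then show ?thesis by (simp add: algebra_simps)
  qed
  also have "\<dots> \<le> growth_const * growth ^ ?k"
    using growth_ge(1) lam0 A by (intro mult_mono power_mono) (auto simp: growth_const_def)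
  finally show "info F t m y \<le> growth_const * growth ^ ?k" .
qed

lemma info_forgetting':
  assumes F: "F \<in> laws" and N: "N * (L + 1) \<le> m" and m: "m \<le> m'"
  shows "\<bar>info F t m' y - info F t m y\<bar> \<le> growth_const * (theta t N y * growth ^ y t)"
proof -
  have "ubound 0 (y t) / lbound (y t) = exp (lam0 + A) * ((lam0 + A) / lam0) ^ y t"
    using lam0 by (simp add: ubound_def lbound_def power_divide exp_add exp_diff exp_minus field_simps)
  also have "\<dots> \<le> exp (lam0 + A) * growth ^ y t"
    using growth_ge lam0 A by (intro mult_left_mono power_mono) auto
  finally have "2 * (ubound 0 (y t) / lbound (y t)) \<le> (2 * exp (lam0 + A)) * growth ^ y t" by simp
  also have "\<dots> \<le> growth_const * growth ^ y t"
    using growth_ge lam0 A by (intro mult_right_mono) (auto simp: growth_const_def)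
  finally have "theta t N y * (2 * (ubound 0 (y t) / lbound (y t))) \<le> theta t N y * (growth_const * growth ^ y t)"
    using theta_bounds by (intro mult_left_mono) auto
  then show ?thesis using info_forgetting[OF assms, of t y] by (simp add: mult_ac)
qed

section \<open>Decay of the finite-history functionals\<close>

definition rmax :: "real \<Rightarrow> real" where "rmax B = lam0 + A + B"

text \<open>Bounds the expected factor of one block: with Poisson means at most
  \<open>rmax B\<close>, the L + 1 counts all vanish with probability at least exp(- rmax B)^(L +
  1), and then the product of ratios is \<open>ratio 0 ^ (L + 1)\<close>.\<close>

definition contraction :: "real \<Rightarrow> real" where
  "contraction B = 1 - (exp (- rmax B) * ratio 0) ^ (L + 1)"

text \<open>The first factor bounds the excess of the modulus of a complex kernel over a Poisson
  product; the second is the moment E[growth^Y] of a Poisson variable of mean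
  \<open>rmax B\<close>.\<close>

definition theta_const :: "real \<Rightarrow> real" where
  "theta_const B = exp (2 * B * (real L + 1)) * exp ((growth - 1) * rmax B)"

lemma contraction_bounds: "B \<ge> 0 \<Longrightarrow> 0 < contraction B" "contraction B < 1"
proof -
  show "contraction B < 1" using ratio_bounds(1)[of 0] by (simp add: contraction_def)
  assume B: "B \<ge> 0"
  have "exp (- rmax B) < 1" using B lam0 A by (simp add: rmax_def)
  then have "exp (- rmax B) * ratio 0 < 1 * 1"
    by (intro mult_less_le_imp_less) (use ratio_bounds[of 0] in auto)
  then have "(exp (- rmax B) * ratio 0) ^ (L + 1) < 1"
    using ratio_bounds(1)[of 0] by (intro power_less_one_iff[THEN iffD2]) auto
  then show "0 < contraction B" by (simp add: contraction_def)
qed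

lemma theta_const_pos: "theta_const B > 0"
  by (simp add: theta_const_def)

text \<open>For fixed inputs the modulus of the kernel is a constant times a product of Poisson
  weights with means |\<zeta>|, so the outputs behave as independent and the block factors of
  \<open>theta\<close> can be averaged separately.\<close>

lemma theta_kernel_sum:
  fixes t :: int
  assumes x: "\<And>k. 0 \<le> x k \<and> x k \<le> A" and z: "norm z \<le> B" and N: "N * (L + 1) \<le> m"
  defines "I \<equiv> {t - int m..t}"
  shows "(\<lambda>y. theta t N y * growth ^ y t * norm (ckernel I j z y x)) summable_on PiE I (\<lambda>_. UNIV)"
    and "(\<Sum>\<^sub>\<infinity>y\<in>PiE I (\<lambda>_. UNIV). theta t N y * growth ^ y t * norm (ckernel I j z y x)) \<le> theta_const B * contraction B ^ N"
proof -
  have B: "B \<ge> 0" using z norm_ge_zero[of z] by linarith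
  define r where "r s = norm (cr j z x s)" for s
  define f where "f = (\<lambda>s k. (if s = t then growth ^ k else 1) * poisson_weight (r s) k)"
  define E where "E = (\<Prod>s\<in>I. exp (r s - Re (cr j z x s)))"
  have r: "0 \<le> r s" "r s \<le> rmax B" for s
    using crate_bounds(1)[OF x z] by (auto simp: r_def rmax_def)
  have tI: "t \<in> I" "finite I" by (auto simp: I_def)
  have N': "int N * blen \<le> int m" using N by (metis of_nat_1 of_nat_add of_nat_le_iff of_nat_mult)
  have UI: "(\<Union>i<N. block t i) \<subseteq> I" "t \<notin> (\<Union>i<N. block t i)"
    unfolding blocks_union I_def using N' by auto
  have fs: "(f s has_sum (if s = t then exp ((growth - 1) * r s) else 1)) UNIV" for s
    using power_poisson_weight_has_sum[of growth "r s"] poisson_weight_has_sum[of "r s"] by (auto simp: f_def)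
  have f0: "f s k \<ge> 0" for s k
    using growth_ge poisson_weight_nonneg[OF r(1)] by (auto simp: f_def)
  define q where "q s = (\<Sum>\<^sub>\<infinity>k. ratio k * f s k)" for s
  have qs: "(\<lambda>k. ratio k * f s k) summable_on UNIV" for s
    by (rule Infinite_Sum.summable_on_comparison_test[OF has_sum_imp_summable[OF fs[of s]]])
      (use f0 ratio_bounds in \<open>auto simp: less_imp_le mult_left_le_one_le\<close>)
  have q_le: "q s \<le> infsum (f s) UNIV" for s
    unfolding q_def by (rule infsum_mono[OF qs has_sum_imp_summable[OF fs[of s]]])
      (use f0 ratio_bounds in \<open>auto simp: less_imp_le mult_left_le_one_le\<close>)
  \<comment> \<open>Only the count 0 is kept; its weight exp(- r s) is at least exp(- rmax
    B).\<close>
  have q_ge: "exp (- rmax B) * ratio 0 \<le> q s" if "s \<noteq> t" for s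
  proof -
    have "exp (- rmax B) * ratio 0 \<le> ratio 0 * f s 0"
      using that r(2)[of s] ratio_bounds(1)[of 0] by (simp add: f_def poisson_weight_def)
    also have "\<dots> = (\<Sum>k\<in>{0}. ratio k * f s k)" by simp
    also have "\<dots> \<le> q s" unfolding q_def
      by (rule finite_sum_le_infsum[OF qs]) (use f0 ratio_bounds in \<open>auto simp: less_imp_le\<close>)
    finally show ?thesis .
  qed
  let ?v = "(\<Prod>i<N. (\<Prod>s\<in>block t i. infsum (f s) UNIV) - (\<Prod>s\<in>block t i. q s))
      * (\<Prod>s\<in>I - (\<Union>i<N. block t i). infsum (f s) UNIV)"
  have hs: "((\<lambda>y. (\<Prod>i<N. 1 - (\<Prod>s\<in>block t i. ratio (y s))) * (\<Prod>s\<in>I. f s (y s))) has_sum ?v) (PiE I (\<lambda>_. UNIV))"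
    unfolding q_def
  proof (rule has_sum_block_prod[OF tI(2)])
    show "\<bar>ratio k\<bar> \<le> 1" for k using ratio_bounds[of k] by simp
    show "(\<lambda>k. \<bar>f s k\<bar>) summable_on UNIV" for s using has_sum_imp_summable[OF fs] f0 by simp
  qed (use UI block_disjoint in auto)
  have e: "theta t N y * growth ^ y t * norm (ckernel I j z y x)
      = E * ((\<Prod>i<N. 1 - (\<Prod>s\<in>block t i. ratio (y s))) * (\<Prod>s\<in>I. f s (y s)))" for y
  proof -
    have "norm (ckernel I j z y x) = (\<Prod>s\<in>I. exp (r s - Re (cr j z x s)) * poisson_weight (r s) (y s))"
      unfolding ckernel_def by (simp add: prod_norm[symmetric] norm_poisson_kernel r_def)
    also have "\<dots> = E * (\<Prod>s\<in>I. poisson_weight (r s) (y s))" by (simp add: prod.distrib E_def)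
    finally have 1: "norm (ckernel I j z y x) = E * (\<Prod>s\<in>I. poisson_weight (r s) (y s))" .
    have 2: "(\<Prod>s\<in>I. f s (y s)) = growth ^ y t * (\<Prod>s\<in>I. poisson_weight (r s) (y s))"
      unfolding f_def prod.distrib using tI by (simp add: prod.delta)
    show ?thesis unfolding 1 2 theta_def by (simp add: mult_ac)
  qed
  have hs': "((\<lambda>y. theta t N y * growth ^ y t * norm (ckernel I j z y x)) has_sum E * ?v) (PiE I (\<lambda>_. UNIV))"
    unfolding e by (rule has_sum_cmult_right[OF hs])
  then show "(\<lambda>y. theta t N y * growth ^ y t * norm (ckernel I j z y x)) summable_on PiE I (\<lambda>_. UNIV)"
    by (rule has_sum_imp_summable)
  have v1: "(\<Prod>s\<in>I - (\<Union>i<N. block t i). infsum (f s) UNIV) = exp ((growth - 1) * r t)"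
  proof -
    have "(\<Prod>s\<in>I - (\<Union>i<N. block t i). infsum (f s) UNIV) = (\<Prod>s\<in>I - (\<Union>i<N. block t i). if s = t then exp ((growth - 1) * r t) else 1)"
      using infsumI[OF fs] by (intro prod.cong) auto
    also have "\<dots> = exp ((growth - 1) * r t)" using tI UI by (subst prod.delta) auto
    finally show ?thesis .
  qed
  \<comment> \<open>No block contains \<open>t\<close>, so the weight \<open>growth\<close> is
    absent here and the first product is 1: the difference is one minus the mean of the product of
    ratios.\<close>
  have v2: "0 \<le> (\<Prod>s\<in>block t i. infsum (f s) UNIV) - (\<Prod>s\<in>block t i. q s) \<and>
      (\<Prod>s\<in>block t i. infsum (f s) UNIV) - (\<Prod>s\<in>block t i. q s) \<le> contraction B" if "i < N" for i
  proof -
    have nt: "s \<noteq> t" if "s \<in> block t i" for s using UI that \<open>i < N\<close> by auto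
    have one: "(\<Prod>s\<in>block t i. infsum (f s) UNIV) = 1"
      by (rule prod.neutral) (use infsumI[OF fs] nt in auto)
    have k: "0 \<le> exp (- rmax B) * ratio 0" using ratio_bounds(1)[of 0] by simp
    have "(\<Prod>s\<in>block t i. q s) \<le> (\<Prod>s\<in>block t i. infsum (f s) UNIV)"
      by (intro prod_mono conjI q_le) (use q_ge nt k order_trans in blast)
    moreover have "(exp (- rmax B) * ratio 0) ^ (L + 1) \<le> (\<Prod>s\<in>block t i. q s)"
    proof -
      have "card (block t i) = L + 1" by (simp add: block_def algebra_simps nat_add_distrib)
      then have "(exp (- rmax B) * ratio 0) ^ (L + 1) = (\<Prod>s\<in>block t i. exp (- rmax B) * ratio 0)" by simp
      also have "\<dots> \<le> (\<Prod>s\<in>block t i. q s)"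
        by (intro prod_mono conjI k q_ge nt)
      finally show ?thesis .
    qed
    ultimately show ?thesis unfolding one contraction_def by simp
  qed
  have "(\<Prod>i<N. (\<Prod>s\<in>block t i. infsum (f s) UNIV) - (\<Prod>s\<in>block t i. q s)) \<le> (\<Prod>i<N. contraction B)"
    by (rule prod_mono) (use v2 in auto)
  then have v3: "?v \<le> contraction B ^ N * exp ((growth - 1) * rmax B)"
    unfolding v1 using r growth_ge(1) contraction_bounds[of B] B by (intro mult_mono) auto
  \<comment> \<open>At most the L + 1 outputs reached by the fixed symbol contribute to the
    exponent, whatever the length of the window.\<close>
  have E1: "E \<le> exp (2 * B * (real L + 1))"
  proof -
    have "(\<Sum>s\<in>I. r s - Re (cr j z x s)) \<le> (\<Sum>s\<in>I. if s \<in> {j..j + int L} then 2 * B else 0)"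
      unfolding r_def by (intro sum_mono crate_bounds(3)[OF x z])
    also have "\<dots> = (\<Sum>s\<in>I \<inter> {j..j + int L}. 2 * B)"
      using tI by (subst sum.inter_restrict) auto
    also have "\<dots> \<le> (\<Sum>s\<in>{j..j + int L}. 2 * B)" using B by (intro sum_mono2) auto
    also have "\<dots> = 2 * B * (real L + 1)" by simp
    finally show ?thesis using tI by (simp add: E_def exp_sum[symmetric])
  qed
  have v0: "0 \<le> ?v" unfolding v1 using v2 by (intro mult_nonneg_nonneg prod_nonneg) auto
  have "E * ?v \<le> exp (2 * B * (real L + 1)) * (contraction B ^ N * exp ((growth - 1) * rmax B))"
    by (rule mult_mono[OF E1 v3 _ v0]) simp
  then show "(\<Sum>\<^sub>\<infinity>y\<in>PiE I (\<lambda>_. UNIV). theta t N y * growth ^ y t * norm (ckernel I j z y x)) \<le> theta_const B * contraction B ^ N"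
    unfolding infsumI[OF hs'] theta_const_def by (simp add: mult_ac)
qed

lemma theta_sum_bound:
  fixes t :: int
  assumes F: "F \<in> laws" and z: "norm z \<le> B" and N: "N * (L + 1) \<le> m"
  defines "I \<equiv> {t - int m..t}"
  shows "(\<lambda>y. theta t N y * growth ^ y t * norm (cmass F I j z y)) summable_on PiE I (\<lambda>_. UNIV)" (is ?A)
    and "(\<Sum>\<^sub>\<infinity>y\<in>PiE I (\<lambda>_. UNIV). theta t N y * growth ^ y t * norm (cmass F I j z y)) \<le> theta_const B * contraction B ^ N" (is ?B)
proof -
  let ?K = "\<lambda>y x. theta t N y * growth ^ y t * norm (ckernel I j z y x)"
  have int: "integrable (inputs F) (?K y)" for y
    by (intro integrable_mult_right integrable_norm integrable_ckernel F)
  have pos: "?K y x \<ge> 0" for y x using theta_bounds growth_ge by auto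
  have s: "(\<lambda>y. \<integral>x. ?K y x \<partial>inputs F) summable_on PiE I (\<lambda>_. UNIV)"
    and le: "(\<Sum>\<^sub>\<infinity>y\<in>PiE I (\<lambda>_. UNIV). \<integral>x. ?K y x \<partial>inputs F) \<le> theta_const B * contraction B ^ N"
  proof -
    have k1: "(\<lambda>y. ?K y x) summable_on PiE I (\<lambda>_. UNIV)" if "x \<in> space (inputs F)" for x
      unfolding I_def by (rule theta_kernel_sum(1)[OF _ z N]) (use that in \<open>auto simp: space_inputs[OF F]\<close>)
    have k2: "(\<Sum>\<^sub>\<infinity>y\<in>PiE I (\<lambda>_. UNIV). ?K y x) \<le> theta_const B * contraction B ^ N" if "x \<in> space (inputs F)" for x
      unfolding I_def by (rule theta_kernel_sum(2)[OF _ z N]) (use that in \<open>auto simp: space_inputs[OF F]\<close>)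
    show "(\<lambda>y. \<integral>x. ?K y x \<partial>inputs F) summable_on PiE I (\<lambda>_. UNIV)"
      by (rule summable_on_integral_bound(1)[OF prob_inputs[OF F] int pos k1 k2])
    show "(\<Sum>\<^sub>\<infinity>y\<in>PiE I (\<lambda>_. UNIV). \<integral>x. ?K y x \<partial>inputs F) \<le> theta_const B * contraction B ^ N"
      by (rule summable_on_integral_bound(2)[OF prob_inputs[OF F] int pos k1 k2])
  qed
  have dom: "theta t N y * growth ^ y t * norm (cmass F I j z y) \<le> (\<integral>x. ?K y x \<partial>inputs F)" for y
  proof -
    have "norm (cmass F I j z y) \<le> (\<integral>x. norm (ckernel I j z y x) \<partial>inputs F)"
      unfolding cmass_def by (rule integral_norm_bound)
    then show ?thesis using theta_bounds growth_ge by (simp add: mult_left_mono)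
  qed
  have pos': "0 \<le> theta t N y * growth ^ y t * norm (cmass F I j z y)" for y
    using theta_bounds growth_ge by auto
  show ?A by (rule Infinite_Sum.summable_on_comparison_test[OF s]) (use dom pos' in auto)
  then show ?B using infsum_mono[OF _ s dom] le by (meson order_trans)
qed

definition exp_info :: "real measure \<Rightarrow> int \<Rightarrow> nat \<Rightarrow> int \<Rightarrow> complex \<Rightarrow> complex" where
  "exp_info F t m j z = (\<Sum>\<^sub>\<infinity>y\<in>window (t - int m) t. of_real (info F t m y) * cmass F {t - int m..t} j z y)"

lemma info_dom:
  assumes F: "F \<in> laws" and I: "finite I" "t \<in> I"
  shows "\<bar>info F t m y\<bar> \<le> growth_const * (\<Prod>s\<in>I. growth ^ y s)"
proof -
  have "(\<Prod>s\<in>{t}. growth ^ y s) \<le> (\<Prod>s\<in>I. growth ^ y s)"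
    by (rule prod_mono2) (use I growth_ge in \<open>auto simp: one_le_power\<close>)
  then have "growth_const * growth ^ y t \<le> growth_const * (\<Prod>s\<in>I. growth ^ y s)"
    using growth_ge by (intro mult_left_mono) auto
  then show ?thesis using info_bounds[OF F, where t=t and m=m and y=y] by linarith
qed

lemma info_cmass_summable:
  assumes F: "F \<in> laws" and I: "finite I" "t \<in> I"
  shows "(\<lambda>y. norm (of_real (info F t m y) * cmass F I j z y)) summable_on PiE I (\<lambda>_. UNIV)"
  by (rule cmass_weighted_summable[OF F I(1) _ info_dom[OF F I]]) (use growth_ge in auto)

lemma exp_info_larger_window:
  assumes F: "F \<in> laws" and I: "finite I" "{t - int m..t} \<subseteq> I"
  shows "(\<Sum>\<^sub>\<infinity>y\<in>PiE I (\<lambda>_. UNIV). of_real (info F t m y) * cmass F I j z y) = exp_info F t m j z"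
proof -
  let ?H = "{t - int m..t}"
  have U: "?H \<union> (I - ?H) = I" using I by auto
  have b: "growth \<ge> 1" using growth_ge by simp
  have d: "\<bar>info F t m y\<bar> \<le> growth_const * (\<Prod>s\<in>?H. growth ^ y s)" for y by (rule info_dom[OF F]) auto
  have c: "info F t m y = info F t m y'" if "\<And>s. s \<in> ?H \<Longrightarrow> y s = y' s" for y y'
    using cprob_cong[of t m y y' F] that by (simp add: info_def)
  have "(\<Sum>\<^sub>\<infinity>y\<in>PiE (?H \<union> (I - ?H)) (\<lambda>_. UNIV). of_real (info F t m y) * cmass F (?H \<union> (I - ?H)) j z y)
      = (\<Sum>\<^sub>\<infinity>y\<in>PiE ?H (\<lambda>_. UNIV). of_real (info F t m y) * cmass F ?H j z y)"
    by (rule cmass_weighted_marginal[OF F _ _ _ b d c]) (use I in auto)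
  then show ?thesis unfolding U exp_info_def window_def .
qed

text \<open>By consistency of the marginals both expectations may be taken over the longer window,
  where the pointwise forgetting estimate is summed against the modulus. The bound is free of
  \<open>t\<close>, \<open>j\<close> and \<open>F\<close>.\<close>

lemma exp_info_diff:
  assumes F: "F \<in> laws" and z: "norm z \<le> B" and m: "m \<le> m'"
  shows "norm (exp_info F t m' j z - exp_info F t m j z) \<le> growth_const * theta_const B * contraction B ^ (m div (L + 1))"
proof -
  let ?I = "{t - int m'..t}" let ?N = "m div (L + 1)"
  let ?W = "PiE ?I (\<lambda>_. UNIV)"
  have N: "?N * (L + 1) \<le> m'" using m div_times_less_eq_dividend[of m "L + 1"] by linarith
  have N0: "?N * (L + 1) \<le> m" by (rule div_times_less_eq_dividend)
  let ?b = "\<lambda>y. theta t ?N y * growth ^ y t * norm (cmass F ?I j z y)"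
  note s = theta_sum_bound[OF F z N, where t=t and j=j]
  have s1: "((\<lambda>y. of_real (info F t k y) * cmass F ?I j z y) has_sum exp_info F t k j z) ?W" if "k \<le> m'" for k
  proof -
    have s: "(\<lambda>y. of_real (info F t k y) * cmass F ?I j z y) summable_on ?W"
      by (rule abs_summable_summable, rule info_cmass_summable[OF F]) auto
    have "{t - int k..t} \<subseteq> ?I" using that by auto
    then have e: "(\<Sum>\<^sub>\<infinity>y\<in>?W. of_real (info F t k y) * cmass F ?I j z y) = exp_info F t k j z"
      by (intro exp_info_larger_window F) auto
    show ?thesis unfolding e[symmetric] by (rule has_sum_infsum[OF s])
  qed
  have "norm (exp_info F t m' j z - exp_info F t m j z) \<le> growth_const * (\<Sum>\<^sub>\<infinity>y\<in>?W. ?b y)"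
  proof (rule norm_infsum_le)
    show "((\<lambda>y. of_real (info F t m' y) * cmass F ?I j z y - of_real (info F t m y) * cmass F ?I j z y) has_sum
      exp_info F t m' j z - exp_info F t m j z) ?W"
      by (rule has_sum_difference[OF s1 s1]) (use m in auto)
    show "((\<lambda>y. growth_const * ?b y) has_sum growth_const * (\<Sum>\<^sub>\<infinity>y\<in>?W. ?b y)) ?W"
      by (rule has_sum_cmult_right[OF has_sum_infsum[OF s(1)]])
    fix y
    have "norm (of_real (info F t m' y) * cmass F ?I j z y - of_real (info F t m y) * cmass F ?I j z y)
        = \<bar>info F t m' y - info F t m y\<bar> * norm (cmass F ?I j z y)"
      by (metis left_diff_distrib norm_mult norm_of_real of_real_diff)
    also have "\<dots> \<le> (growth_const * (theta t ?N y * growth ^ y t)) * norm (cmass F ?I j z y)"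
      by (intro mult_right_mono info_forgetting'[OF F N0 m]) auto
    finally show "norm (of_real (info F t m' y) * cmass F ?I j z y - of_real (info F t m y) * cmass F ?I j z y) \<le> growth_const * ?b y"
      by (simp add: mult_ac)
  qed
  also have "\<dots> \<le> growth_const * (theta_const B * contraction B ^ ?N)"
    by (rule mult_left_mono[OF s(2)]) (use growth_ge(3) in linarith)
  finally show ?thesis by (simp add: mult_ac)
qed

lemma exp_info_bound:
  assumes F: "F \<in> laws" and z: "norm z \<le> B"
  shows "norm (exp_info F t m j z) \<le> growth_const * theta_const B"
proof -
  let ?I = "{t - int m..t}" let ?W = "PiE ?I (\<lambda>_. UNIV)"
  let ?b = "\<lambda>y. theta t 0 y * growth ^ y t * norm (cmass F ?I j z y)"
  have N: "0 * (L + 1) \<le> m" by simp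
  note s = theta_sum_bound[OF F z N, where t=t and j=j]
  have "norm (exp_info F t m j z) \<le> growth_const * (\<Sum>\<^sub>\<infinity>y\<in>?W. ?b y)"
    unfolding exp_info_def window_def
  proof (rule norm_infsum_le)
    show "((\<lambda>y. of_real (info F t m y) * cmass F ?I j z y) has_sum
      (\<Sum>\<^sub>\<infinity>y\<in>?W. of_real (info F t m y) * cmass F ?I j z y)) ?W"
      by (rule has_sum_infsum, rule abs_summable_summable, rule info_cmass_summable[OF F]) auto
    show "((\<lambda>y. growth_const * ?b y) has_sum growth_const * (\<Sum>\<^sub>\<infinity>y\<in>?W. ?b y)) ?W"
      by (rule has_sum_cmult_right[OF has_sum_infsum[OF s(1)]])
    fix y
    have "norm (of_real (info F t m y) * cmass F ?I j z y) \<le> (growth_const * growth ^ y t) * norm (cmass F ?I j z y)"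
      unfolding norm_mult norm_of_real using info_bounds[OF F, where t=t and m=m and y=y]
      by (intro mult_right_mono) auto
    then show "norm (of_real (info F t m y) * cmass F ?I j z y) \<le> growth_const * ?b y"
      by (simp add: theta_def)
  qed
  also have "\<dots> \<le> growth_const * (theta_const B * contraction B ^ 0)"
    by (rule mult_left_mono[OF s(2)]) (use growth_ge(3) in linarith)
  finally show ?thesis by simp
qed

text \<open>A symbol fixed at time \<open>t + 1\<close> does not reach the outputs up to time \<open>t\<close>, so
  \<open>exp_info F t m (t + 1) 0\<close> is the baseline expectation.\<close>

definition hist_diff :: "real measure \<Rightarrow> int \<Rightarrow> nat \<Rightarrow> int \<Rightarrow> complex \<Rightarrow> complex" where
  "hist_diff F t m j z = exp_info F t m j z - exp_info F t m (t + 1) 0"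

text \<open>The exponent 1 / (L + 1) converts blocks into single outputs. The further square root is
  held in reserve: estimates hold with exponents 2m and 2t, and combine into m + t.\<close>

definition forget_rate :: "real \<Rightarrow> real" where
  "forget_rate B = contraction B powr (1 / (2 * (real L + 1)))"

text \<open>One division by \<open>contraction B\<close> pays for rounding m down to whole blocks;
  the division by \<open>forget_rate B ^ (2 * (L + 1))\<close> pays for the L + 1 steps of lag
  during which the fixed symbol acts.\<close>

definition forget_const :: "real \<Rightarrow> real" where
  "forget_const B = (2 * growth_const * theta_const B / contraction B) / forget_rate B ^ (2 * (L + 1))"

lemma forget_rate_bounds:
  assumes B: "B \<ge> 0" shows "0 < forget_rate B" "forget_rate B < 1" "forget_rate B ^ (2 * (L + 1)) = contraction B"
proof -
  note c = contraction_bounds(1)[OF B] contraction_bounds(2)[of B]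
  show "0 < forget_rate B" using c by (simp add: forget_rate_def)
  then have "forget_rate B ^ (2 * (L + 1)) = forget_rate B powr real (2 * (L + 1))" by (rule powr_realpow[symmetric])
  also have "\<dots> = contraction B powr (1 / (2 * (real L + 1)) * real (2 * (L + 1)))"
    unfolding forget_rate_def by (rule powr_powr)
  also have "1 / (2 * (real L + 1)) * real (2 * (L + 1)) = 1" by (simp add: field_simps)
  finally show "forget_rate B ^ (2 * (L + 1)) = contraction B" using c by simp
  then show "forget_rate B < 1" using c one_le_power[of "forget_rate B" "2 * (L + 1)"] by (cases "forget_rate B < 1") auto
qed

text \<open>Rounding down to whole blocks loses less than one block, hence at most one factor
  \<open>contraction B\<close>.\<close>

lemma contraction_div_le:
  assumes B: "B \<ge> 0" shows "contraction B ^ (m div (L + 1)) \<le> forget_rate B ^ (2 * m) / contraction B"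
proof -
  note s = forget_rate_bounds[OF B] and c = contraction_bounds(1)[OF B]
  have "contraction B ^ (m div (L + 1)) * contraction B = forget_rate B ^ (2 * (L + 1) * (m div (L + 1) + 1))"
    using power_mult[of "forget_rate B" "2 * (L + 1)" "m div (L + 1) + 1"] unfolding s(3) by simp
  also have "\<dots> \<le> forget_rate B ^ (2 * m)"
  proof (rule power_decreasing)
    have "m < (L + 1) * (m div (L + 1) + 1)" using dividend_less_div_times[of "L + 1" m] by (simp add: algebra_simps)
    then show "2 * m \<le> 2 * (L + 1) * (m div (L + 1) + 1)" by (simp only: mult.assoc)
  qed (use s in auto)
  finally show ?thesis using c by (simp add: field_simps)
qed

lemma forget_const_ge:
  assumes B: "B \<ge> 0" shows "2 * growth_const * theta_const B / contraction B \<le> forget_const B" "2 * growth_const * theta_const B \<le> forget_const B" "forget_const B > 0"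
proof -
  note s = forget_rate_bounds[OF B] and c = contraction_bounds(1)[OF B] contraction_bounds(2)[of B]
  have p: "2 * growth_const * theta_const B > 0" using growth_ge theta_const_pos[of B] by simp
  have le: "u \<le> u / contraction B" if "u \<ge> 0" for u
    using that c mult_left_le[of "contraction B" u] by (simp add: field_simps)
  show 1: "2 * growth_const * theta_const B / contraction B \<le> forget_const B" unfolding forget_const_def s(3) by (rule le) (use p c in simp)
  show "2 * growth_const * theta_const B \<le> forget_const B" using le[of "2 * growth_const * theta_const B"] p 1 by linarith
  with p show "forget_const B > 0" by linarith
qed

lemma hist_diff_diff:
  assumes F: "F \<in> laws" and z: "norm z \<le> B" and m: "m \<le> m'"
  shows "norm (hist_diff F t m' j z - hist_diff F t m j z) \<le> forget_const B * forget_rate B ^ (2 * m)"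
proof -
  have B: "B \<ge> 0" using z norm_ge_zero[of z] by linarith
  have "norm (hist_diff F t m' j z - hist_diff F t m j z) \<le> norm (exp_info F t m' j z - exp_info F t m j z)
      + norm (exp_info F t m' (t + 1) 0 - exp_info F t m (t + 1) 0)"
    unfolding hist_diff_def by (rule norm_diff_diff_le)
  also have "\<dots> \<le> 2 * growth_const * theta_const B * contraction B ^ (m div (L + 1))"
    using exp_info_diff[OF F z m, of t j] exp_info_diff[OF F _ m, of 0 B t "t + 1"] B by simp
  also have "\<dots> \<le> 2 * growth_const * theta_const B * (forget_rate B ^ (2 * m) / contraction B)"
    using growth_ge theta_const_pos[of B] by (intro mult_left_mono contraction_div_le[OF B]) auto
  also have "\<dots> = 2 * growth_const * theta_const B / contraction B * forget_rate B ^ (2 * m)" by simp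
  also have "\<dots> \<le> forget_const B * forget_rate B ^ (2 * m)"
    using forget_rate_bounds[OF B] by (intro mult_right_mono forget_const_ge[OF B]) auto
  finally show ?thesis .
qed

lemma hist_diff_zero:
  assumes F: "F \<in> laws" and "{t - int m..t} \<inter> {j..j + int L} = {}"
  shows "hist_diff F t m j z = 0"
proof -
  have "cmass F {t - int m..t} j z y = cmass F {t - int m..t} (t + 1) 0 y" for y
    using cmass_unaffected[OF F, of "{t - int m..t}" j z y] cmass_unaffected[OF F, of "{t - int m..t}" "t + 1" 0 y] assms(2) by auto
  then show ?thesis by (simp add: hist_diff_def exp_info_def)
qed

text \<open>For small lags the functional is merely bounded. For large lags it is an increment over
  a history that does not reach the fixed symbol's outputs, where it vanishes, so decay in the
  history length becomes decay in the lag.\<close>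

lemma hist_diff_bound:
  assumes F: "F \<in> laws" and z: "norm z \<le> B" and t: "t \<ge> j"
  shows "norm (hist_diff F t m j z) \<le> forget_const B * forget_rate B ^ (2 * nat (t - j))"
proof -
  have B: "B \<ge> 0" using z norm_ge_zero[of z] by linarith
  note s = forget_rate_bounds[OF B] and c = contraction_bounds(1)[OF B] contraction_bounds(2)[of B]
  let ?C = "2 * growth_const * theta_const B / contraction B"
  have C: "?C \<ge> 0" "2 * growth_const * theta_const B \<le> ?C" using growth_ge theta_const_pos[of B] c
    mult_left_le[of "contraction B" "2 * growth_const * theta_const B"] by (auto simp: field_simps)
  have eC: "?C * forget_rate B ^ k \<le> forget_const B * forget_rate B ^ n" if "n \<le> k + 2 * (L + 1)" for k n
  proof -
    have "forget_rate B ^ (k + 2 * (L + 1)) \<le> forget_rate B ^ n" by (rule power_decreasing) (use that s in auto)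
    then have "forget_rate B ^ k \<le> forget_rate B ^ n / forget_rate B ^ (2 * (L + 1))" using s(1) by (simp add: power_add field_simps)
    from mult_left_mono[OF this C(1)] show ?thesis by (simp add: forget_const_def)
  qed
  show ?thesis
  proof (cases "t - j \<le> int L")
    case True
    have "norm (hist_diff F t m j z) \<le> norm (exp_info F t m j z) + norm (exp_info F t m (t + 1) 0)"
      unfolding hist_diff_def by (rule norm_triangle_ineq4)
    also have "\<dots> \<le> ?C * forget_rate B ^ 0"
      using exp_info_bound[OF F z, of t m j] exp_info_bound[OF F, of 0 B t m "t + 1"] B C(2) by simp
    also have "\<dots> \<le> forget_const B * forget_rate B ^ (2 * nat (t - j))" by (rule eC) (use True in auto)
    finally show ?thesis .
  next
    case False
    \<comment> \<open>The longest history that misses all affected outputs: it starts at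
      \<open>t - m0 = j + L + 1\<close>.\<close>
    define m0 where "m0 = nat (t - j) - (L + 1)"
    have m0: "int m0 = t - j - int L - 1" using False by (simp add: m0_def)
    have z0: "hist_diff F t k j z = 0" if "k \<le> m0" for k
      by (rule hist_diff_zero[OF F]) (use that m0 in auto)
    show ?thesis
    proof (cases "m \<le> m0")
      case True
      then show ?thesis using z0[OF True] forget_const_ge(3)[OF B] s by simp
    next
      case False
      have "norm (hist_diff F t m j z) = norm (hist_diff F t m j z - hist_diff F t m0 j z)" by (simp add: z0)
      also have "\<dots> \<le> norm (exp_info F t m j z - exp_info F t m0 j z)
          + norm (exp_info F t m (t + 1) 0 - exp_info F t m0 (t + 1) 0)"
        unfolding hist_diff_def by (rule norm_diff_diff_le)
      also have "\<dots> \<le> 2 * growth_const * theta_const B * contraction B ^ (m0 div (L + 1))"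
        using exp_info_diff[OF F z, of m0 m t j] exp_info_diff[OF F, of 0 B m0 m t "t + 1"] B False by simp
      also have "\<dots> \<le> 2 * growth_const * theta_const B * (forget_rate B ^ (2 * m0) / contraction B)"
        using growth_ge theta_const_pos[of B] by (intro mult_left_mono contraction_div_le[OF B]) auto
      also have "\<dots> = ?C * forget_rate B ^ (2 * m0)" by simp
      also have "\<dots> \<le> forget_const B * forget_rate B ^ (2 * nat (t - j))" by (rule eC) (auto simp: m0_def)
      finally show ?thesis .
    qed
  qed
qed

section \<open>Stationarity\<close>

lemma distr_shift_inputs:
  assumes F: "F \<in> laws"
  shows "(\<lambda>x k. x (k + c)) \<in> inputs F \<rightarrow>\<^sub>M inputs F" "distr (inputs F) (inputs F) (\<lambda>x k. x (k + c)) = inputs F"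
proof -
  show "(\<lambda>x k. x (k + c)) \<in> inputs F \<rightarrow>\<^sub>M inputs F"
    by (rule measurable_PiM_single') (auto simp: space_PiM PiE_iff)
  show "distr (inputs F) (inputs F) (\<lambda>x k. x (k + c)) = inputs F"
    using distr_PiM_reindex[of UNIV "\<lambda>_. F" "\<lambda>k. k + c" UNIV] laws_uptoD(1)[OF F] by (simp add: restrict_def)
qed

lemma cmass_shift:
  assumes F: "F \<in> laws"
  shows "cmass F {a - c..b - c} (j - c) z (\<lambda>s. y (s + c)) = cmass F {a..b} j z y"
proof -
  have "cmass F {a - c..b - c} (j - c) z (\<lambda>s. y (s + c))
      = (\<integral>x. ckernel {a - c..b - c} (j - c) z (\<lambda>s. y (s + c)) (\<lambda>k. x (k + c)) \<partial>inputs F)"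
    unfolding cmass_def by (subst distr_shift_inputs(2)[OF F, of c, symmetric],
        rule integral_distr[OF distr_shift_inputs(1)[OF F]]) (intro measurable_ckernel F subset_UNIV)
  also have "\<dots> = (\<integral>x. ckernel {a..b} j z y x \<partial>inputs F)"
  proof (rule Bochner_Integration.integral_cong[OF refl])
    fix x
    have "cr (j - c) z (\<lambda>k. x (k + c)) (s - c) = cr j z x s" for s
      unfolding crate_def by (intro arg_cong2[where f="(+)"] sum.cong refl) (auto simp: algebra_simps)
    then have e: "cr (j - c) z (\<lambda>k. x (k + c)) s = cr j z x (s + c)" for s by (metis add_diff_cancel_right')
    have im: "{a..b} = (\<lambda>s. s + c) ` {a - c..b - c}" by auto
    show "ckernel {a - c..b - c} (j - c) z (\<lambda>s. y (s + c)) (\<lambda>k. x (k + c)) = ckernel {a..b} j z y x"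
      unfolding ckernel_def im by (subst prod.reindex) (auto simp: e)
  qed
  finally show ?thesis by (simp add: cmass_def)
qed

lemma bmass_shift:
  assumes F: "F \<in> laws"
  shows "bmass F {a - c..b - c} (\<lambda>s. y (s + c)) = bmass F {a..b} y"
  using cmass_shift[OF F, of a c b "b + 1" 0 y] cmass_unaffected[OF F, of "{a..b}" "b + 1" 0 y]
    cmass_unaffected[OF F, of "{a - c..b - c}" "b + 1 - c" 0 "\<lambda>s. y (s + c)"] by simp

lemma info_shift:
  assumes F: "F \<in> laws"
  shows "info F (t - c) m (\<lambda>s. y (s + c)) = info F t m y"
proof -
  have e: "{t - c - int m..t - c} = {t - int m - c..t - c}" "{t - c - int m..<t - c} = {t - int m - c..t - 1 - c}"
    "{t - int m..<t} = {t - int m..t - 1}" by auto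
  show ?thesis unfolding info_def cprob_def e bmass_shift[OF F] ..
qed

lemma exp_info_shift:
  assumes F: "F \<in> laws"
  shows "exp_info F (t - c) m (j - c) z = exp_info F t m j z"
proof -
  let ?g = "\<lambda>y s. if s \<in> {t - int m - c..t - c} then y (s + c) else (undefined :: nat)"
  have w: "t - c - int m = t - int m - c" by simp
  have "exp_info F (t - c) m (j - c) z = (\<Sum>\<^sub>\<infinity>y\<in>window (t - int m) t. of_real (info F (t - c) m (?g y)) * cmass F {t - int m - c..t - c} (j - c) z (?g y))"
    unfolding exp_info_def w by (rule infsum_reindex_bij_betw[symmetric, OF window_shift_bij])
  also have "\<dots> = exp_info F t m j z" unfolding exp_info_def
  proof (rule infsum_cong)
    fix y
    have 1: "info F (t - c) m (?g y) = info F (t - c) m (\<lambda>s. y (s + c))"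
      unfolding info_def by (intro arg_cong[where f="\<lambda>u. - ln u"] cprob_cong) auto
    have 2: "cmass F {t - int m - c..t - c} (j - c) z (?g y) = cmass F {t - int m - c..t - c} (j - c) z (\<lambda>s. y (s + c))"
      by (rule cmass_cong) auto
    show "of_real (info F (t - c) m (?g y)) * cmass F {t - int m - c..t - c} (j - c) z (?g y)
        = of_real (info F t m y) * cmass F {t - int m..t} j z y"
      unfolding 1 2 info_shift[OF F] cmass_shift[OF F] ..
  qed
  finally show ?thesis .
qed

lemma hist_diff_shift: "F \<in> laws \<Longrightarrow> hist_diff F (t - c) m (j - c) z = hist_diff F t m j z"
  unfolding hist_diff_def diff_add_eq[of t c 1] using exp_info_shift[of F t c m j z] exp_info_shift[of F t c m "t + 1" 0] by simp

section \<open>Convergence and analyticity\<close>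

text \<open>The exponential factors depend on \<open>z\<close> through the real slopes alone, not on
  the inputs, and leave the integral. What remains is a polynomial in \<open>z\<close> of bounded
  degree with bounded coefficients, whose integral is again a polynomial.\<close>

lemma cmass_holomorphic:
  assumes F: "F \<in> laws" and I: "finite I"
  shows "(\<lambda>z. cmass F I j z y) holomorphic_on UNIV"
proof -
  define d where "d s = (if s \<in> {j..j + int L} then complex_of_real (h (nat (s - j))) else 0)" for s
  define c where "c s x = complex_of_real (rt (x(j := 0)) s)" for s x
  \<comment> \<open>\<open>[:a, 0:]\<close> is the constant polynomial \<open>a\<close>, written so
    that both factors have the shape of \<open>poly_family_linear\<close>.\<close>
  define p where "p x = (\<Prod>s\<in>I. [:exp (- c s x) / fact (y s), 0:] * [:c s x, d s:] ^ y s)" for x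
  have u: "(0::real) \<in> {0..A}" using A by simp
  have cm: "c s \<in> borel_measurable (inputs F)" for s
    unfolding c_def[abs_def]
    by (rule measurable_compose[OF measurable_compose[OF measurable_fix_input[OF F u] measurable_rate[OF F]] borel_measurable_of_real])
  have cb: "0 \<le> Re (c s x) \<and> norm (c s x) \<le> lam0 + A" if "x \<in> space (inputs F)" for s x
  proof -
    have "lam0 \<le> rt (x(j := 0)) s" "rt (x(j := 0)) s \<le> lam0 + A"
      using rate_bounds[of "x(j := 0)" s] that A by (auto simp: space_inputs[OF F] fun_upd_def)
    then show ?thesis using lam0 by (simp add: c_def)
  qed
  have "poly_family (inputs F) p"
    unfolding p_def[abs_def]
  proof (intro poly_family_prod poly_family_mult poly_family_power)
    fix s
    show "poly_family (inputs F) (\<lambda>x. [:c s x, d s:])"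
      by (rule poly_family_linear[OF cm]) (use cb in blast)
    show "poly_family (inputs F) (\<lambda>x. [:exp (- c s x) / fact (y s), 0:])"
    proof (rule poly_family_linear[where C="1 / fact (y s)"])
      show "(\<lambda>x. exp (- c s x) / fact (y s)) \<in> borel_measurable (inputs F)"
        using cm[of s] by (intro borel_measurable_divide borel_measurable_const measurable_compose[OF borel_measurable_uminus[OF cm]] borel_measurable_continuous_onI continuous_intros)
      show "norm (exp (- c s x) / fact (y s)) \<le> 1 / fact (y s)" if "x \<in> space (inputs F)" for x
        using cb[OF that, of s] by (simp add: norm_divide divide_right_mono)
    qed
  qed
  then have 1: "(\<lambda>z. \<integral>x. poly (p x) z \<partial>inputs F) holomorphic_on UNIV"
    by (rule poly_family_integral[OF prob_inputs[OF F]])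
  have "ckernel I j z y x = exp (- (z * (\<Sum>s\<in>I. d s))) * poly (p x) z" for z x
  proof -
    have "cr j z x s = c s x + d s * z" for s
      unfolding crate_split[of x j z s] c_def d_def by auto
    then have "ckernel I j z y x = (\<Prod>s\<in>I. exp (- (z * d s)) * (exp (- c s x) / fact (y s) * (c s x + d s * z) ^ y s))"
      unfolding ckernel_def poisson_kernel_def by (intro prod.cong) (auto simp: exp_add[symmetric] exp_diff algebra_simps exp_minus field_simps)
    also have "\<dots> = (\<Prod>s\<in>I. exp (- (z * d s))) * (\<Prod>s\<in>I. exp (- c s x) / fact (y s) * (c s x + d s * z) ^ y s)"
      by (rule prod.distrib)
    also have "(\<Prod>s\<in>I. exp (- c s x) / fact (y s) * (c s x + d s * z) ^ y s) = poly (p x) z"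
      by (simp add: p_def poly_prod poly_power mult_ac)
    also have "(\<Prod>s\<in>I. exp (- (z * d s))) = exp (- (z * (\<Sum>s\<in>I. d s)))"
      using I by (simp add: exp_sum[symmetric] sum_negf sum_distrib_left)
    finally show ?thesis .
  qed
  then have "(\<lambda>z. cmass F I j z y) = (\<lambda>z. exp (- (z * (\<Sum>s\<in>I. d s))) * (\<integral>x. poly (p x) z \<partial>inputs F))"
    by (simp add: cmass_def)
  then show ?thesis using 1 by (auto intro!: holomorphic_intros)
qed

lemma cmass_summable:
  assumes F: "F \<in> laws" and I: "finite I"
  shows "(\<lambda>y. norm (cmass F I j z y)) summable_on PiE I (\<lambda>_. UNIV)"
  using cmass_weighted_summable[OF F I, of 1 "\<lambda>_. 1" 1 j z] by simp

text \<open>The majorant is summable and uniform on each disc about 0, so the sum over windows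
  converges uniformly there and the limit is entire.\<close>

lemma exp_info_holomorphic:
  assumes F: "F \<in> laws"
  shows "(\<lambda>z. exp_info F t m j z) holomorphic_on UNIV"
proof (rule entire_uniform_limit)
  let ?I = "{t - int m..t}"
  show "(\<lambda>z. \<Sum>y\<in>S. of_real (info F t m y) * cmass F ?I j z y) holomorphic_on UNIV" for S
    by (intro holomorphic_intros cmass_holomorphic F) auto
  show "finite_subsets_at_top (window (t - int m) t) \<noteq> bot" by simp
  fix B :: real assume B: "B \<ge> 0"
  show "uniform_limit (cball 0 B) (\<lambda>S z. \<Sum>y\<in>S. of_real (info F t m y) * cmass F ?I j z y) (\<lambda>z. exp_info F t m j z)
      (finite_subsets_at_top (window (t - int m) t))"
    unfolding exp_info_def
  proof (rule Weierstrass_m_test_general)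
    show "(\<lambda>y. growth_const * (\<Prod>s\<in>?I. growth ^ y s * ubound B (y s))) summable_on window (t - int m) t"
      unfolding window_def by (intro summable_on_cmult_right prod_ubound_summable B) (use growth_ge in auto)
    fix y z assume "z \<in> cball (0::complex) B"
    then have z: "norm z \<le> B" by simp
    have "norm (of_real (info F t m y) * cmass F ?I j z y) \<le> (growth_const * (\<Prod>s\<in>?I. growth ^ y s)) * (\<Prod>s\<in>?I. ubound B (y s))"
      unfolding norm_mult norm_of_real
    proof (rule mult_mono)
      show d: "\<bar>info F t m y\<bar> \<le> growth_const * (\<Prod>s\<in>?I. growth ^ y s)" by (rule info_dom[OF F]) auto
      show "0 \<le> growth_const * (\<Prod>s\<in>?I. growth ^ y s)" using d by linarith
    qed (auto intro: norm_cmass_le[OF F z])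
    then show "norm (of_real (info F t m y) * cmass F ?I j z y) \<le> growth_const * (\<Prod>s\<in>?I. growth ^ y s * ubound B (y s))"
      by (simp add: prod.distrib mult.assoc)
  qed
qed

lemma hist_diff_holomorphic: "F \<in> laws \<Longrightarrow> (\<lambda>z. hist_diff F t m j z) holomorphic_on UNIV"
  unfolding hist_diff_def by (intro holomorphic_intros exp_info_holomorphic)

lemma Delta_hist_term_has_sum:
  assumes F: "F \<in> laws"
  shows "(Delta_hist_term L lam0 h F t m z has_sum hist_diff F (int t) m 0 z) (window (int t - int m) (int t))"
proof -
  let ?I = "{int t - int m..int t}"
  have "((\<lambda>y. of_real (info F (int t) m y) * cmass F ?I j z y) has_sum exp_info F (int t) m j z) (PiE ?I (\<lambda>_. UNIV))" for j z
    unfolding exp_info_def window_def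
    by (rule has_sum_infsum, rule abs_summable_summable, rule info_cmass_summable[OF F]) auto
  from has_sum_difference[OF this[of 0 z] this[of "int t + 1" 0]]
  have "((\<lambda>y. of_real (info F (int t) m y) * (cmass F ?I 0 z y - cmass F ?I (int t + 1) 0 y)) has_sum hist_diff F (int t) m 0 z) (PiE ?I (\<lambda>_. UNIV))"
    by (simp add: hist_diff_def right_diff_distrib)
  moreover have "cmass F ?I (int t + 1) 0 y = of_real (bmass F ?I y)" for y
    by (rule cmass_unaffected[OF F]) auto
  ultimately show ?thesis
    by (simp add: Delta_hist_term_def[abs_def] history_info_eq[OF F] fixed_prob_eq[OF F] block_prob_eq window_def)
qed

lemma Delta_hist_eq: "F \<in> laws \<Longrightarrow> Delta_hist L lam0 h F t m z = hist_diff F (int t) m 0 z"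
  unfolding Delta_hist_def by (rule infsumI[OF Delta_hist_term_has_sum])

lemma forget_rate_power_tendsto: "B \<ge> 0 \<Longrightarrow> (\<lambda>m. forget_const B * forget_rate B ^ (2 * m)) \<longlonglongrightarrow> 0"
  unfolding power_mult using forget_rate_bounds[of B]
  by (intro tendsto_mult_right_zero LIMSEQ_realpow_zero) (auto simp: power_less_one_iff)

lemma Delta_lim:
  assumes F: "F \<in> laws"
  shows "(\<lambda>m. hist_diff F (int t) m 0 z) \<longlonglongrightarrow> Delta L lam0 h F t z"
proof -
  define B where "B = norm z"
  have B: "B \<ge> 0" "norm z \<le> B" by (auto simp: B_def)
  have "Cauchy (\<lambda>m. hist_diff F (int t) m 0 z)"
  proof (rule metric_CauchyI)
    fix e :: real assume "e > 0"
    then obtain M where M: "\<And>m. m \<ge> M \<Longrightarrow> norm (forget_const B * forget_rate B ^ (2 * m)) < e / 2"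
      using LIMSEQ_D[OF forget_rate_power_tendsto[OF B(1)], of "e / 2"] by auto
    have "dist (hist_diff F (int t) m 0 z) (hist_diff F (int t) M 0 z) < e / 2" if "m \<ge> M" for m
      using hist_diff_diff[OF F B(2) that, of "int t" 0] M[of M] by (simp add: dist_norm)
    then have "dist (hist_diff F (int t) m 0 z) (hist_diff F (int t) n 0 z) < e" if "m \<ge> M" "n \<ge> M" for m n
      using that by (meson dist_triangle_half_l)
    then show "\<exists>M. \<forall>m\<ge>M. \<forall>n\<ge>M. dist (hist_diff F (int t) m 0 z) (hist_diff F (int t) n 0 z) < e" by blast
  qed
  then show ?thesis
    unfolding Delta_def Delta_hist_eq[OF F] using Cauchy_convergent_iff convergent_LIMSEQ_iff by blast
qed

lemma Delta_approx:
  assumes F: "F \<in> laws" and z: "norm z \<le> B"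
  shows "norm (Delta L lam0 h F t z - hist_diff F (int t) m 0 z) \<le> forget_const B * forget_rate B ^ (2 * m)"
    and "norm (Delta L lam0 h F t z) \<le> forget_const B * forget_rate B ^ (2 * t)"
proof -
  have lim: "(\<lambda>k. norm (hist_diff F (int t) k 0 z - hist_diff F (int t) m 0 z)) \<longlonglongrightarrow> norm (Delta L lam0 h F t z - hist_diff F (int t) m 0 z)"
    by (intro tendsto_intros Delta_lim F)
  show "norm (Delta L lam0 h F t z - hist_diff F (int t) m 0 z) \<le> forget_const B * forget_rate B ^ (2 * m)"
    by (rule tendsto_upperbound[OF lim]) (use hist_diff_diff[OF F z] in \<open>auto intro: eventually_sequentiallyI[of m]\<close>)
  show "norm (Delta L lam0 h F t z) \<le> forget_const B * forget_rate B ^ (2 * t)"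
    by (rule tendsto_upperbound[OF tendsto_norm[OF Delta_lim[OF F]]])
      (use hist_diff_bound[OF F z, of 0 "int t"] in \<open>auto intro!: always_eventually\<close>)
qed

lemma Delta_uniform_limit:
  assumes F: "F \<in> laws" and K: "\<And>z. z \<in> K \<Longrightarrow> norm z \<le> B" and B: "B \<ge> 0"
  shows "uniform_limit K (\<lambda>m. Delta_hist L lam0 h F t m) (Delta L lam0 h F t) sequentially"
proof (rule uniform_limitI)
  fix e :: real assume "e > 0"
  then have "\<forall>\<^sub>F m in sequentially. forget_const B * forget_rate B ^ (2 * m) < e"
    using order_tendstoD(2)[OF forget_rate_power_tendsto[OF B]] by simp
  then show "\<forall>\<^sub>F m in sequentially. \<forall>z\<in>K. dist (Delta_hist L lam0 h F t m z) (Delta L lam0 h F t z) < e"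
  proof eventually_elim
    case (elim m)
    then show ?case
      using Delta_approx(1)[OF F K, where t=t and m=m] by (force simp: Delta_hist_eq[OF F] dist_norm norm_minus_commute)
  qed
qed

lemma Delta_holomorphic: "F \<in> laws \<Longrightarrow> Delta L lam0 h F t holomorphic_on UNIV"
proof (rule entire_uniform_limit[of "\<lambda>m. Delta_hist L lam0 h F t m" sequentially])
  assume F: "F \<in> laws"
  show "Delta_hist L lam0 h F t m holomorphic_on UNIV" for m
  proof -
    have "Delta_hist L lam0 h F t m = (\<lambda>z. hist_diff F (int t) m 0 z)" by (rule ext) (rule Delta_hist_eq[OF F])
    then show ?thesis using hist_diff_holomorphic[OF F, of "int t" m 0] by simp
  qed
  show "uniform_limit (cball 0 B) (\<lambda>m. Delta_hist L lam0 h F t m) (Delta L lam0 h F t) sequentially" if "B \<ge> 0" for B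
    by (rule Delta_uniform_limit[OF F _ that]) simp
qed simp

lemma Delta_sum_finite:
  assumes F: "F \<in> laws" and K: "\<And>z. z \<in> K \<Longrightarrow> norm z \<le> B" and B: "B \<ge> 0"
  shows "(\<Sum>t. SUP z\<in>K. ennreal (norm (Delta L lam0 h F t z))) < \<infinity>"
proof -
  have s: "summable (\<lambda>t. forget_const B * forget_rate B ^ (2 * t))"
    unfolding power_mult using forget_rate_bounds[OF B] by (intro summable_mult summable_geometric) (auto simp: power_less_one_iff)
  have "(\<Sum>t. SUP z\<in>K. ennreal (norm (Delta L lam0 h F t z))) \<le> (\<Sum>t. ennreal (forget_const B * forget_rate B ^ (2 * t)))"
    by (intro suminf_le SUP_least ennreal_leI Delta_approx(2)[OF F K]) auto
  also have "\<dots> = ennreal (\<Sum>t. forget_const B * forget_rate B ^ (2 * t))"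
    by (rule suminf_ennreal2[OF _ s]) (use forget_const_ge(3)[OF B] forget_rate_bounds[OF B] in auto)
  also have "\<dots> < \<infinity>" by simp
  finally show ?thesis .
qed

section \<open>Chain rule and the block derivative\<close>

lemma exp_info_unaffected:
  assumes F: "F \<in> laws" and "{t - int m..t} \<inter> {j..j + int L} = {}"
  shows "exp_info F t m j z = exp_info F t m (t + 1) 0"
  using hist_diff_zero[OF assms, of z] by (simp add: hist_diff_def)

text \<open>The chain rule for one path: the history of length \<open>m\<close> before time
  \<open>m + 1\<close> reaches back exactly to time 1.\<close>

lemma ln_bmass_chain:
  assumes F: "F \<in> laws"
  shows "ln (bmass F {1..int n} y) = - (\<Sum>m<n. info F (int m + 1) m y)"
proof (induction n)
  case 0
  interpret prob_space "olaw F" by (rule output_law_basic[OF F])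
  have "bmass F {} y = 1" unfolding bmass_def cylinder_def using prob_space by (simp add: output_law_basic[OF F])
  then show ?case by simp
next
  case (Suc n)
  have e: "{1..<int n + 1} = {1..int n}" "{1..int (Suc n)} = {1..int n + 1}" by auto
  have p: "bmass F {1..int n} y > 0" "bmass F {1..int n + 1} y > 0" by (auto intro!: bmass_bounds(3)[OF F])
  have "info F (int n + 1) n y = - (ln (bmass F {1..int n + 1} y) - ln (bmass F {1..int n} y))"
    unfolding info_def cprob_def using p by (simp add: e ln_div)
  then show ?case using Suc unfolding e(2) by simp
qed

text \<open>Each chain-rule summand depends only on outputs up to time \<open>m + 1\<close>, so
  summation over the whole block reduces to its own window.\<close>

lemma D_block_term_has_sum:
  assumes F: "F \<in> laws"
  shows "(D_block_term L lam0 h F n j z has_sum - (\<Sum>m<n. hist_diff F (int m + 1) m j z)) (window 1 (int n))"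
proof -
  let ?I = "{1..int n}"
  have 1: "((\<lambda>y. of_real (info F (int m + 1) m y) * cmass F ?I j z y) has_sum exp_info F (int m + 1) m j z) (PiE ?I (\<lambda>_. UNIV))"
    if "m < n" for m j z
  proof -
    have s: "(\<lambda>y. of_real (info F (int m + 1) m y) * cmass F ?I j z y) summable_on (PiE ?I (\<lambda>_. UNIV))"
      by (rule abs_summable_summable, rule info_cmass_summable[OF F]) (use that in auto)
    have e: "infsum (\<lambda>y. of_real (info F (int m + 1) m y) * cmass F ?I j z y) (PiE ?I (\<lambda>_. UNIV)) = exp_info F (int m + 1) m j z"
      by (rule exp_info_larger_window[OF F]) (use that in auto)
    show ?thesis unfolding e[symmetric] by (rule has_sum_infsum[OF s])
  qed
  have 2: "((\<lambda>y. of_real (info F (int m + 1) m y) * (cmass F ?I j z y - of_real (bmass F ?I y))) has_sum hist_diff F (int m + 1) m j z) (PiE ?I (\<lambda>_. UNIV))"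
    if "m < n" for m
  proof -
    \<comment> \<open>A symbol at \<open>n + 1\<close> is beyond the block and hence gives the
      baseline.\<close>
    have "cmass F ?I (int n + 1) 0 y = of_real (bmass F ?I y)" for y by (rule cmass_unaffected[OF F]) auto
    moreover have "exp_info F (int m + 1) m (int n + 1) 0 = exp_info F (int m + 1) m (int m + 1 + 1) 0"
      by (rule exp_info_unaffected[OF F]) (use that in auto)
    ultimately show ?thesis
      using has_sum_difference[OF 1[OF that, of j z] 1[OF that, of "int n + 1" 0]] by (simp add: hist_diff_def right_diff_distrib)
  qed
  have "((\<lambda>y. \<Sum>m<n. of_real (info F (int m + 1) m y) * (cmass F ?I j z y - of_real (bmass F ?I y))) has_sum (\<Sum>m<n. hist_diff F (int m + 1) m j z)) (PiE ?I (\<lambda>_. UNIV))"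
    by (rule has_sum_finite_sum) (use 2 in auto)
  from has_sum_uminusI[OF this] show ?thesis
    unfolding D_block_term_def[abs_def] fixed_prob_eq[OF F] block_prob_eq ln_bmass_chain[OF F] window_def
    by (simp add: sum_distrib_right[symmetric] mult_ac)
qed

text \<open>Shifting the symbol at \<open>j\<close> to time 0 turns output time \<open>m + 1\<close>
  into lag t = m + 1 - j; for j from 1 - L to m + 1 these lags are 0, ..., m + L.\<close>

definition hist_diff_sum :: "real measure \<Rightarrow> nat \<Rightarrow> complex \<Rightarrow> complex" where
  "hist_diff_sum F m z = (\<Sum>t<m + L + 1. hist_diff F (int t) m 0 z)"

lemma D_block_eq:
  assumes F: "F \<in> laws"
  shows "D_block L lam0 h F n z = (1 / of_nat n) * (\<Sum>m<n. hist_diff_sum F m z)"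
proof -
  have "(\<Sum>j\<in>{1 - int L..int n}. hist_diff F (int m + 1) m j z) = hist_diff_sum F m z" if "m < n" for m
  proof -
    \<comment> \<open>A symbol after time \<open>m + 1\<close> does not reach the outputs of this
      summand.\<close>
    have "(\<Sum>j\<in>{1 - int L..int n}. hist_diff F (int m + 1) m j z) = (\<Sum>j\<in>{1 - int L..int m + 1}. hist_diff F (int m + 1) m j z)"
      by (rule sum.mono_neutral_right) (use that in \<open>auto intro!: hist_diff_zero[OF F]\<close>)
    also have "\<dots> = (\<Sum>j\<in>{1 - int L..int m + 1}. hist_diff F (int m + 1 - j) m 0 z)"
    proof (rule sum.cong[OF refl])
      show "hist_diff F (int m + 1) m j z = hist_diff F (int m + 1 - j) m 0 z" for j
        using hist_diff_shift[OF F, of "int m + 1" j m j z] by simp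
    qed
    also have "\<dots> = hist_diff_sum F m z" unfolding hist_diff_sum_def
      by (rule sum.reindex_bij_witness[where i="\<lambda>t. int m + 1 - int t" and j="\<lambda>j. nat (int m + 1 - j)"]) auto
    finally show ?thesis .
  qed
  then have "(\<Sum>m<n. hist_diff_sum F m z) = (\<Sum>m<n. \<Sum>j\<in>{1 - int L..int n}. hist_diff F (int m + 1) m j z)" by simp
  also have "\<dots> = (\<Sum>j\<in>{1 - int L..int n}. \<Sum>m<n. hist_diff F (int m + 1) m j z)" by (rule sum.swap)
  finally show ?thesis
    unfolding D_block_def infsumI[OF D_block_term_has_sum[OF F]] by (simp add: sum_negf)
qed

lemma D_block_holomorphic: "F \<in> laws \<Longrightarrow> D_block L lam0 h F n holomorphic_on UNIV"
proof -
  assume F: "F \<in> laws"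
  have "(\<lambda>z. (1 / of_nat n) * (\<Sum>m<n. hist_diff_sum F m z)) holomorphic_on UNIV"
    unfolding hist_diff_sum_def by (intro holomorphic_intros hist_diff_holomorphic F)
  moreover have "D_block L lam0 h F n = (\<lambda>z. (1 / of_nat n) * (\<Sum>m<n. hist_diff_sum F m z))"
    by (rule ext) (rule D_block_eq[OF F])
  ultimately show ?thesis by simp
qed

text \<open>For lags t \<le> m the error is that of truncating the history, of order \<tau>^(2m);
  for t > m both terms are small by decay in the lag, of order \<tau>^(2t). In either case it is of
  order \<tau>^(m+t), summable over t with a sum geometric in m.\<close>

lemma hist_diff_sum_approx:
  assumes F: "F \<in> laws" and z: "norm z \<le> B"
  shows "norm (hist_diff_sum F m z - h_dot L lam0 h F z) \<le> 2 * forget_const B / (1 - forget_rate B) * forget_rate B ^ m"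
proof -
  have B: "B \<ge> 0" using z norm_ge_zero[of z] by linarith
  note s = forget_rate_bounds[OF B] and C = forget_const_ge(3)[OF B]
  let ?d = "\<lambda>t. hist_diff F (int t) m 0 z - Delta L lam0 h F t z"
  have g: "summable (\<lambda>t. 2 * forget_const B * forget_rate B ^ m * forget_rate B ^ t)"
    using s by (intro summable_mult summable_geometric) auto
  have sd: "summable (\<lambda>t. Delta L lam0 h F t z)"
  proof (rule summable_comparison_test')
    show "summable (\<lambda>t. forget_const B * forget_rate B ^ (2 * t))"
      unfolding power_mult using s by (intro summable_mult summable_geometric) (auto simp: power_less_one_iff)
  qed (rule Delta_approx(2)[OF F z])
  have 0: "hist_diff F (int t) m 0 z = 0" if "t \<notin> {..<m + L + 1}" for t
    by (rule hist_diff_zero[OF F]) (use that in auto)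
  have sh: "(\<lambda>t. hist_diff F (int t) m 0 z) sums hist_diff_sum F m z"
    unfolding hist_diff_sum_def by (rule sums_finite) (use 0 in auto)
  have "hist_diff_sum F m z - h_dot L lam0 h F z = (\<Sum>t. ?d t)"
    unfolding h_dot_def using suminf_diff[OF sums_summable[OF sh] sd] sums_unique[OF sh] by simp
  also have "norm \<dots> \<le> (\<Sum>t. 2 * forget_const B * forget_rate B ^ m * forget_rate B ^ t)"
  proof (rule norm_suminf_le[OF _ g])
    fix t
    show "norm (?d t) \<le> 2 * forget_const B * forget_rate B ^ m * forget_rate B ^ t"
    proof (cases "t \<le> m")
      case True
      have "norm (?d t) \<le> forget_const B * forget_rate B ^ (2 * m)"
        using Delta_approx(1)[OF F z, of t m] by (simp add: norm_minus_commute)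
      also have "\<dots> \<le> (2 * forget_const B) * forget_rate B ^ (m + t)"
        using True C s by (intro mult_mono power_decreasing) auto
      finally show ?thesis by (simp add: power_add mult_ac)
    next
      case False
      have "norm (?d t) \<le> norm (hist_diff F (int t) m 0 z) + norm (Delta L lam0 h F t z)" by (rule norm_triangle_ineq4)
      also have "\<dots> \<le> 2 * forget_const B * forget_rate B ^ (2 * t)"
        using Delta_approx(2)[OF F z, of t] hist_diff_bound[OF F z, of 0 "int t" m] by simp
      also have "\<dots> \<le> 2 * forget_const B * forget_rate B ^ (m + t)"
        using False C s by (intro mult_mono power_decreasing) auto
      finally show ?thesis by (simp add: power_add mult_ac)
    qed
  qed
  also have "\<dots> = 2 * forget_const B * forget_rate B ^ m * (1 / (1 - forget_rate B))"
    using s by (subst suminf_mult) (auto simp: suminf_geometric summable_geometric)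
  finally show ?thesis by simp
qed

definition block_const :: "real \<Rightarrow> real" where
  "block_const B = 2 * forget_const B / (1 - forget_rate B) / (1 - forget_rate B)"

lemma block_const_nonneg: "B \<ge> 0 \<Longrightarrow> block_const B \<ge> 0"
  using forget_rate_bounds[of B] forget_const_ge(3)[of B] by (simp add: block_const_def)

lemma D_block_approx:
  assumes F: "F \<in> laws" and z: "norm z \<le> B" and n: "n \<ge> 1"
  shows "norm (D_block L lam0 h F n z - h_dot L lam0 h F z) \<le> block_const B / real n"
proof -
  have B: "B \<ge> 0" using z norm_ge_zero[of z] by linarith
  note s = forget_rate_bounds[OF B] and C = forget_const_ge(3)[OF B]
  have "D_block L lam0 h F n z - h_dot L lam0 h F z = (1 / of_nat n) * (\<Sum>m<n. hist_diff_sum F m z - h_dot L lam0 h F z)"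
    unfolding D_block_eq[OF F] using n by (simp add: sum_subtractf field_simps)
  also have "norm \<dots> = (1 / real n) * norm (\<Sum>m<n. hist_diff_sum F m z - h_dot L lam0 h F z)"
    by (simp add: norm_mult norm_divide)
  also have "\<dots> \<le> (1 / real n) * (\<Sum>m<n. 2 * forget_const B / (1 - forget_rate B) * forget_rate B ^ m)"
    by (intro mult_left_mono sum_norm_le hist_diff_sum_approx[OF F z]) auto
  also have "\<dots> \<le> (1 / real n) * (2 * forget_const B / (1 - forget_rate B) / (1 - forget_rate B))"
    by (intro mult_left_mono mean_geometric_le) (use s C in auto)
  finally show ?thesis by (simp add: block_const_def mult_ac)
qed

lemma D_block_uniform_limit:
  assumes F: "F \<in> laws" and K: "\<And>z. z \<in> K \<Longrightarrow> norm z \<le> B"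
  shows "uniform_limit K (\<lambda>n. D_block L lam0 h F n) (h_dot L lam0 h F) sequentially"
proof (rule uniform_limitI)
  fix e :: real assume "e > 0"
  have "(\<lambda>n. block_const B / real n) \<longlonglongrightarrow> 0" by (rule lim_const_over_n)
  then have "\<forall>\<^sub>F n in sequentially. block_const B / real n < e \<and> n \<ge> 1"
    using order_tendstoD(2) \<open>e > 0\<close> eventually_ge_at_top by (intro eventually_conj) auto
  then show "\<forall>\<^sub>F n in sequentially. \<forall>z\<in>K. dist (D_block L lam0 h F n z) (h_dot L lam0 h F z) < e"
  proof eventually_elim
    case (elim n)
    then show ?case using D_block_approx[OF F K, where n=n] by (force simp: dist_norm)
  qed
qed

section \<open>Mixtures of input laws\<close>

text \<open>As a two-stage experiment, a coin toss followed by a draw from \<open>F\<close> or the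
  value \<open>u\<close>, the mixture inherits its measure properties and its integrals from the
  monadic bind.\<close>

lemma mix_dirac_bind:
  assumes F: "F \<in> laws" and u: "u \<in> {0..A}" and e: "0 \<le> e" "e \<le> 1"
  shows "mix_dirac F u e = measure_pmf (bernoulli_pmf e) \<bind> (\<lambda>b. if b then return F u else F)"
    and "(\<lambda>b. if b then return F u else F) \<in> measure_pmf (bernoulli_pmf e) \<rightarrow>\<^sub>M prob_algebra F"
proof -
  let ?k = "\<lambda>b. if b then return F u else F"
  let ?Q = "measure_pmf (bernoulli_pmf e) \<bind> ?k"
  have uF: "u \<in> space F" using u laws_uptoD(3)[OF F] by simp
  have pr: "prob_space (return F u)" "prob_space F"
    using prob_space_return[OF uF] laws_uptoD(1)[OF F] by auto
  show k: "?k \<in> measure_pmf (bernoulli_pmf e) \<rightarrow>\<^sub>M prob_algebra F"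
    using pr by (auto simp: space_prob_algebra)
  have k': "?k \<in> measure_pmf (bernoulli_pmf e) \<rightarrow>\<^sub>M subprob_algebra F"
    by (rule measurable_prob_algebraD[OF k])
  have sQ: "sets ?Q = sets F" by (rule sets_bind) auto
  have em: "emeasure ?Q S = ennreal (1 - e) * emeasure F S + ennreal e * emeasure (return F u) S" if "S \<in> sets F" for S
    by (subst emeasure_bind[OF _ k' that]) (use e in \<open>auto simp: mult.commute add.commute\<close>)
  have "mix_dirac F u e = measure_of (space ?Q) (sets ?Q) (emeasure ?Q)"
    unfolding mix_dirac_def sQ sets_eq_imp_space_eq[OF sQ]
    by (rule measure_of_eq) (auto simp: sets.space_closed sets.sigma_sets_eq em)
  also have "\<dots> = ?Q" by (rule measure_of_of_measure)
  finally show "mix_dirac F u e = ?Q" .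
qed

lemma mix_dirac_laws:
  assumes F: "F \<in> laws" and u: "u \<in> {0..A}" and e: "0 \<le> e" "e \<le> 1"
  shows "mix_dirac F u e \<in> laws" "sets (mix_dirac F u e) = sets F"
proof -
  note b = mix_dirac_bind[OF assms]
  have i: "measure_pmf (bernoulli_pmf e) \<in> space (prob_algebra (measure_pmf (bernoulli_pmf e)))"
    by (simp add: space_prob_algebra prob_space_measure_pmf)
  show s: "sets (mix_dirac F u e) = sets F" unfolding b(1) by (rule sets_bind) auto
  have "prob_space (mix_dirac F u e)" unfolding b(1) by (rule prob_space_bind'[OF i b(2)])
  then show "mix_dirac F u e \<in> laws"
    using s laws_uptoD(2)[OF F] by (simp add: laws_upto_def space_prob_algebra)
qed

lemma nn_integral_mix_dirac:
  assumes F: "F \<in> laws" and u: "u \<in> {0..A}" and e: "0 \<le> e" "e \<le> 1" and f: "f \<in> borel_measurable F"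
  shows "(\<integral>\<^sup>+x. f x \<partial>mix_dirac F u e) = ennreal (1 - e) * (\<integral>\<^sup>+x. f x \<partial>F) + ennreal e * f u"
proof -
  have uF: "u \<in> space F" using u laws_uptoD(3)[OF F] by simp
  have "(\<integral>\<^sup>+x. f x \<partial>mix_dirac F u e) = (\<integral>\<^sup>+b. \<integral>\<^sup>+x. f x \<partial>(if b then return F u else F) \<partial>bernoulli_pmf e)"
    unfolding mix_dirac_bind(1)[OF F u e]
    by (rule nn_integral_bind[OF f measurable_prob_algebraD[OF mix_dirac_bind(2)[OF F u e]]])
  also have "\<dots> = f u * ennreal e + (\<integral>\<^sup>+x. f x \<partial>F) * ennreal (1 - e)"
    using e nn_integral_return[OF uF f] by simp
  finally show ?thesis by (simp add: mult.commute add.commute)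
qed

lemma mix_dirac_0: "F \<in> laws \<Longrightarrow> mix_dirac F u 0 = F"
  unfolding mix_dirac_def by (simp add: measure_of_of_measure)

text \<open>Moving one time into \<open>K\<close> replaces an integral by an affine function of \<open>e\<close>, so derivatives in the mixing
  weight follow by induction on \<open>K\<close>.\<close>

definition mixed_inputs :: "real measure \<Rightarrow> real \<Rightarrow> real \<Rightarrow> int set \<Rightarrow> (int \<Rightarrow> real) measure" where
  "mixed_inputs F u e K = (\<Pi>\<^sub>M k\<in>UNIV. if k \<in> K then mix_dirac F u e else F)"

lemma mixed_inputs_basic:
  assumes F: "F \<in> laws" and u: "u \<in> {0..A}" and e: "0 \<le> e" "e \<le> 1"
  shows "prob_space (mixed_inputs F u e K)" "sets (mixed_inputs F u e K) = sets (inputs F)"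
    "space (mixed_inputs F u e K) = space (inputs F)"
proof -
  show "prob_space (mixed_inputs F u e K)"
    unfolding mixed_inputs_def using laws_uptoD(1)[OF F] laws_uptoD(1)[OF mix_dirac_laws(1)[OF assms]]
    by (intro prob_space_PiM) auto
  show s: "sets (mixed_inputs F u e K) = sets (inputs F)"
    unfolding mixed_inputs_def by (rule sets_PiM_cong) (auto simp: mix_dirac_laws[OF assms])
  show "space (mixed_inputs F u e K) = space (inputs F)" by (rule sets_eq_imp_space_eq[OF s])
qed

lemma nn_integral_mixed_insert:
  fixes f :: "(int \<Rightarrow> real) \<Rightarrow> ennreal"
  assumes F: "F \<in> laws" and u: "u \<in> {0..A}" and e: "0 \<le> e" "e \<le> 1" and f: "f \<in> borel_measurable (inputs F)" and k: "k \<notin> K"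
  shows "(\<integral>\<^sup>+x. f x \<partial>mixed_inputs F u e (insert k K))
    = ennreal (1 - e) * (\<integral>\<^sup>+x. f x \<partial>mixed_inputs F u e K) + ennreal e * (\<integral>\<^sup>+x. f (x(k := u)) \<partial>mixed_inputs F u e K)"
proof -
  let ?N = "\<lambda>K i. if i \<in> K then mix_dirac F u e else F"
  let ?R = "Pi\<^sub>M (UNIV - {k}) (?N K)"
  have N: "prob_space (?N K i)" for K i
    using laws_uptoD(1)[OF F] laws_uptoD(1)[OF mix_dirac_laws(1)[OF F u e]] by auto
  interpret R: prob_space ?R by (rule prob_space_PiM[OF N])
  have fN: "g \<in> borel_measurable (Pi\<^sub>M UNIV (?N K))" if "g \<in> borel_measurable (inputs F)" for K and g :: "(int \<Rightarrow> real) \<Rightarrow> ennreal"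
    using that mixed_inputs_basic(2)[OF F u e, of K] unfolding mixed_inputs_def by (simp cong: measurable_cong_sets)
  have R: "Pi\<^sub>M (UNIV - {k}) (?N (insert k K)) = ?R" by (rule PiM_cong) auto
  have Nk: "?N (insert k K) k = mix_dirac F u e" "?N K k = F" using k by auto
  have up: "(\<lambda>x. f (x(k := u))) \<in> borel_measurable (inputs F)"
    by (rule measurable_compose[OF measurable_fix_input[OF F u] f])
  have pm: "(\<lambda>(v, X). f (X(k := v))) \<in> borel_measurable (F \<Otimes>\<^sub>M ?R)"
    using nn_integral_PiM_coordinate(2)[of "?N K", OF N fN[OF f], of k] Nk by simp
  have fm: "(\<lambda>v. f (X(k := v))) \<in> borel_measurable F" if "X \<in> space ?R" for X
    using measurable_compose[OF measurable_Pair2'[OF that] pm] by simp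
  have inner: "(\<lambda>X. \<integral>\<^sup>+v. f (X(k := v)) \<partial>F) \<in> borel_measurable ?R"
  proof -
    interpret law: prob_space F by (rule laws_uptoD(1)[OF F])
    have "case_prod (\<lambda>X v. f (X(k := v))) \<in> borel_measurable (?R \<Otimes>\<^sub>M F)"
      using measurable_pair_swap[OF pm] by (simp add: case_prod_unfold)
    then show ?thesis by (rule law.borel_measurable_nn_integral)
  qed
  have outer: "(\<lambda>X. f (X(k := u))) \<in> borel_measurable ?R"
    using measurable_compose[OF measurable_Pair1'[of u F ?R] pm] u laws_uptoD(3)[OF F] by simp
  have "(\<integral>\<^sup>+x. f x \<partial>mixed_inputs F u e (insert k K)) = (\<integral>\<^sup>+X. \<integral>\<^sup>+v. f (X(k := v)) \<partial>mix_dirac F u e \<partial>?R)"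
    unfolding mixed_inputs_def
    using nn_integral_PiM_coordinate(1)[of "?N (insert k K)", OF N fN[OF f], of k] Nk R by simp
  also have "\<dots> = (\<integral>\<^sup>+X. ennreal (1 - e) * (\<integral>\<^sup>+v. f (X(k := v)) \<partial>F) + ennreal e * f (X(k := u)) \<partial>?R)"
    by (rule nn_integral_cong) (use nn_integral_mix_dirac[OF F u e fm] in simp)
  also have "\<dots> = ennreal (1 - e) * (\<integral>\<^sup>+X. \<integral>\<^sup>+v. f (X(k := v)) \<partial>F \<partial>?R) + ennreal e * (\<integral>\<^sup>+X. f (X(k := u)) \<partial>?R)"
    using inner outer by (simp add: nn_integral_add nn_integral_cmult)
  also have "(\<integral>\<^sup>+X. \<integral>\<^sup>+v. f (X(k := v)) \<partial>F \<partial>?R) = (\<integral>\<^sup>+x. f x \<partial>mixed_inputs F u e K)"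
    unfolding mixed_inputs_def using nn_integral_PiM_coordinate(1)[of "?N K", OF N fN[OF f], of k] Nk by simp
  also have "(\<integral>\<^sup>+X. f (X(k := u)) \<partial>?R) = (\<integral>\<^sup>+x. f (x(k := u)) \<partial>mixed_inputs F u e K)"
    unfolding mixed_inputs_def using nn_integral_PiM_coordinate(1)[of "?N K", OF N fN[OF up], of k] Nk
    by (simp add: prob_space.emeasure_space_1[OF laws_uptoD(1)[OF F]])
  finally show ?thesis .
qed

definition mix_int :: "real measure \<Rightarrow> real \<Rightarrow> real \<Rightarrow> int set \<Rightarrow> ((int \<Rightarrow> real) \<Rightarrow> real) \<Rightarrow> real" where
  "mix_int F u e K f = (\<integral>x. f x \<partial>mixed_inputs F u e K)"

text \<open>The class in which identities between nonnegative integrals can be read back as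
  identities between finite real ones.\<close>

definition bounded_nonneg :: "real measure \<Rightarrow> real \<Rightarrow> ((int \<Rightarrow> real) \<Rightarrow> real) \<Rightarrow> bool" where
  "bounded_nonneg F c f \<longleftrightarrow> f \<in> borel_measurable (inputs F) \<and> (\<forall>x\<in>space (inputs F). 0 \<le> f x \<and> f x \<le> c)"

lemma bounded_nonneg_upd:
  assumes F: "F \<in> laws" and u: "u \<in> {0..A}" and f: "bounded_nonneg F c f"
  shows "bounded_nonneg F c (\<lambda>x. f (x(k := u)))"
  using f measurable_compose[OF measurable_fix_input[OF F u], of f borel k] measurable_space[OF measurable_fix_input[OF F u]]
  by (auto simp: bounded_nonneg_def)

lemma mix_int_insert:
  assumes F: "F \<in> laws" and u: "u \<in> {0..A}" and e: "0 \<le> e" "e \<le> 1" and f: "bounded_nonneg F c f" and k: "k \<notin> K"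
  shows "mix_int F u e (insert k K) f = (1 - e) * mix_int F u e K f + e * mix_int F u e K (\<lambda>x. f (x(k := u)))"
proof -
  note b = mixed_inputs_basic[OF F u e]
  have i: "mix_int F u e K g = enn2real (\<integral>\<^sup>+x. ennreal (g x) \<partial>mixed_inputs F u e K)"
    "(\<integral>\<^sup>+x. ennreal (g x) \<partial>mixed_inputs F u e K) < \<infinity>" if "bounded_nonneg F c g" for g K
  proof -
    have 1: "g \<in> borel_measurable (mixed_inputs F u e K)"
      using that b(2)[of K] by (simp add: bounded_nonneg_def cong: measurable_cong_sets)
    have 2: "0 \<le> g x \<and> g x \<le> c" if "x \<in> space (mixed_inputs F u e K)" for x
      using that \<open>bounded_nonneg F c g\<close> b(3)[of K] by (simp add: bounded_nonneg_def)
    show "mix_int F u e K g = enn2real (\<integral>\<^sup>+x. ennreal (g x) \<partial>mixed_inputs F u e K)"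
      "(\<integral>\<^sup>+x. ennreal (g x) \<partial>mixed_inputs F u e K) < \<infinity>"
      unfolding mix_int_def by (rule integral_eq_enn2real_bounded[OF b(1) 1 2], assumption)+
  qed
  have fm: "(\<lambda>x. ennreal (f x)) \<in> borel_measurable (inputs F)" using f by (auto simp: bounded_nonneg_def)
  show ?thesis
    unfolding i(1)[OF f] i(1)[OF bounded_nonneg_upd[OF F u f]] nn_integral_mixed_insert[OF F u e fm k]
    using i(2)[OF f, of K] i(2)[OF bounded_nonneg_upd[OF F u f], of K k] e
    by (simp add: enn2real_plus enn2real_mult ennreal_mult_less_top)
qed

lemma mix_int_bounds:
  assumes F: "F \<in> laws" and u: "u \<in> {0..A}" and e: "0 \<le> e" "e \<le> 1" and f: "bounded_nonneg F c f"
  shows "0 \<le> mix_int F u e K f" "mix_int F u e K f \<le> c"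
proof -
  note b = mixed_inputs_basic[OF F u e, of K]
  interpret prob_space "mixed_inputs F u e K" by (rule b)
  have m: "f \<in> borel_measurable (mixed_inputs F u e K)" using f b by (simp add: bounded_nonneg_def cong: measurable_cong_sets)
  show "0 \<le> mix_int F u e K f" unfolding mix_int_def using f b by (auto simp: bounded_nonneg_def intro!: integral_nonneg_AE)
  have "integrable (mixed_inputs F u e K) f"
    by (rule integrable_const_bound[where B=c]) (use f b m in \<open>auto simp: bounded_nonneg_def\<close>)
  then have "mix_int F u e K f \<le> (\<integral>x. c \<partial>mixed_inputs F u e K)"
    unfolding mix_int_def by (rule integral_mono) (use f b in \<open>auto simp: bounded_nonneg_def\<close>)
  then show "mix_int F u e K f \<le> c" by (simp add: prob_space)
qed

text \<open>The product rule for a product measure: the law of one coordinate has derivative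
  \<delta>_u - F, so coordinate \<open>k\<close> contributes the difference between pinning it to
  \<open>u\<close> and drawing it from \<open>F\<close>, with the other times in \<open>K\<close>
  still mixed.\<close>

lemma mix_int_derivative:
  assumes F: "F \<in> laws" and u: "u \<in> {0..A}" and fin: "finite K" and f: "bounded_nonneg F c f" and e: "e \<in> {0..1}"
  shows "((\<lambda>e. mix_int F u e K f) has_field_derivative
      (\<Sum>k\<in>K. mix_int F u e (K - {k}) (\<lambda>x. f (x(k := u))) - mix_int F u e (K - {k}) f)) (at e within {0..1})"
  using fin f
proof (induction K arbitrary: f)
  case empty
  have "mix_int F u e {} f = (\<integral>x. f x \<partial>inputs F)" for e by (simp add: mix_int_def mixed_inputs_def)
  then show ?case by simp
next
  case (insert k K)
  let ?f = "\<lambda>x. f (x(k := u))"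
  note fk = bounded_nonneg_upd[OF F u insert.prems, of k]
  let ?D = "\<lambda>f. \<Sum>j\<in>K. mix_int F u e (K - {j}) (\<lambda>x. f (x(j := u))) - mix_int F u e (K - {j}) f"
  have "((\<lambda>e. (1 - e) * mix_int F u e K f + e * mix_int F u e K ?f) has_field_derivative
      ((0 - 1) * mix_int F u e K f + ?D f * (1 - e)) + (1 * mix_int F u e K ?f + ?D ?f * e)) (at e within {0..1})"
    by (intro DERIV_add DERIV_mult DERIV_diff DERIV_const DERIV_ident insert.IH insert.prems fk)
  moreover have "((0 - 1) * mix_int F u e K f + ?D f * (1 - e)) + (1 * mix_int F u e K ?f + ?D ?f * e)
      = (\<Sum>j\<in>insert k K. mix_int F u e (insert k K - {j}) (\<lambda>x. f (x(j := u))) - mix_int F u e (insert k K - {j}) f)"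
  proof -
    have "mix_int F u e (insert k K - {j}) (\<lambda>x. f (x(j := u))) - mix_int F u e (insert k K - {j}) f
        = (1 - e) * (mix_int F u e (K - {j}) (\<lambda>x. f (x(j := u))) - mix_int F u e (K - {j}) f)
          + e * (mix_int F u e (K - {j}) (\<lambda>x. ?f (x(j := u))) - mix_int F u e (K - {j}) ?f)" if "j \<in> K" for j
    proof -
      have jk: "j \<noteq> k" using that insert.hyps by auto
      have s: "insert k K - {j} = insert k (K - {j})" using jk by auto
      have k: "k \<notin> K - {j}" using insert.hyps by simp
      have e': "0 \<le> e" "e \<le> 1" using e by auto
      have m1: "mix_int F u e (insert k (K - {j})) f = (1 - e) * mix_int F u e (K - {j}) f + e * mix_int F u e (K - {j}) ?f"
        by (rule mix_int_insert[OF F u e' insert.prems k])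
      have m2: "mix_int F u e (insert k (K - {j})) (\<lambda>x. f (x(j := u)))
          = (1 - e) * mix_int F u e (K - {j}) (\<lambda>x. f (x(j := u))) + e * mix_int F u e (K - {j}) (\<lambda>x. ?f (x(j := u)))"
        unfolding fun_upd_twist[OF jk] by (rule mix_int_insert[OF F u e' bounded_nonneg_upd[OF F u insert.prems] k])
      show ?thesis unfolding s m1 m2 by (simp add: algebra_simps)
    qed
    then have "(\<Sum>j\<in>K. mix_int F u e (insert k K - {j}) (\<lambda>x. f (x(j := u))) - mix_int F u e (insert k K - {j}) f)
        = (1 - e) * ?D f + e * ?D ?f"
      by (simp add: sum.distrib sum_distrib_left)
    moreover have "insert k K - {k} = K" using insert.hyps by auto
    ultimately show ?thesis using insert.hyps by (simp add: algebra_simps)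
  qed
  ultimately have der: "((\<lambda>e. (1 - e) * mix_int F u e K f + e * mix_int F u e K ?f) has_field_derivative
      (\<Sum>j\<in>insert k K. mix_int F u e (insert k K - {j}) (\<lambda>x. f (x(j := u))) - mix_int F u e (insert k K - {j}) f)) (at e within {0..1})"
    by simp
  have eq: "(1 - e') * mix_int F u e' K f + e' * mix_int F u e' K ?f = mix_int F u e' (insert k K) f" if "e' \<in> {0..1}" for e'
    by (rule mix_int_insert[symmetric, OF F u _ _ insert.prems insert.hyps(2)]) (use that in auto)
  show ?case
    by (rule has_field_derivative_transform_within[OF der zero_less_one e eq])
qed

lemma mix_int_restrict:
  assumes F: "F \<in> laws" and u: "u \<in> {0..A}" and e: "0 \<le> e" "e \<le> 1" and fin: "finite J"
    and m: "f \<in> borel_measurable (Pi\<^sub>M J (\<lambda>_. F))" and dep: "\<And>x. f (restrict x J) = f x"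
    and K: "K \<inter> J = K' \<inter> J"
  shows "mix_int F u e K f = mix_int F u e K' f"
proof -
  let ?N = "\<lambda>K i. if i \<in> K then mix_dirac F u e else F"
  have N: "prob_space (?N K i)" for K i
    using laws_uptoD(1)[OF F] laws_uptoD(1)[OF mix_dirac_laws(1)[OF F u e]] by auto
  have "mix_int F u e K f = (\<integral>x. f x \<partial>Pi\<^sub>M J (?N K))" for K
  proof -
    have d: "distr (Pi\<^sub>M UNIV (?N K)) (Pi\<^sub>M J (?N K)) (\<lambda>x. \<lambda>n\<in>J. x n) = Pi\<^sub>M J (?N K)"
      using distr_PiM_reindex[of UNIV "?N K" "\<lambda>x. x" J, OF N] by simp
    have r: "(\<lambda>x. \<lambda>n\<in>J. x n) \<in> Pi\<^sub>M UNIV (?N K) \<rightarrow>\<^sub>M Pi\<^sub>M J (?N K)"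
      by (rule measurable_restrict) auto
    have s: "sets (Pi\<^sub>M J (?N K)) = sets (Pi\<^sub>M J (\<lambda>_. F))"
      by (rule sets_PiM_cong) (auto simp: mix_dirac_laws[OF F u e])
    have m': "f \<in> borel_measurable (Pi\<^sub>M J (?N K))" using m s by (simp cong: measurable_cong_sets)
    show ?thesis unfolding mix_int_def mixed_inputs_def
      by (subst d[symmetric], subst integral_distr[OF r m']) (simp add: dep)
  qed
  moreover have "Pi\<^sub>M J (?N K) = Pi\<^sub>M J (?N K')" by (rule PiM_cong) (use K in auto)
  ultimately show ?thesis by simp
qed

abbreviation "input_times n \<equiv> {1 - int L..int n}"

lemma bounded_nonneg_rkernel: "F \<in> laws \<Longrightarrow> bounded_nonneg F (\<Prod>s\<in>I. ubound 0 (y s)) (rkernel I y)"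
  using rkernel_bounds[where I=I and y=y] measurable_rkernel[of F I y] by (auto simp: bounded_nonneg_def space_inputs)

lemma rkernel_as_ckernel:
  assumes F: "F \<in> laws" and I: "finite I" and J: "\<And>s. s \<in> I \<Longrightarrow> {s - int L..s} \<subseteq> J"
  shows "rkernel I y \<in> borel_measurable (Pi\<^sub>M J (\<lambda>_. F))" "rkernel I y (restrict x J) = rkernel I y x"
proof -
  have "(\<lambda>x. poisson_weight (rt x s) (y s)) \<in> borel_measurable (Pi\<^sub>M J (\<lambda>_. F))" if "s \<in> I" for s
    by (rule measurable_compose[OF _ measurable_poisson_weight], unfold rate_def,
        intro borel_measurable_add borel_measurable_const borel_measurable_sum borel_measurable_times measurable_coord F)
      (use J[OF that] in auto)
  then show "rkernel I y \<in> borel_measurable (Pi\<^sub>M J (\<lambda>_. F))"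
    unfolding rkernel_def[abs_def] by (intro borel_measurable_prod)
  have "rt (restrict x J) s = rt x s" if "s \<in> I" for s
    by (rule rate_cong) (use J[OF that] in auto)
  then show "rkernel I y (restrict x J) = rkernel I y x" unfolding rkernel_def by (intro prod.cong) auto
qed

text \<open>Outputs 1..n are fed by the inputs at times 1 - L..n only. Mixing at those finitely many
  times is enough, which is what the induction on \<open>K\<close> can differentiate.\<close>

lemma bmass_mix:
  assumes F: "F \<in> laws" and u: "u \<in> {0..A}" and e: "0 \<le> e" "e \<le> 1"
  shows "bmass (mix_dirac F u e) {1..int n} y = mix_int F u e (input_times n) (rkernel {1..int n} y)"
proof -
  have "bmass (mix_dirac F u e) {1..int n} y = mix_int F u e UNIV (rkernel {1..int n} y)"
    using bmass_eq[OF mix_dirac_laws(1)[OF assms], of "{1..int n}"] by (simp add: mix_int_def mixed_inputs_def)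
  also have "\<dots> = mix_int F u e (input_times n) (rkernel {1..int n} y)"
    by (rule mix_int_restrict[OF F u e, where J="input_times n"]) (auto intro!: rkernel_as_ckernel[OF F])
  finally show ?thesis .
qed

definition bmass_deriv :: "real measure \<Rightarrow> real \<Rightarrow> nat \<Rightarrow> (int \<Rightarrow> nat) \<Rightarrow> real \<Rightarrow> real" where
  "bmass_deriv F u n y e = (\<Sum>k\<in>input_times n. mix_int F u e (input_times n - {k}) (\<lambda>x. rkernel {1..int n} y (x(k := u)))
      - mix_int F u e (input_times n - {k}) (rkernel {1..int n} y))"

lemma bmass_mix_derivative:
  assumes F: "F \<in> laws" and u: "u \<in> {0..A}" and e: "e \<in> {0..1}"
  shows "((\<lambda>e. bmass (mix_dirac F u e) {1..int n} y) has_field_derivative bmass_deriv F u n y e) (at e within {0..1})"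
  unfolding bmass_deriv_def
  by (rule has_field_derivative_transform_within[where d=1, OF mix_int_derivative[OF F u _ bounded_nonneg_rkernel[OF F] e]])
    (use e in \<open>auto simp: bmass_mix[OF F u]\<close>)

lemma bmass_deriv_continuous:
  assumes F: "F \<in> laws" and u: "u \<in> {0..A}"
  shows "continuous_on {0..1} (bmass_deriv F u n y)"
proof -
  have "continuous_on {0..1} (\<lambda>e. mix_int F u e K f)" if "finite K" "bounded_nonneg F c f" for K f c
    by (rule DERIV_continuous_on) (rule mix_int_derivative[OF F u that])
  then show ?thesis
    unfolding bmass_deriv_def[abs_def] using bounded_nonneg_rkernel[OF F] bounded_nonneg_upd[OF F u bounded_nonneg_rkernel[OF F]]
    by (intro continuous_on_sum continuous_on_diff) blast+
qed

lemma bmass_deriv_bound: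
  assumes F: "F \<in> laws" and u: "u \<in> {0..A}" and e: "e \<in> {0..1}"
  shows "\<bar>bmass_deriv F u n y e\<bar> \<le> (real n + real L) * (\<Prod>s\<in>{1..int n}. ubound 0 (y s))"
proof -
  let ?c = "\<Prod>s\<in>{1..int n}. ubound 0 (y s)"
  have "\<bar>bmass_deriv F u n y e\<bar> \<le> (\<Sum>k\<in>input_times n. ?c)"
    unfolding bmass_deriv_def
  proof (rule order_trans[OF sum_abs sum_mono])
    fix k
    have e': "0 \<le> e" "e \<le> 1" using e by auto
    note b = mix_int_bounds[OF F u e' bounded_nonneg_rkernel[OF F, where I="{1..int n}" and y=y], of "input_times n - {k}"]
      mix_int_bounds[OF F u e' bounded_nonneg_upd[OF F u bounded_nonneg_rkernel[OF F, where I="{1..int n}" and y=y], of k], of "input_times n - {k}"]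
    show "\<bar>mix_int F u e (input_times n - {k}) (\<lambda>x. rkernel {1..int n} y (x(k := u))) - mix_int F u e (input_times n - {k}) (rkernel {1..int n} y)\<bar> \<le> ?c"
      using b by linarith
  qed
  also have "\<dots> = (real n + real L) * ?c" by simp
  finally show ?thesis .
qed

text \<open>Since (1 - e) (\<delta>_u - F) = \<delta>_u - F_e for the mixture F_e, the derivative at
  an interior point e is, up to the factor 1 - e, the same functional evaluated at the law F_e.
  Estimates uniform in the law thus apply along the whole segment.\<close>

lemma bmass_deriv_fixed:
  assumes F: "F \<in> laws" and u: "u \<in> {0..A}" and e: "0 \<le> e" "e < 1"
  shows "complex_of_real ((1 - e) * bmass_deriv F u n y e) = (\<Sum>j\<in>input_times n. cmass (mix_dirac F u e) {1..int n} j (of_real u) y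
      - of_real (bmass (mix_dirac F u e) {1..int n} y))"
proof -
  have e1: "e \<le> 1" using e by simp
  let ?f = "rkernel {1..int n} y" let ?G = "mix_dirac F u e"
  note G = mix_dirac_laws(1)[OF F u e(1) e1]
  have *: "(1 - e) * (mix_int F u e (input_times n - {k}) (\<lambda>x. ?f (x(k := u))) - mix_int F u e (input_times n - {k}) ?f)
      = mix_int F u e UNIV (\<lambda>x. ?f (x(k := u))) - bmass ?G {1..int n} y" if "k \<in> input_times n" for k
  proof -
    have ins: "insert k (input_times n - {k}) = input_times n" using that by auto
    have 1: "mix_int F u e (input_times n) ?f = (1 - e) * mix_int F u e (input_times n - {k}) ?f + e * mix_int F u e (input_times n - {k}) (\<lambda>x. ?f (x(k := u)))"
      using mix_int_insert[OF F u e(1) e1 bounded_nonneg_rkernel[OF F], of k "input_times n - {k}" "{1..int n}" y] unfolding ins by simp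
    have J: "(\<lambda>x. ?f (x(k := u))) \<in> borel_measurable (Pi\<^sub>M (input_times n - {k}) (\<lambda>_. F))"
    proof -
      have "of_real (?f (x(k := u))) = ckernel {1..int n} k (of_real u) y x" for x
        unfolding ckernel_def rkernel_def of_real_prod crate_of_real poisson_kernel_of_real ..
      then have "(\<lambda>x. ?f (x(k := u))) = (\<lambda>x. Re (ckernel {1..int n} k (of_real u) y x))" by (metis Re_complex_of_real)
      moreover have "ckernel {1..int n} k (of_real u) y \<in> borel_measurable (Pi\<^sub>M (input_times n - {k}) (\<lambda>_. F))"
        by (rule measurable_ckernel[OF F]) auto
      ultimately show ?thesis by simp
    qed
    have dep: "?f ((restrict x (input_times n - {k}))(k := u)) = ?f (x(k := u))" for x
      unfolding rkernel_def by (intro prod.cong refl arg_cong2[where f=poisson_weight] rate_cong) auto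
    have 2: "mix_int F u e (input_times n - {k}) (\<lambda>x. ?f (x(k := u))) = mix_int F u e UNIV (\<lambda>x. ?f (x(k := u)))"
      by (rule mix_int_restrict[OF F u e(1) e1 _ J dep]) auto
    show ?thesis unfolding bmass_mix[OF F u e(1) e1] 1 2[symmetric] by (simp add: algebra_simps)
  qed
  have FPm: "cmass ?G {1..int n} k (of_real u) y = of_real (mix_int F u e UNIV (\<lambda>x. ?f (x(k := u))))" for k
    unfolding cmass_def ckernel_def crate_of_real poisson_kernel_of_real rkernel_def mix_int_def mixed_inputs_def
    by (simp flip: of_real_prod)
  have "(1 - e) * bmass_deriv F u n y e = (\<Sum>k\<in>input_times n. mix_int F u e UNIV (\<lambda>x. ?f (x(k := u))) - bmass ?G {1..int n} y)"
    unfolding bmass_deriv_def sum_distrib_left by (rule sum.cong) (use * in auto)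
  then show ?thesis unfolding FPm by simp
qed

section \<open>Entropies\<close>

lemma cmass_total:
  assumes F: "F \<in> laws" and I: "finite I"
  shows "((\<lambda>y. cmass F I j z y) has_sum 1) (PiE I (\<lambda>_. UNIV))"
proof -
  interpret prob_space "inputs F" by (rule prob_inputs[OF F])
  have "cmass F {} j z (\<lambda>_. 0) = 1" by (simp add: cmass_def ckernel_def prob_space)
  moreover have "cmass F I j z (\<lambda>s. if s \<in> I then u s else 0) = cmass F I j z u" for u
    by (rule cmass_cong) simp
  ultimately show ?thesis using cmass_marginal[OF F _ I, of "{}" j z "\<lambda>_. 0"] by simp
qed

lemma ln_bmass_bound:
  assumes F: "F \<in> laws"
  shows "\<bar>ln (bmass F {1..int n} y)\<bar> \<le> real n * growth_const * (\<Prod>s\<in>{1..int n}. growth ^ y s)"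
proof -
  have "\<bar>ln (bmass F {1..int n} y)\<bar> \<le> (\<Sum>m<n. \<bar>info F (int m + 1) m y\<bar>)"
    unfolding ln_bmass_chain[OF F] by simp
  also have "\<dots> \<le> (\<Sum>m<n. growth_const * (\<Prod>s\<in>{1..int n}. growth ^ y s))"
    by (intro sum_mono info_dom[OF F]) auto
  finally show ?thesis by simp
qed

definition ent_term_deriv :: "real measure \<Rightarrow> real \<Rightarrow> nat \<Rightarrow> (int \<Rightarrow> nat) \<Rightarrow> real \<Rightarrow> real" where
  "ent_term_deriv F u n y e = - (bmass_deriv F u n y e * (ln (bmass (mix_dirac F u e) {1..int n} y) + 1))"

definition block_ent_deriv :: "real measure \<Rightarrow> real \<Rightarrow> nat \<Rightarrow> real \<Rightarrow> real" where
  "block_ent_deriv F u n e = (\<Sum>\<^sub>\<infinity>y\<in>window 1 (int n). ent_term_deriv F u n y e)"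

text \<open>A majorant, uniform in the mixing weight, for both the entropy terms and their
  derivatives. The two products stand for the logarithm and for the constant 1 next to it; the base
  1 gives the second the shape of \<open>prod_ubound_summable\<close>.\<close>

definition ent_bound :: "nat \<Rightarrow> (int \<Rightarrow> nat) \<Rightarrow> real" where
  "ent_bound n y = (real n + real L + 1) * ((real n * growth_const) * (\<Prod>s\<in>{1..int n}. growth ^ y s * ubound 0 (y s))
      + (\<Prod>s\<in>{1..int n}. 1 ^ y s * ubound 0 (y s)))"

lemma ent_bound_summable: "ent_bound n summable_on window 1 (int n)"
  unfolding ent_bound_def[abs_def] window_def
  by (intro summable_on_cmult_right summable_on_add prod_ubound_summable) (use growth_ge in auto)

lemma ent_term_deriv_bound:
  assumes F: "F \<in> laws" and u: "u \<in> {0..A}" and e: "e \<in> {0..1}"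
  shows "\<bar>ent_term_deriv F u n y e\<bar> \<le> ent_bound n y"
    and "\<bar>bmass (mix_dirac F u e) {1..int n} y * ln (bmass (mix_dirac F u e) {1..int n} y)\<bar> \<le> ent_bound n y"
proof -
  have G: "mix_dirac F u e \<in> laws" by (rule mix_dirac_laws(1)[OF F u]) (use e in auto)
  let ?p = "bmass (mix_dirac F u e) {1..int n} y"
  let ?Q = "\<Prod>s\<in>{1..int n}. ubound 0 (y s)" and ?g = "\<Prod>s\<in>{1..int n}. growth ^ y s"
  let ?l = "real n * growth_const * ?g"
  have Q: "?Q \<ge> 0" using ubound_pos[of 0] by (intro prod_nonneg) (auto intro: less_imp_le)
  have l: "\<bar>ln ?p\<bar> \<le> ?l" by (rule ln_bmass_bound[OF G])
  then have l0: "?l \<ge> 0" by linarith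
  have eb: "ent_bound n y = (real n + real L + 1) * (?Q * (?l + 1))"
    by (simp add: ent_bound_def prod.distrib algebra_simps)
  have "\<bar>ent_term_deriv F u n y e\<bar> \<le> ((real n + real L) * ?Q) * (?l + 1)"
    unfolding ent_term_deriv_def abs_minus_cancel abs_mult
    by (intro mult_mono bmass_deriv_bound[OF F u e]) (use l Q in auto)
  also have "\<dots> \<le> ent_bound n y" unfolding eb using Q l0 by (simp add: mult.assoc mult_right_mono)
  finally show "\<bar>ent_term_deriv F u n y e\<bar> \<le> ent_bound n y" .
  have "\<bar>?p * ln ?p\<bar> \<le> ?Q * ?l"
    unfolding abs_mult by (intro mult_mono) (use bmass_bounds(2,3)[OF G, of "{1..int n}" y] l Q in auto)
  also have "\<dots> \<le> 1 * (?Q * (?l + 1))" using Q by (simp add: algebra_simps)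
  also have "\<dots> \<le> ent_bound n y" unfolding eb using Q l0 by (intro mult_right_mono) auto
  finally show "\<bar>?p * ln ?p\<bar> \<le> ent_bound n y" .
qed

lemma block_entropy_mix_derivative:
  assumes F: "F \<in> laws" and u: "u \<in> {0..A}" and n: "n \<ge> 1" and e: "e \<in> {0..1}"
  shows "((\<lambda>e. block_entropy L lam0 h (mix_dirac F u e) n) has_field_derivative block_ent_deriv F u n e) (at e within {0..1})"
proof -
  let ?p = "\<lambda>y e. bmass (mix_dirac F u e) {1..int n} y"
  have "((\<lambda>e. \<Sum>\<^sub>\<infinity>y\<in>window 1 (int n). - (?p y e * ln (?p y e))) has_field_derivative block_ent_deriv F u n e) (at e within {0..1})"
    unfolding block_ent_deriv_def
  proof (rule infsum_has_field_derivative[OF countable_window infinite_window[OF n] _ _ _ ent_bound_summable _ ent_bound_summable e])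
    fix y e assume e: "e \<in> {0..1::real}"
    have G: "mix_dirac F u e \<in> laws" by (rule mix_dirac_laws(1)[OF F u]) (use e in auto)
    have p: "?p y e > 0" by (rule bmass_bounds(3)[OF G]) simp
    have "((\<lambda>e. - (?p y e * ln (?p y e))) has_field_derivative
        - (bmass_deriv F u n y e * ln (?p y e) + (inverse (?p y e) * bmass_deriv F u n y e) * ?p y e)) (at e within {0..1})"
      by (intro DERIV_minus DERIV_mult bmass_mix_derivative[OF F u e] DERIV_chain'[OF bmass_mix_derivative[OF F u e] DERIV_ln[OF p], simplified] )
    moreover have "- (bmass_deriv F u n y e * ln (?p y e) + (inverse (?p y e) * bmass_deriv F u n y e) * ?p y e) = ent_term_deriv F u n y e"
      using p by (simp add: ent_term_deriv_def field_simps)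
    ultimately show "((\<lambda>e. - (?p y e * ln (?p y e))) has_field_derivative ent_term_deriv F u n y e) (at e within {0..1})" by simp
    show "\<bar>- (?p y e * ln (?p y e))\<bar> \<le> ent_bound n y" using ent_term_deriv_bound(2)[OF F u e] by simp
    show "\<bar>ent_term_deriv F u n y e\<bar> \<le> ent_bound n y" by (rule ent_term_deriv_bound(1)[OF F u e])
  qed simp
  then show ?thesis by (simp add: block_entropy_def block_prob_eq infsum_uminus)
qed

lemma block_ent_deriv_continuous:
  assumes F: "F \<in> laws" and u: "u \<in> {0..A}"
  shows "continuous_on {0..1} (block_ent_deriv F u n)"
  unfolding block_ent_deriv_def[abs_def]
proof (rule continuous_on_infsum[OF _ ent_term_deriv_bound(1)[OF F u] ent_bound_summable])
  fix y
  have pc: "continuous_on {0..1} (\<lambda>e. bmass (mix_dirac F u e) {1..int n} y)"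
    by (rule DERIV_continuous_on) (rule bmass_mix_derivative[OF F u])
  have "bmass (mix_dirac F u e) {1..int n} y \<noteq> 0" if "e \<in> {0..1}" for e
    using bmass_bounds(3)[OF mix_dirac_laws(1)[OF F u], of e "{1..int n}" y] that by auto
  then show "continuous_on {0..1} (ent_term_deriv F u n y)"
    unfolding ent_term_deriv_def[abs_def] by (intro continuous_intros bmass_deriv_continuous[OF F u] pc) auto
qed

text \<open>Identifies the genuine derivative of the block entropy with the functional
  \<open>D_block\<close>, which keeps only the logarithm from the derivative of p ln p.\<close>

lemma block_ent_deriv_eq:
  assumes F: "F \<in> laws" and u: "u \<in> {0..A}" and n: "n \<ge> 1" and e: "0 \<le> e" "e < 1"
  shows "complex_of_real ((1 - e) * block_ent_deriv F u n e) = of_nat n * D_block L lam0 h (mix_dirac F u e) n (of_real u)"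
proof -
  let ?G = "mix_dirac F u e" let ?I = "{1..int n}" let ?W = "window 1 (int n)"
  have G: "?G \<in> laws" by (rule mix_dirac_laws(1)[OF F u]) (use e in auto)
  let ?d = "\<lambda>j y. cmass ?G ?I j (of_real u) y - of_real (bmass ?G ?I y)"
  define V where "V j = infsum (D_block_term L lam0 h ?G n j (of_real u)) ?W" for j
  have dt: "D_block_term L lam0 h ?G n j (of_real u) y = ?d j y * of_real (ln (bmass ?G ?I y))" for j y
    by (simp add: D_block_term_def fixed_prob_eq[OF G] block_prob_eq)
  have 1: "((\<lambda>y. ?d j y * of_real (ln (bmass ?G ?I y))) has_sum V j) ?W" for j
    using D_block_term_has_sum[OF G, of n j "of_real u"] infsumI[OF D_block_term_has_sum[OF G, of n j "of_real u"]]
    unfolding V_def dt by simp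
  \<comment> \<open>Both laws have total mass 1, so the constant 1 in ln p + 1 sums to
    nothing.\<close>
  have 2: "(?d j has_sum 0) ?W" for j
  proof -
    have "cmass ?G ?I (int n + 1) 0 y = of_real (bmass ?G ?I y)" for y by (rule cmass_unaffected[OF G]) auto
    then show ?thesis
      using has_sum_difference[OF cmass_total[OF G, of ?I j "of_real u"] cmass_total[OF G, of ?I "int n + 1" 0]] by (simp add: window_def)
  qed
  have "((\<lambda>y. \<Sum>j\<in>input_times n. - (?d j y * of_real (ln (bmass ?G ?I y)) + ?d j y)) has_sum (\<Sum>j\<in>input_times n. - (V j + 0))) ?W"
    by (intro has_sum_finite_sum has_sum_uminusI has_sum_add 1 2) auto
  moreover have "(\<Sum>j\<in>input_times n. - (?d j y * of_real (ln (bmass ?G ?I y)) + ?d j y)) = of_real ((1 - e) * ent_term_deriv F u n y e)" for y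
  proof -
    have "complex_of_real ((1 - e) * ent_term_deriv F u n y e) = - (of_real ((1 - e) * bmass_deriv F u n y e) * (of_real (ln (bmass ?G ?I y)) + 1))"
      by (simp add: ent_term_deriv_def)
    also have "\<dots> = - ((\<Sum>j\<in>input_times n. ?d j y) * (of_real (ln (bmass ?G ?I y)) + 1))"
      unfolding bmass_deriv_fixed[OF F u e] ..
    also have "\<dots> = (\<Sum>j\<in>input_times n. - (?d j y * of_real (ln (bmass ?G ?I y)) + ?d j y))"
      by (simp only: sum_distrib_right sum_negf distrib_left mult_1_right sum.distrib)
    finally show ?thesis ..
  qed
  ultimately have hs: "((\<lambda>y. complex_of_real ((1 - e) * ent_term_deriv F u n y e)) has_sum - (\<Sum>j\<in>input_times n. V j)) ?W"
    by (simp add: sum_negf)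
  have "(\<lambda>y. ent_term_deriv F u n y e) summable_on ?W"
    by (rule abs_summable_summable, rule Infinite_Sum.summable_on_comparison_test[OF ent_bound_summable])
      (use ent_term_deriv_bound(1)[OF F u] e in auto)
  then have "((\<lambda>y. ent_term_deriv F u n y e) has_sum block_ent_deriv F u n e) ?W"
    unfolding block_ent_deriv_def by (rule has_sum_infsum)
  then have "((\<lambda>y. complex_of_real ((1 - e) * ent_term_deriv F u n y e)) has_sum of_real ((1 - e) * block_ent_deriv F u n e)) ?W"
    by (intro has_sum_of_real has_sum_cmult_right)
  from has_sum_unique[OF this hs] show ?thesis
    unfolding D_block_def V_def using n by simp
qed

lemma block_entropy_right_derivative:
  assumes F: "F \<in> laws" and u: "u \<in> {0..A}" and n: "n \<ge> 1"
  shows "((\<lambda>e. complex_of_real (1 / real n * block_entropy L lam0 h (mix_dirac F u e) n))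
      has_vector_derivative D_block L lam0 h F n (of_real u)) (at_right 0)"
proof -
  have "((\<lambda>e. block_entropy L lam0 h (mix_dirac F u e) n) has_real_derivative block_ent_deriv F u n 0) (at 0 within {0..1})"
    by (rule block_entropy_mix_derivative[OF F u n]) simp
  then have "((\<lambda>e. block_entropy L lam0 h (mix_dirac F u e) n) has_real_derivative block_ent_deriv F u n 0) (at_right 0)"
    by (simp add: at_within_Icc_at_right)
  from DERIV_cmult[OF this, of "1 / real n"]
  have "((\<lambda>e. 1 / real n * block_entropy L lam0 h (mix_dirac F u e) n) has_real_derivative 1 / real n * block_ent_deriv F u n 0) (at_right 0)" .
  then have "((\<lambda>e. complex_of_real (1 / real n * block_entropy L lam0 h (mix_dirac F u e) n))
      has_vector_derivative of_real (1 / real n * block_ent_deriv F u n 0)) (at_right 0)"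
    by (rule has_vector_derivative_of_real)
  moreover have "complex_of_real (1 / real n * block_ent_deriv F u n 0) = D_block L lam0 h F n (of_real u)"
    using block_ent_deriv_eq[OF F u n, of 0] n by (simp add: mix_dirac_0[OF F])
  ultimately show ?thesis by simp
qed

section \<open>Conditional entropies H(Y_0 | Y_{-m}, ..., Y_{-1}) and the limiting
  derivative\<close>

definition cond_ent :: "real measure \<Rightarrow> nat \<Rightarrow> real" where
  "cond_ent F m = (\<Sum>\<^sub>\<infinity>y\<in>window (- int m) 0. info F 0 m y * bmass F {- int m..0} y)"

lemma exp_info_baseline:
  assumes F: "F \<in> laws" and "{t - int m..t} \<inter> {j..j + int L} = {}"
  shows "exp_info F t m j z = of_real (cond_ent F m)"
proof -
  have "exp_info F t m j z = exp_info F t m (t + 1) 0" by (rule exp_info_unaffected[OF assms])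
  also have "\<dots> = exp_info F 0 m 1 0" using exp_info_shift[OF F, of t t m "t + 1" 0] by simp
  also have "\<dots> = (\<Sum>\<^sub>\<infinity>y\<in>window (- int m) 0. of_real (info F 0 m y * bmass F {- int m..0} y))"
    unfolding exp_info_def using cmass_unaffected[OF F, of "{- int m..0}" 1 0] by simp
  also have "\<dots> = of_real (cond_ent F m)" unfolding cond_ent_def
  proof (rule infsumI[OF has_sum_of_real[OF has_sum_infsum]], rule abs_summable_summable)
    show "(\<lambda>y. norm (info F 0 m y * bmass F {- int m..0} y)) summable_on window (- int m) 0"
      using info_cmass_summable[OF F, of "{- int m..0}" 0 m 1 0] cmass_unaffected[OF F, of "{- int m..0}" 1 0]
      by (simp add: window_def norm_mult abs_mult)
  qed
  finally show ?thesis .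
qed

lemma cond_ent_diff:
  assumes F: "F \<in> laws" and m: "m \<le> m'"
  shows "\<bar>cond_ent F m' - cond_ent F m\<bar> \<le> forget_const 0 * forget_rate 0 ^ (2 * m)"
proof -
  have z: "norm (0::complex) \<le> 0" by simp
  have e: "exp_info F 0 k 1 0 = of_real (cond_ent F k)" for k by (rule exp_info_baseline[OF F]) auto
  have "\<bar>cond_ent F m' - cond_ent F m\<bar> = norm (exp_info F 0 m' 1 0 - exp_info F 0 m 1 0)"
    unfolding e by (metis norm_of_real of_real_diff)
  also have "\<dots> \<le> growth_const * theta_const 0 * contraction 0 ^ (m div (L + 1))" by (rule exp_info_diff[OF F z m])
  also have "\<dots> \<le> growth_const * theta_const 0 * (forget_rate 0 ^ (2 * m) / contraction 0)"
    by (intro mult_left_mono contraction_div_le) (use growth_ge theta_const_pos[of 0] in auto)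
  also have "\<dots> \<le> 2 * growth_const * theta_const 0 * (forget_rate 0 ^ (2 * m) / contraction 0)"
    using growth_ge theta_const_pos[of 0] forget_rate_bounds[of 0] contraction_bounds[of 0] by (intro mult_right_mono) auto
  also have "\<dots> = 2 * growth_const * theta_const 0 / contraction 0 * forget_rate 0 ^ (2 * m)" by simp
  also have "\<dots> \<le> forget_const 0 * forget_rate 0 ^ (2 * m)"
    using forget_rate_bounds[of 0] by (intro mult_right_mono forget_const_ge) auto
  finally show ?thesis .
qed

text \<open>The chain rule in expectation; stationarity moves the conditional entropy at time
  \<open>m + 1\<close> to time 0.\<close>

lemma block_entropy_eq:
  assumes F: "F \<in> laws"
  shows "block_entropy L lam0 h F n = (\<Sum>m<n. cond_ent F m)"
proof -
  let ?I = "{1..int n}"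
  have "((\<lambda>y. of_real (info F (int m + 1) m y) * cmass F ?I (int n + 1) 0 y) has_sum of_real (cond_ent F m)) (PiE ?I (\<lambda>_. UNIV))"
    if "m < n" for m
  proof -
    have s: "(\<lambda>y. of_real (info F (int m + 1) m y) * cmass F ?I (int n + 1) 0 y) summable_on (PiE ?I (\<lambda>_. UNIV))"
      by (rule abs_summable_summable, rule info_cmass_summable[OF F]) (use that in auto)
    have e: "infsum (\<lambda>y. of_real (info F (int m + 1) m y) * cmass F ?I (int n + 1) 0 y) (PiE ?I (\<lambda>_. UNIV)) = exp_info F (int m + 1) m (int n + 1) 0"
      by (rule exp_info_larger_window[OF F]) (use that in auto)
    have "exp_info F (int m + 1) m (int n + 1) 0 = of_real (cond_ent F m)"
      by (rule exp_info_baseline[OF F]) (use that in auto)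
    then show ?thesis using has_sum_infsum[OF s] unfolding e by simp
  qed
  then have "((\<lambda>y. \<Sum>m<n. of_real (info F (int m + 1) m y) * cmass F ?I (int n + 1) 0 y) has_sum (\<Sum>m<n. of_real (cond_ent F m))) (PiE ?I (\<lambda>_. UNIV))"
    by (intro has_sum_finite_sum) auto
  moreover have "(\<Sum>m<n. of_real (info F (int m + 1) m y) * cmass F ?I (int n + 1) 0 y) = - of_real (bmass F ?I y * ln (bmass F ?I y))" for y
  proof -
    have "cmass F ?I (int n + 1) 0 y = of_real (bmass F ?I y)" by (rule cmass_unaffected[OF F]) auto
    then show ?thesis by (simp add: ln_bmass_chain[OF F] sum_distrib_left mult.commute)
  qed
  ultimately have "((\<lambda>y. complex_of_real (- (bmass F ?I y * ln (bmass F ?I y)))) has_sum of_real (\<Sum>m<n. cond_ent F m)) (PiE ?I (\<lambda>_. UNIV))"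
    by simp
  then have "((\<lambda>y. - (bmass F ?I y * ln (bmass F ?I y))) has_sum (\<Sum>m<n. cond_ent F m)) (PiE ?I (\<lambda>_. UNIV))"
    by (simp only: has_sum_of_real_iff)
  then show ?thesis
    unfolding block_entropy_def block_prob_eq window_def infsum_uminus[symmetric] by (rule infsumI)
qed

text \<open>The estimates \<open>D_block_approx\<close> and \<open>cond_ent_diff\<close> are uniform in the input law, so the mean value
  theorem can be applied to the block entropies before the block length is sent to infinity.\<close>

lemma entropy_limit_right_derivative:
  assumes F: "F \<in> laws" and u: "u \<in> {0..A}"
    and lim: "\<And>G. G \<in> laws \<Longrightarrow> (\<lambda>m. cond_ent G m) \<longlonglongrightarrow> r G"
  shows "((\<lambda>e. complex_of_real (r (mix_dirac F u e))) has_vector_derivative h_dot L lam0 h F (of_real u)) (at_right 0)"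
proof -
  define B where "B = \<bar>u\<bar>"
  have B: "B \<ge> 0" "norm (complex_of_real u) \<le> B" by (auto simp: B_def)
  let ?G = "\<lambda>e. mix_dirac F u e"
  have G: "?G e \<in> laws" if "0 \<le> e" "e \<le> 1" for e by (rule mix_dirac_laws(1)[OF F u that])
  define H where "H n e = block_entropy L lam0 h (?G e) n / real n" for n e
  define C0 where "C0 = forget_const 0 / (1 - forget_rate 0)"
  note s0 = forget_rate_bounds[of 0, simplified] and c0 = forget_const_ge(3)[of 0, simplified]
  have r: "\<bar>block_entropy L lam0 h G n / real n - r G\<bar> \<le> C0 / real n" if G: "G \<in> laws" and n: "n \<ge> 1" for G n
  proof -
    have cr: "\<bar>cond_ent G m - r G\<bar> \<le> forget_const 0 * forget_rate 0 ^ m" for m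
    proof -
      have "(\<lambda>k. \<bar>cond_ent G k - cond_ent G m\<bar>) \<longlonglongrightarrow> \<bar>r G - cond_ent G m\<bar>" by (intro tendsto_intros lim G)
      then have "\<bar>r G - cond_ent G m\<bar> \<le> forget_const 0 * forget_rate 0 ^ (2 * m)"
        by (rule tendsto_upperbound) (use cond_ent_diff[OF G] in \<open>auto intro: eventually_sequentiallyI[of m]\<close>)
      also have "\<dots> \<le> forget_const 0 * forget_rate 0 ^ m" using s0 c0 by (intro mult_left_mono power_decreasing) auto
      finally show ?thesis by (simp add: abs_minus_commute)
    qed
    have "block_entropy L lam0 h G n / real n - r G = (\<Sum>m<n. cond_ent G m - r G) / real n"
      unfolding block_entropy_eq[OF G] using n by (simp add: sum_subtractf field_simps)
    also have "\<bar>\<dots>\<bar> \<le> (\<Sum>m<n. \<bar>cond_ent G m - r G\<bar>) / real n"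
      by (simp add: divide_right_mono)
    also have "\<dots> \<le> (\<Sum>m<n. forget_const 0 * forget_rate 0 ^ m) / real n" by (intro divide_right_mono sum_mono cr) auto
    also have "\<dots> \<le> C0 / real n"
      unfolding C0_def by (intro divide_right_mono mean_geometric_le) (use s0 c0 in auto)
    finally show ?thesis .
  qed
  define d where "d = Re (h_dot L lam0 h F (of_real u))"
  define D where "D n e = block_ent_deriv F u n e / real n" for n e
  have D: "complex_of_real (D n e) = D_block L lam0 h (?G e) n (of_real u) / of_real (1 - e)"
    if "n \<ge> 1" "0 \<le> e" "e < 1" for n e
    using block_ent_deriv_eq[OF F u that] that unfolding D_def
    by (simp add: field_simps)
  \<comment> \<open>At real points the block functionals are derivatives of real entropies, and the
    reals are closed, so the limit is real and real calculus applies.\<close>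
  have hd: "h_dot L lam0 h F (of_real u) = of_real d"
  proof -
    have "(\<lambda>n. D_block L lam0 h F n (of_real u)) \<longlonglongrightarrow> h_dot L lam0 h F (of_real u)"
    proof (rule LIMSEQ_I)
      fix e :: real assume "e > 0"
      have "(\<lambda>n. block_const B / real n) \<longlonglongrightarrow> 0" by (rule lim_const_over_n)
      from LIMSEQ_D[OF this \<open>e > 0\<close>] obtain N where N: "\<And>n. n \<ge> N \<Longrightarrow> norm (block_const B / real n) < e" by auto
      show "\<exists>N. \<forall>n\<ge>N. norm (D_block L lam0 h F n (of_real u) - h_dot L lam0 h F (of_real u)) < e"
      proof (intro exI[of _ "max N 1"] allI impI)
        fix n assume "n \<ge> max N 1"
        then show "norm (D_block L lam0 h F n (of_real u) - h_dot L lam0 h F (of_real u)) < e"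
          using D_block_approx[OF F B(2), of n] N[of n] block_const_nonneg[OF B(1)] by auto
      qed
    qed
    then have lim: "(\<lambda>n. D_block L lam0 h F n (of_real u)) \<longlonglongrightarrow> h_dot L lam0 h F (of_real u)" .
    have "D_block L lam0 h F n (of_real u) \<in> \<real>" if "n \<ge> 1" for n
      using D[OF that, of 0] mix_dirac_0[OF F] by (metis Reals_of_real diff_zero div_by_1 of_real_1 order_refl zero_less_one)
    then have "\<forall>\<^sub>F n in sequentially. D_block L lam0 h F n (of_real u) \<in> \<real>"
      by (auto intro: eventually_sequentiallyI[of 1])
    then have "h_dot L lam0 h F (of_real u) \<in> \<real>"
      by (rule Lim_in_closed_set[OF closed_complex_Reals _ sequentially_bot lim])
    then show ?thesis unfolding d_def by (simp add: of_real_Re)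
  qed
  \<comment> \<open>Restricting to e \<le> 1/2 keeps the factor 1 / (1 - e) below 2. The comparison
    passes through \<open>h_dot\<close> at the mixed law, whose block error is uniform in e.\<close>
  have cmp: "\<bar>D n e - D N e\<bar> \<le> 2 * (block_const B / real n + block_const B / real N)"
    if "n \<ge> 1" "N \<ge> 1" "0 \<le> e" "e \<le> 1/2" for n N e
  proof -
    have e1: "e < 1" "e \<le> 1" using that by auto
    let ?z = "complex_of_real u"
    have "\<bar>D n e - D N e\<bar> = norm (complex_of_real (D n e) - of_real (D N e))" by (metis norm_of_real of_real_diff)
    also have "\<dots> = norm (D_block L lam0 h (?G e) n ?z - D_block L lam0 h (?G e) N ?z) / (1 - e)"
      unfolding D[OF that(1,3) e1(1)] D[OF that(2,3) e1(1)] diff_divide_distrib[symmetric] norm_divide norm_of_real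
      using e1 by simp
    also have "\<dots> \<le> (block_const B / real n + block_const B / real N) / (1 - e)"
    proof (rule divide_right_mono)
      have "norm (D_block L lam0 h (?G e) n ?z - D_block L lam0 h (?G e) N ?z)
          \<le> norm (D_block L lam0 h (?G e) n ?z - h_dot L lam0 h (?G e) ?z) + norm (D_block L lam0 h (?G e) N ?z - h_dot L lam0 h (?G e) ?z)"
        using norm_triangle_ineq4[of "D_block L lam0 h (?G e) n ?z - h_dot L lam0 h (?G e) ?z"
          "D_block L lam0 h (?G e) N ?z - h_dot L lam0 h (?G e) ?z"] by simp
      then show "norm (D_block L lam0 h (?G e) n ?z - D_block L lam0 h (?G e) N ?z) \<le> block_const B / real n + block_const B / real N"
        using D_block_approx[OF G[OF that(3) e1(2)] B(2) that(1)] D_block_approx[OF G[OF that(3) e1(2)] B(2) that(2)] by linarith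
    qed (use e1 in auto)
    also have "\<dots> \<le> (block_const B / real n + block_const B / real N) * 2"
    proof -
      have "1 / (1 - e) \<le> 2" using that by (simp add: field_simps)
      then show ?thesis using block_const_nonneg[OF B(1)] mult_left_mono[of "1 / (1 - e)" 2 "block_const B / real n + block_const B / real N"] by simp
    qed
    finally show ?thesis by (simp only: mult.commute[of 2])
  qed
  have D0: "\<bar>D n 0 - d\<bar> \<le> block_const B / real n" if "n \<ge> 1" for n
  proof -
    have "\<bar>D n 0 - d\<bar> = norm (complex_of_real (D n 0) - of_real d)" by (metis norm_of_real of_real_diff)
    also have "\<dots> = norm (D_block L lam0 h F n (of_real u) - h_dot L lam0 h F (of_real u))"
      using D[OF that, of 0] by (simp add: mix_dirac_0[OF F] hd)
    finally show ?thesis using D_block_approx[OF F B(2) that] by simp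
  qed
  have quot: "\<forall>\<^sub>F e in at_right 0. \<bar>(r (?G e) - r F) / e - d\<bar> \<le> \<eta>" if "\<eta> > 0" for \<eta>
  proof -
    \<comment> \<open>Error budget, with w < \<eta>/6 the block error at \<open>N\<close>: 2w from
      \<open>cmp\<close>, w from \<open>D0\<close>, and \<eta>/6 from continuity of
      \<open>D N\<close> at 0. The total stays below \<eta>, leaving the error at length
      \<open>n\<close> to vanish in the limit.\<close>
    have "\<forall>\<^sub>F n in sequentially. block_const B / real n < \<eta> / 6 \<and> n \<ge> 1"
      using order_tendstoD(2)[OF lim_const_over_n, of "\<eta> / 6" "block_const B"] \<open>\<eta> > 0\<close> eventually_ge_at_top by (intro eventually_conj) auto
    then obtain N where N: "block_const B / real N < \<eta> / 6" "N \<ge> 1" by (auto simp: eventually_sequentially)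
    have "continuous_on {0..1} (D N)"
      unfolding D_def[abs_def] by (intro continuous_intros block_ent_deriv_continuous[OF F u]) (use N in auto)
    then have "(D N \<longlongrightarrow> D N 0) (at 0 within {0..1})" by (auto simp: continuous_on_def)
    then have "(D N \<longlongrightarrow> D N 0) (at_right 0)" by (simp add: at_within_Icc_at_right)
    then have "\<forall>\<^sub>F e in at_right 0. dist (D N e) (D N 0) < \<eta> / 6"
      by (rule tendstoD) (use \<open>\<eta> > 0\<close> in simp)
    then obtain b where b0: "b > 0" "\<forall>e>0. e < b \<longrightarrow> dist (D N e) (D N 0) < \<eta> / 6"
      unfolding eventually_at_right_field by blast
    have b: "b > 0" "\<And>e. 0 < e \<Longrightarrow> e < b \<Longrightarrow> \<bar>D N e - D N 0\<bar> < \<eta> / 6"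
      using b0 by (auto simp: dist_real_def)
    have "\<bar>(r (?G e) - r F) / e - d\<bar> \<le> \<eta>" if e: "0 < e" "e < min b (1/2)" for e
    proof -
      \<comment> \<open>The intermediate point of the mean value theorem depends on
        \<open>n\<close>. It is harmless because \<open>D n\<close> is compared with the fixed
        \<open>D N\<close> uniformly in that point, and continuity at 0 is used for \<open>N\<close>
        alone.\<close>
      have key: "\<bar>(H n e - H n 0) / e - d\<bar> \<le> \<eta> + 2 * (block_const B / real n)" if n: "n \<ge> 1" for n
      proof -
        have "\<exists>x\<in>{0<..<e}. H n e - H n 0 = (\<lambda>v. D n x * v) (e - 0)"
        proof (rule mvt_simple[OF e(1)])
          fix x assume x: "0 \<le> x" "x \<le> e"
          have "(H n has_field_derivative D n x) (at x within {0..1})"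
            unfolding H_def[abs_def] D_def by (rule DERIV_cdivide, rule block_entropy_mix_derivative[OF F u n]) (use x e in auto)
          then have "(H n has_field_derivative D n x) (at x within {0..e})"
            by (rule DERIV_subset) (use e in auto)
          then show "(H n has_derivative (\<lambda>v. D n x * v)) (at x within {0..e})"
            by (simp add: has_field_derivative_def)
        qed
        then obtain x where x: "0 < x" "x < e" "H n e - H n 0 = D n x * e" by auto
        have q: "(H n e - H n 0) / e = D n x" using x e by simp
        have xb: "x < b" "x \<le> 1 / 2" using x e by auto
        have "\<bar>D n x - d\<bar> \<le> \<bar>D n x - D N x\<bar> + \<bar>D N x - D N 0\<bar> + \<bar>D N 0 - d\<bar>" by linarith
        also have "\<dots> \<le> 2 * (block_const B / real n + block_const B / real N) + \<eta> / 6 + block_const B / real N"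
          by (intro add_mono cmp[OF n N(2)] D0[OF N(2)] less_imp_le[OF b(2)]) (use x xb in auto)
        also have "\<dots> \<le> \<eta> + 2 * (block_const B / real n)"
        proof -
          have "2 * (v + w) + \<eta> / 6 + w \<le> \<eta> + 2 * v" if "w < \<eta> / 6" for v w :: real
            using that \<open>\<eta> > 0\<close> by (simp add: field_simps)
          from this[OF N(1)] show ?thesis .
        qed
        finally show ?thesis unfolding q .
      qed
      have "(\<lambda>n. \<bar>(H n e - H n 0) / e - d\<bar>) \<longlonglongrightarrow> \<bar>(r (?G e) - r F) / e - d\<bar>"
      proof (intro tendsto_intros)
        have "(\<lambda>n. block_entropy L lam0 h G n / real n) \<longlonglongrightarrow> r G" if "G \<in> laws" for G
        proof (rule LIM_zero_cancel, rule Lim_null_comparison)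
          show "\<forall>\<^sub>F n in sequentially. norm (block_entropy L lam0 h G n / real n - r G) \<le> C0 / real n"
            using r[OF that] by (auto intro: eventually_sequentiallyI[of 1])
          show "(\<lambda>n. C0 / real n) \<longlonglongrightarrow> 0" by (rule lim_const_over_n)
        qed
        note this[OF G[of e]] this[OF F]
        then show "(\<lambda>n. H n e) \<longlonglongrightarrow> r (?G e)" "(\<lambda>n. H n 0) \<longlonglongrightarrow> r F"
          using e unfolding H_def mix_dirac_0[OF F] by auto
      qed (use e in auto)
      moreover have "(\<lambda>n. \<eta> + 2 * (block_const B / real n)) \<longlonglongrightarrow> \<eta> + 2 * 0"
        by (intro tendsto_intros lim_const_over_n)
      ultimately have "\<bar>(r (?G e) - r F) / e - d\<bar> \<le> \<eta> + 2 * 0"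
        by (rule LIMSEQ_le) (use key in blast)
      then show ?thesis using \<open>\<eta> > 0\<close> by simp
    qed
    then show ?thesis unfolding eventually_at_right_field using b(1) by (intro exI[of _ "min b (1/2)"]) auto
  qed
  have "((\<lambda>e. (r (?G e) - r F) / e) \<longlongrightarrow> d) (at_right 0)"
  proof (rule tendstoI)
    fix \<eta> :: real assume "\<eta> > 0"
    then have "\<forall>\<^sub>F e in at_right 0. \<bar>(r (?G e) - r F) / e - d\<bar> \<le> \<eta> / 2" by (intro quot) simp
    then show "\<forall>\<^sub>F e in at_right 0. dist ((r (?G e) - r F) / e) d < \<eta>"
      by eventually_elim (use \<open>\<eta> > 0\<close> in \<open>auto simp: dist_real_def\<close>)
  qed
  then have "((\<lambda>e. r (?G e)) has_real_derivative d) (at_right 0)"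
    by (simp add: has_field_derivative_iff mix_dirac_0[OF F])
  then have "((\<lambda>e. complex_of_real (r (?G e))) has_vector_derivative of_real d) (at_right 0)"
    by (rule has_vector_derivative_of_real)
  then show ?thesis unfolding hd .
qed

section \<open>Conditioning on the infinite past\<close>

text \<open>The information density is determined only up to null sets of the baseline, yet is
  integrated under the law with a fixed symbol. Fixing a symbol changes finitely many Poisson laws,
  all of full support, so it creates no new events of positive probability.\<close>

lemma AE_output_law_fixed:
  assumes F: "F \<in> laws" and u: "u \<in> {0..A}" and ae: "AE w in olaw F. P w"
  shows "AE w in olawx F j u. P w"
proof -
  interpret I: prob_space "inputs F" by (rule prob_inputs[OF F])
  obtain E where E: "{w \<in> space (olaw F). \<not> P w} \<subseteq> E" "emeasure (olaw F) E = 0" "E \<in> sets (olaw F)"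
    using ae by (rule AE_E)
  have Es: "E \<in> sets outputs" using E(3) output_law_basic(2)[OF F] by simp
  note k = measurable_prob_algebraD[OF measurable_output_kernel[OF F]]
    and kf = measurable_prob_algebraD[OF measurable_output_kernel_fix[OF F u]]
  have "(\<integral>\<^sup>+x. emeasure (okernel x) E \<partial>inputs F) = 0"
    using E(2) emeasure_bind[OF I.not_empty k Es] by (simp add: output_law_def)
  moreover have "(\<lambda>x. emeasure (okernel x) E) \<in> borel_measurable (inputs F)"
    by (rule measurable_compose[OF k measurable_emeasure_subprob_algebra[OF Es]])
  ultimately have "AE x in inputs F. emeasure (okernel x) E = 0"
    by (simp add: nn_integral_0_iff_AE)
  then have "AE x in inputs F. emeasure (okernel (x(j := u))) E = 0"
  proof (rule AE_mp[OF _ AE_I2], intro impI)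
    fix x assume x: "x \<in> space (inputs F)" and null: "emeasure (okernel x) E = 0"
    have pos: "rt x s > 0" "rt (x(j := u)) s > 0" for s
      using rate_bounds(3)[of x s] rate_bounds(3)[of "x(j := u)" s] x u by (auto simp: space_inputs[OF F] fun_upd_def)
    have unaff: "rt (x(j := u)) s = rt x s" if "s \<notin> {j..j + int L}" for s
      by (rule rate_cong) (use that in auto)
    show "emeasure (okernel (x(j := u))) E = 0"
      unfolding output_kernel_def
      by (rule null_set_change_finite[of "{j..j + int L}" "\<lambda>s. poisson_pmf (rt x s)"])
        (use pos unaff null Es in \<open>auto simp: output_kernel_def\<close>)
  qed
  then have "(\<integral>\<^sup>+x. emeasure (okernel (x(j := u))) E \<partial>inputs F) = (\<integral>\<^sup>+x. 0 \<partial>inputs F)"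
    by (rule nn_integral_cong_AE)
  then have null: "emeasure (olawx F j u) E = 0"
    using emeasure_bind[OF I.not_empty kf Es] by (simp add: output_law_fixed_def)
  show ?thesis
    by (rule AE_I[OF _ null]) (use E(1) Es output_law_fixed_basic[OF F u] output_law_basic[OF F] in auto)
qed

text \<open>Treats the baseline law (symbol out of reach) and the law with a real symbol fixed
  alike: both are genuine measures whose cylinder masses up to \<open>t\<close> are given by
  \<open>cmass\<close>.\<close>

definition represents :: "(int \<Rightarrow> nat) measure \<Rightarrow> real measure \<Rightarrow> int \<Rightarrow> int \<Rightarrow> complex \<Rightarrow> bool" where
  "represents Q F t j z \<longleftrightarrow> prob_space Q \<and> sets Q = sets outputs \<and>
     (\<forall>H y. finite H \<longrightarrow> H \<subseteq> {..t} \<longrightarrow> cmass F H j z y = of_real (measure Q (cylinder H y)))"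

lemma represents_output_law: "F \<in> laws \<Longrightarrow> represents (olaw F) F t (t + 1) 0"
  unfolding represents_def using output_law_basic[of F]
  by (auto simp: bmass_def[symmetric] intro!: cmass_unaffected)

lemma represents_output_law_fixed:
  "F \<in> laws \<Longrightarrow> u \<in> {0..A} \<Longrightarrow> represents (olawx F j u) F t j (of_real u)"
  unfolding represents_def using output_law_fixed_basic[of F u j] by (auto intro!: cmass_of_real)

lemma theta_restrict: "N * (L + 1) \<le> m \<Longrightarrow> theta t N (restrict w {t - int m..t}) = theta t N w"
proof -
  assume N: "N * (L + 1) \<le> m"
  have N': "int N * blen \<le> int m" using N by (metis of_nat_1 of_nat_add of_nat_le_iff of_nat_mult)
  have "(\<Union>i<N. block t i) \<subseteq> {t - int m..t}" unfolding blocks_union using N' by auto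
  then show ?thesis unfolding theta_def by (intro prod.cong refl arg_cong2[where f="(-)"]) auto
qed

lemma theta_update: "theta t N (w(t := k)) = theta t N w"
proof -
  have "t \<notin> block t i" if "i < N" for i
    using blocks_union[of t N] that by (auto dest: equalityD1)
  then show ?thesis unfolding theta_def by (intro prod.cong refl arg_cong2[where f="(-)"]) auto
qed

lemma expectation_theta:
  assumes F: "F \<in> laws" and Q: "represents Q F t j z"
  shows "integrable Q (\<lambda>w. theta t N w * growth ^ w t)"
    and "(\<integral>w. theta t N w * growth ^ w t \<partial>Q) \<le> theta_const (norm z) * contraction (norm z) ^ N"
proof -
  define m where "m = N * (L + 1)"
  let ?H = "{t - int m..t}"
  have q: "prob_space Q" "sets Q = sets outputs" and n: "norm (cmass F ?H j z y) = measure Q (cylinder ?H y)" for y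
    using Q by (auto simp: represents_def)
  have N: "N * (L + 1) \<le> m" by (simp add: m_def)
  have fm: "finite_measure Q" using q(1) by (simp add: prob_space.finite_measure)
  note s = theta_sum_bound[OF F order_refl N, where t=t and j=j and z=z, unfolded n]
  have dep: "theta t N (restrict w ?H) * growth ^ (restrict w ?H) t = theta t N w * growth ^ w t" for w
    using theta_restrict[OF N] by simp
  have s': "(\<lambda>y. norm (theta t N y * growth ^ y t * measure Q (cylinder ?H y))) summable_on PiE ?H (\<lambda>_. UNIV)"
    using s(1) theta_bounds growth_ge by simp
  note w = window_expectation[OF fm q(2) _ dep s']
  show "integrable Q (\<lambda>w. theta t N w * growth ^ w t)" by (rule w(1)) simp
  show "(\<integral>w. theta t N w * growth ^ w t \<partial>Q) \<le> theta_const (norm z) * contraction (norm z) ^ N"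
    using s(2) infsumI[OF w(2)] by simp
qed

lemma info_restrict: "info F t m (restrict w {t - int m..t}) = info F t m w"
  unfolding info_def by (intro arg_cong[where f="\<lambda>v. - ln v"] cprob_cong) auto

lemma expectation_info:
  assumes F: "F \<in> laws" and Q: "represents Q F t j z"
  shows "integrable Q (info F t m)" and "exp_info F t m j z = of_real (\<integral>w. info F t m w \<partial>Q)"
proof -
  let ?H = "{t - int m..t}"
  have q: "prob_space Q" "sets Q = sets outputs" and n: "cmass F ?H j z y = of_real (measure Q (cylinder ?H y))" for y
    using Q by (auto simp: represents_def)
  have fm: "finite_measure Q" using q(1) by (simp add: prob_space.finite_measure)
  have "(\<lambda>y. norm (of_real (info F t m y) * cmass F ?H j z y)) summable_on PiE ?H (\<lambda>_. UNIV)"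
    by (rule info_cmass_summable[OF F]) auto
  then have s: "(\<lambda>y. norm (info F t m y * measure Q (cylinder ?H y))) summable_on PiE ?H (\<lambda>_. UNIV)"
    by (simp add: n norm_mult abs_mult)
  note w = window_expectation[OF fm q(2) _ info_restrict s]
  show "integrable Q (info F t m)" by (rule w(1)) simp
  have "((\<lambda>y. complex_of_real (info F t m y * measure Q (cylinder ?H y))) has_sum of_real (\<integral>w. info F t m w \<partial>Q)) (PiE ?H (\<lambda>_. UNIV))"
    by (rule has_sum_of_real[OF w(2)]) simp
  from infsumI[OF this] show "exp_info F t m j z = of_real (\<integral>w. info F t m w \<partial>Q)"
    unfolding exp_info_def window_def n by simp
qed

text \<open>The expectations are geometrically small, so the series of the factors has finite
  expectation and converges almost surely.\<close>

lemma AE_theta_tendsto_0: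
  assumes F: "F \<in> laws"
  shows "AE w in olaw F. (\<lambda>N. theta t N w) \<longlonglongrightarrow> 0"
proof -
  let ?P = "olaw F"
  note R = represents_output_law[OF F, of t] and s = output_law_basic(2)[OF F]
  have c: "0 < contraction 0" "contraction 0 < 1" using contraction_bounds[of 0] by auto
  have m: "(\<lambda>w. ennreal (theta t N w)) \<in> borel_measurable ?P" for N
  proof -
    have "theta t N \<in> borel_measurable ?P"
    proof (rule measurable_finite_dependence)
      show "theta t N (restrict w {t - int (N * (L + 1))..t}) = theta t N w" for w
        by (rule theta_restrict[OF order_refl])
    qed (simp_all add: measurable_output_coord[OF s])
    then show ?thesis by simp
  qed
  have b: "(\<integral>\<^sup>+w. ennreal (theta t N w) \<partial>?P) \<le> ennreal (theta_const 0 * contraction 0 ^ N)" for N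
  proof -
    have "(\<integral>\<^sup>+w. ennreal (theta t N w) \<partial>?P) \<le> (\<integral>\<^sup>+w. ennreal (theta t N w * growth ^ w t) \<partial>?P)"
    proof (intro nn_integral_mono ennreal_leI)
      fix w
      have "theta t N w * 1 \<le> theta t N w * growth ^ w t"
        by (rule mult_left_mono) (use theta_bounds growth_ge in \<open>auto simp: one_le_power\<close>)
      then show "theta t N w \<le> theta t N w * growth ^ w t" by simp
    qed
    also have "\<dots> = ennreal (\<integral>w. theta t N w * growth ^ w t \<partial>?P)"
      by (rule nn_integral_eq_integral[OF expectation_theta(1)[OF F R]]) (use theta_bounds growth_ge in auto)
    also have "\<dots> \<le> ennreal (theta_const 0 * contraction 0 ^ N)"
      using expectation_theta(2)[OF F R, of N] by (intro ennreal_leI) simp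
    finally show ?thesis .
  qed
  have "(\<integral>\<^sup>+w. (\<Sum>N. ennreal (theta t N w)) \<partial>?P) = (\<Sum>N. \<integral>\<^sup>+w. ennreal (theta t N w) \<partial>?P)"
    by (rule nn_integral_suminf[OF m])
  also have "\<dots> \<le> (\<Sum>N. ennreal (theta_const 0 * contraction 0 ^ N))" by (intro suminf_le b) auto
  also have "\<dots> = ennreal (\<Sum>N. theta_const 0 * contraction 0 ^ N)"
    by (rule suminf_ennreal2) (use c theta_const_pos[of 0] in \<open>auto intro!: summable_mult summable_geometric\<close>)
  finally have "(\<integral>\<^sup>+w. (\<Sum>N. ennreal (theta t N w)) \<partial>?P) \<noteq> \<infinity>" by (auto simp: top_unique)
  then have "AE w in ?P. (\<Sum>N. ennreal (theta t N w)) \<noteq> \<infinity>"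
    by (intro nn_integral_PInf_AE) (use m in auto)
  then show ?thesis
  proof eventually_elim
    case (elim w)
    then have "summable (\<lambda>N. theta t N w)" by (intro summable_suminf_not_top) (use theta_bounds in auto)
    then show ?case by (rule summable_LIMSEQ_zero)
  qed
qed

text \<open>Clamping to [0, 1] keeps the candidate bounded on the null set of paths where the limit
  may fail to exist.\<close>

definition pcond :: "real measure \<Rightarrow> int \<Rightarrow> nat \<Rightarrow> (int \<Rightarrow> nat) \<Rightarrow> real" where
  "pcond F t k w = max 0 (min 1 (lim (\<lambda>m. cprob F t m (w(t := k)))))"

text \<open>\<open>theta t N\<close> does not involve the output at \<open>t\<close>, so one path
  with vanishing factors gives convergence for every value \<open>k\<close> at once.\<close>

lemma pcond_tendsto:
  assumes F: "F \<in> laws" and th: "(\<lambda>N. theta t N w) \<longlonglongrightarrow> 0"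
  shows "(\<lambda>m. cprob F t m (w(t := k))) \<longlonglongrightarrow> pcond F t k w" and "lbound k \<le> pcond F t k w"
proof -
  let ?c = "\<lambda>m. cprob F t m (w(t := k))"
  have "Cauchy ?c"
  proof (rule metric_CauchyI)
    fix e :: real assume "e > 0"
    then obtain N where "\<forall>n\<ge>N. norm (theta t n w - 0) < e / 4" using LIMSEQ_D[OF th, of "e / 4"] by auto
    then have N: "theta t N w < e / 4" using theta_bounds(1)[of t N w] by auto
    define M where "M = N * (L + 1)"
    have *: "dist (?c m) (?c M) < e / 2" if "m \<ge> M" for m
    proof -
      have "\<bar>?c m - ?c M\<bar> \<le> theta t N (w(t := k)) * (?c m + ?c M)"
        by (rule cprob_forgetting[OF F]) (use that in \<open>auto simp: M_def\<close>)
      also have "\<dots> \<le> theta t N w * (1 + 1)"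
        unfolding theta_update by (intro mult_left_mono add_mono cprob_bounds(4)[OF F] theta_bounds)
      finally show ?thesis using N by (simp add: dist_real_def)
    qed
    show "\<exists>M. \<forall>m\<ge>M. \<forall>n\<ge>M. dist (?c m) (?c n) < e"
    proof (intro exI[of _ M] allI impI)
      fix m n assume "m \<ge> M" "n \<ge> M"
      then show "dist (?c m) (?c n) < e" using * by (meson dist_triangle_half_l)
    qed
  qed
  then have l: "?c \<longlonglongrightarrow> lim ?c" using Cauchy_convergent_iff convergent_LIMSEQ_iff by blast
  have lb: "lbound k \<le> lim ?c"
    by (rule tendsto_lowerbound[OF l]) (use cprob_bounds(1)[OF F, of "w(t := k)" t] in \<open>auto intro!: always_eventually\<close>)
  have "lim ?c \<le> 1"
    by (rule tendsto_upperbound[OF l]) (use cprob_bounds(4)[OF F] in \<open>auto intro!: always_eventually\<close>)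
  then have e: "pcond F t k w = lim ?c" using lb lbound_pos[of k] by (simp add: pcond_def)
  show "?c \<longlonglongrightarrow> pcond F t k w" unfolding e by (rule l)
  show "lbound k \<le> pcond F t k w" unfolding e by (rule lb)
qed

lemma past_subalgebra: "F \<in> laws \<Longrightarrow> subalgebra (olaw F) (past t)"
proof -
  assume F: "F \<in> laws"
  note b = output_law_basic[OF F]
  have "sets (past t) \<subseteq> sets (olaw F)"
    unfolding past_def by (rule sets_image_in_sets[OF b(3) measurable_restrict_past[OF b(2)]])
  then show ?thesis by (simp add: subalgebra_def past_def b(3))
qed

lemma pcond_measurable_past: "F \<in> laws \<Longrightarrow> pcond F t k \<in> borel_measurable (past t)"
proof -
  have "(\<lambda>w. cprob F t m (w(t := k))) \<in> borel_measurable (past t)" for m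
  proof (rule measurable_finite_dependence[of "{t - int m..<t}"])
    fix w
    show "cprob F t m ((restrict w {t - int m..<t})(t := k)) = cprob F t m (w(t := k))"
      by (rule cprob_cong) auto
  qed (auto intro: past_coord)
  then show ?thesis unfolding pcond_def[abs_def]
    by (intro borel_measurable_max borel_measurable_min borel_measurable_const borel_measurable_lim_metric)
qed

lemma pcond_bounds: "0 \<le> pcond F t k w" "pcond F t k w \<le> 1"
  by (auto simp: pcond_def)

text \<open>The defining property of the conditional probability, tested on events of finitely many
  past outputs: it holds exactly for every finite history long enough to contain \<open>J\<close>,
  and passes to the limit by dominated convergence.\<close>

lemma pcond_box:
  fixes E :: "int \<Rightarrow> nat set"
  assumes F: "F \<in> laws" and J: "finite J" "J \<subseteq> {..<t}"
  defines "S \<equiv> {w. \<forall>i\<in>J. w i \<in> E i}"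
  shows "measure (olaw F) (S \<inter> {w. w t = k}) = (\<integral>w. indicator S w * pcond F t k w \<partial>olaw F)"
proof -
  let ?P = "olaw F"
  note b = output_law_basic[OF F]
  interpret prob_space ?P by (rule b(1))
  \<comment> \<open>The baseline restricted to the event that the output at \<open>t\<close> is
    \<open>k\<close>; its cylinder masses are those of the history times the finite-history
    conditional probability.\<close>
  let ?Q = "density ?P (indicator {w. w t = k})"
  have St: "{w. w t = k} \<in> sets ?P"
  proof -
    have "{w. w t = k} = cylinder {t} (\<lambda>_. k)" by (auto simp: cylinder_def)
    then show ?thesis using cylinder_sets[of "{t}"] b(2) by simp
  qed
  have Q: "sets ?Q = sets outputs" using b by simp
  have eQ: "emeasure ?Q X = emeasure ?P (X \<inter> {w. w t = k})" if "X \<in> sets ?P" for X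
    using that St by (simp add: emeasure_density indicator_inter_arith[symmetric] Int_commute)
  have U: "UNIV \<in> sets ?P" using sets.top[of ?P] b(3) by simp
  have fQ: "finite_measure ?Q"
    by (rule finite_measureI) (use eQ[OF U] in \<open>simp add: b(3)\<close>)
  have Qm: "measure ?Q X = measure ?P (X \<inter> {w. w t = k})" if "X \<in> sets ?P" for X
    using eQ[OF that] by (simp add: measure_def)
  have SS: "S \<in> sets ?P"
  proof -
    have "(indicator S :: _ \<Rightarrow> real) \<in> borel_measurable ?P"
      by (rule measurable_finite_dependence[OF J(1) measurable_output_coord[OF b(2)]]) (auto simp: S_def indicator_def)
    then show ?thesis using b(3) by (simp add: borel_measurable_indicator_iff)
  qed
  obtain m0 where m0: "J \<subseteq> {t - int m0..<t}"
  proof (cases "J = {}")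
    case False
    have "J \<subseteq> {t - int (nat (t - Min J))..<t}"
    proof
      fix i assume i: "i \<in> J"
      then have "Min J \<le> i" "i < t" using Min_le[OF J(1) i] J(2) by auto
      then show "i \<in> {t - int (nat (t - Min J))..<t}" by auto
    qed
    then show ?thesis by (rule that)
  qed (use that[of 0] in auto)
  have fin: "(\<integral>w. indicator S w * cprob F t m (w(t := k)) \<partial>?P) = measure ?P (S \<inter> {w. w t = k})" if "m \<ge> m0" for m
  proof -
    let ?H = "{t - int m..<t}" let ?c = "\<lambda>w. cprob F t m (w(t := k))"
    have JH: "J \<subseteq> ?H" using m0 that by auto
    have dS: "indicator S (restrict w ?H) = (indicator S w :: real)" for w
    proof -
      have "(\<forall>i\<in>J. (restrict w ?H) i \<in> E i) \<longleftrightarrow> (\<forall>i\<in>J. w i \<in> E i)"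
        by (rule ball_cong) (use JH in auto)
      then show ?thesis by (simp add: S_def indicator_def)
    qed
    have dc: "?c (restrict w ?H) = ?c w" for w by (rule cprob_cong) auto
    have eq: "?c y * measure ?P (cylinder ?H y) = measure ?Q (cylinder ?H y)" for y
    proof -
      have "bmass F ?H (y(t := k)) = bmass F ?H y"
        unfolding bmass_def cylinder_def by (intro arg_cong[where f="measure _"]) auto
      then have "?c y * bmass F ?H y = bmass F {t - int m..t} (y(t := k))"
        unfolding cprob_def using bmass_bounds(3)[OF F, of ?H y] by simp
      moreover have "cylinder {t - int m..t} (y(t := k)) = cylinder ?H y \<inter> {w. w t = k}"
        unfolding insert_hist by (auto simp: cylinder_def)
      moreover have "cylinder ?H y \<in> sets ?P" using cylinder_sets[of ?H y] b(2) by simp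
      ultimately show ?thesis using Qm by (simp add: bmass_def)
    qed
    have tot: "(\<lambda>y. measure M (cylinder ?H y)) summable_on PiE ?H (\<lambda>_. UNIV)" if "M = ?P" for M
    proof -
      have "norm (cmass F ?H (t + 1) 0 y) = measure M (cylinder ?H y)" for y
      proof -
        have "cmass F ?H (t + 1) 0 y = of_real (bmass F ?H y)" by (rule cmass_unaffected[OF F]) auto
        then show ?thesis using that by (simp add: bmass_def)
      qed
      then show ?thesis using cmass_summable[OF F, of ?H "t + 1" 0] by simp
    qed
    have le: "\<bar>indicator S y * ?c y * measure ?P (cylinder ?H y)\<bar> \<le> measure ?P (cylinder ?H y)" for y
    proof -
      have "\<bar>indicator S y * ?c y\<bar> \<le> 1"
        using cprob_bounds(3,4)[OF F, of t m "y(t := k)"] by (auto simp: indicator_def)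
      then show ?thesis unfolding abs_mult[of _ "measure _ _"] by (simp add: mult_left_le_one_le)
    qed
    have s1: "(\<lambda>y. norm (indicator S y * ?c y * measure ?P (cylinder ?H y))) summable_on PiE ?H (\<lambda>_. UNIV)"
      by (rule Infinite_Sum.summable_on_comparison_test[OF tot[OF refl]]) (use le in auto)
    have s2: "(\<lambda>y. norm (indicator S y * measure ?Q (cylinder ?H y))) summable_on PiE ?H (\<lambda>_. UNIV)"
      using s1 by (simp add: eq mult.assoc)
    have d1: "indicator S (restrict w ?H) * ?c (restrict w ?H) = indicator S w * ?c w" for w by (simp only: dS dc)
    have fP: "finite_measure ?P" by unfold_locales
    have "(\<integral>w. indicator S w * ?c w \<partial>?P) = (\<Sum>\<^sub>\<infinity>y\<in>PiE ?H (\<lambda>_. UNIV). indicator S y * ?c y * measure ?P (cylinder ?H y))"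
      by (rule infsumI[symmetric, OF window_expectation(2)[OF fP b(2) _ d1 s1]]) simp
    also have "\<dots> = (\<Sum>\<^sub>\<infinity>y\<in>PiE ?H (\<lambda>_. UNIV). indicator S y * measure ?Q (cylinder ?H y))"
      by (simp add: eq mult.assoc)
    also have "\<dots> = (\<integral>w. indicator S w \<partial>?Q)"
      by (rule infsumI[OF window_expectation(2)[OF fQ Q _ dS s2]]) simp
    also have "\<dots> = measure ?Q S" using SS b by (simp add: Int_absorb2)
    finally show ?thesis using Qm[OF SS] by simp
  qed
  have cm: "(\<lambda>w. cprob F t m (w(t := k))) \<in> borel_measurable ?P" for m
    by (rule measurable_finite_dependence[of "{t - int m..<t}"])
      (auto intro: measurable_output_coord[OF b(2)] cprob_cong)
  have Sm: "(indicator S :: _ \<Rightarrow> real) \<in> borel_measurable ?P" using SS by simp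
  have "(\<lambda>m. \<integral>w. indicator S w * cprob F t m (w(t := k)) \<partial>?P) \<longlonglongrightarrow> (\<integral>w. indicator S w * pcond F t k w \<partial>?P)"
  proof (rule integral_dominated_convergence[where w="\<lambda>_. 1"])
    show "(\<lambda>w. indicator S w * pcond F t k w) \<in> borel_measurable ?P"
      by (intro borel_measurable_times Sm measurable_from_subalg[OF past_subalgebra[OF F] pcond_measurable_past[OF F]])
    show "AE w in ?P. (\<lambda>m. indicator S w * cprob F t m (w(t := k))) \<longlonglongrightarrow> indicator S w * pcond F t k w"
      using AE_theta_tendsto_0[OF F, of t] by eventually_elim (intro tendsto_intros pcond_tendsto F)
    show "AE w in ?P. norm (indicator S w * cprob F t m (w(t := k))) \<le> 1" for m
      by (rule AE_I2) (use cprob_bounds(3,4)[OF F] in \<open>auto simp: indicator_def abs_of_pos\<close>)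
  qed (use cm Sm in auto)
  moreover have "(\<lambda>m. \<integral>w. indicator S w * cprob F t m (w(t := k)) \<partial>?P) \<longlonglongrightarrow> measure ?P (S \<inter> {w. w t = k})"
    by (rule tendsto_eventually) (use fin in \<open>auto intro: eventually_sequentiallyI[of m0]\<close>)
  ultimately show ?thesis by (rule LIMSEQ_unique[symmetric])
qed

text \<open>Two finite measures with densities \<open>indicator ?I\<close> and \<open>pcond\<close>
  are compared on the past. They agree on boxes by \<open>pcond_box\<close>, hence on the whole
  past, and this characterizes the conditional expectation.\<close>

lemma cond_exp_eq_pcond:
  assumes F: "F \<in> laws"
  shows "AE w in olaw F. real_cond_exp (olaw F) (past t) (indicator {v. v t = k}) w = pcond F t k w"
proof -
  let ?P = "olaw F" let ?I = "{v :: int \<Rightarrow> nat. v t = k}"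
  note b = output_law_basic[OF F]
  interpret prob_space ?P by (rule b(1))
  interpret finite_measure_subalgebra ?P "past t"
    by unfold_locales (rule past_subalgebra[OF F])
  let ?M = "\<Pi>\<^sub>M s\<in>{..<t}. count_space (UNIV :: nat set)" let ?r = "\<lambda>w :: int \<Rightarrow> nat. restrict w {..<t}"
  have It: "?I \<in> sets ?P"
  proof -
    have "?I = cylinder {t} (\<lambda>_. k)" by (auto simp: cylinder_def)
    then show ?thesis using cylinder_sets[of "{t}"] b(2) by simp
  qed
  have gm: "pcond F t k \<in> borel_measurable ?P"
    by (rule measurable_from_subalg[OF past_subalgebra[OF F] pcond_measurable_past[OF F]])
  have gi: "integrable ?P (pcond F t k)"
    by (rule integrable_const_bound[where B=1]) (use gm pcond_bounds in auto)
  have ri: "?r \<in> ?P \<rightarrow>\<^sub>M ?M" by (rule measurable_restrict_past[OF b(2)])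
  let ?Q1 = "density ?P (indicator ?I)" and ?Q2 = "density ?P (\<lambda>w. ennreal (pcond F t k w))"
  have r1: "?r \<in> ?Q1 \<rightarrow>\<^sub>M ?M" and r2: "?r \<in> ?Q2 \<rightarrow>\<^sub>M ?M" using ri by auto
  have e1: "emeasure ?Q1 X = ennreal (measure ?P (X \<inter> ?I))" if "X \<in> sets ?P" for X
    using that It by (simp add: emeasure_density indicator_inter_arith[symmetric] Int_commute emeasure_eq_measure)
  have iX: "integrable ?P (\<lambda>w. indicator X w * pcond F t k w)" if "X \<in> sets ?P" for X
    by (rule integrable_const_bound[where B=1]) (use gm pcond_bounds that in \<open>auto simp: indicator_def\<close>)
  have e2: "emeasure ?Q2 X = ennreal (\<integral>w. indicator X w * pcond F t k w \<partial>?P)" if X: "X \<in> sets ?P" for X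
  proof -
    have "emeasure ?Q2 X = (\<integral>\<^sup>+w. ennreal (indicator X w * pcond F t k w) \<partial>?P)"
      using X gm by (subst emeasure_density) (auto intro!: nn_integral_cong simp: indicator_def)
    also have "\<dots> = ennreal (\<integral>w. indicator X w * pcond F t k w \<partial>?P)"
      by (rule nn_integral_eq_integral[OF iX[OF X]]) (use pcond_bounds in auto)
    finally show ?thesis .
  qed
  \<comment> \<open>Boxes generate the product sigma-algebra and are closed under intersection, so
    agreement on them is enough for finite measures.\<close>
  have D: "distr ?Q1 ?M ?r = distr ?Q2 ?M ?r"
  proof (rule measure_eqI_PiM_infinite[where I="{..<t}" and M="\<lambda>_. count_space UNIV"])
    fix E :: "int \<Rightarrow> nat set" and J assume J: "finite J" "J \<subseteq> {..<t}"
    let ?B = "prod_emb {..<t} (\<lambda>_. count_space UNIV) J (Pi\<^sub>E J E)" let ?S = "{w. \<forall>i\<in>J. w i \<in> E i}"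
    have B: "?B \<in> sets ?M" by (rule sets_PiM_I) (use J in auto)
    have v: "?r -` ?B \<inter> space ?P = ?S" using J(2) b(3) by (auto simp: prod_emb_def PiE_iff subset_iff)
    have S: "?S \<in> sets ?P" using measurable_sets[OF ri B] v by simp
    show "emeasure (distr ?Q1 ?M ?r) ?B = emeasure (distr ?Q2 ?M ?r) ?B"
      using v B e1[OF S] e2[OF S] pcond_box[OF F J, of E k] by (simp add: emeasure_distr[OF r1] emeasure_distr[OF r2])
  next
    have U: "UNIV \<in> sets ?P" using sets.top[of ?P] b(3) by simp
    have "finite_measure ?Q1" by (rule finite_measureI) (use e1[OF U] in \<open>simp add: b(3)\<close>)
    then show "finite_measure (distr ?Q1 ?M ?r)" by (rule finite_measure.finite_measure_distr[OF _ r1])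
  qed simp_all
  show ?thesis
  proof (rule real_cond_exp_charact)
    fix X assume X: "X \<in> sets (past t)"
    have "?r \<in> UNIV \<rightarrow> space ?M" by (auto simp: space_PiM)
    from X obtain Y where Y: "Y \<in> sets ?M" "X = ?r -` Y \<inter> UNIV"
      unfolding past_def sets_vimage_algebra2[OF \<open>?r \<in> UNIV \<rightarrow> space ?M\<close>] by blast
    have XP: "X \<in> sets ?P" using X past_subalgebra[OF F, of t] by (auto simp: subalgebra_def)
    have "emeasure ?Q1 X = emeasure ?Q2 X"
      using arg_cong[OF D, of "\<lambda>M. emeasure M Y"] Y b(3) by (simp add: emeasure_distr[OF r1] emeasure_distr[OF r2])
    then have "ennreal (measure ?P (X \<inter> ?I)) = ennreal (\<integral>w. indicator X w * pcond F t k w \<partial>?P)"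
      unfolding e1[OF XP] e2[OF XP] .
    then have "measure ?P (X \<inter> ?I) = (\<integral>w. indicator X w * pcond F t k w \<partial>?P)"
      by (subst (asm) ennreal_inj) (auto intro!: integral_nonneg_AE AE_I2 mult_nonneg_nonneg pcond_bounds)
    moreover have "(\<integral>w\<in>X. indicator ?I w \<partial>?P) = measure ?P (X \<inter> ?I)"
      unfolding set_lebesgue_integral_def using XP It b(3) by (simp add: indicator_inter_arith[symmetric])
    ultimately show "(\<integral>w\<in>X. indicator ?I w \<partial>?P) = (\<integral>w\<in>X. pcond F t k w \<partial>?P)"
      by (simp add: set_lebesgue_integral_def)
  qed (use It gi pcond_measurable_past[OF F] emeasure_finite in \<open>auto simp: less_top[symmetric]\<close>)
qed

text \<open>The information density conditions on the value the path itself takes at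
  \<open>t\<close>, so the identity with \<open>pcond\<close> is needed for all values
  simultaneously; there are countably many. The positive lower bound keeps the logarithm continuous
  at the limit.\<close>

lemma info_density_tendsto:
  assumes F: "F \<in> laws"
  shows "AE w in olaw F. (\<lambda>m. info F t m w) \<longlonglongrightarrow> info_density L lam0 h F t w"
proof -
  have "AE w in olaw F. \<forall>k. real_cond_exp (olaw F) (past t) (indicator {v. v t = k}) w = pcond F t k w"
    using cond_exp_eq_pcond[OF F] by (simp add: AE_all_countable)
  then show ?thesis using AE_theta_tendsto_0[OF F, of t]
  proof eventually_elim
    case (elim w)
    have "(\<lambda>m. - ln (cprob F t m (w(t := w t)))) \<longlonglongrightarrow> - ln (pcond F t (w t) w)"
      by (intro tendsto_intros pcond_tendsto(1)[OF F elim(2)])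
        (use pcond_tendsto(2)[OF F elim(2), of "w t"] lbound_pos[of "w t"] in auto)
    then show ?case using elim(1) by (simp add: info_def[abs_def] info_density_def)
  qed
qed

text \<open>On each of the countably many events that the output at \<open>t\<close> equals
  \<open>k\<close>, the conditional expectation is the one for that fixed \<open>k\<close>.\<close>

lemma info_density_measurable:
  assumes F: "F \<in> laws"
  shows "info_density L lam0 h F t \<in> borel_measurable (olaw F)"
proof -
  have "(\<lambda>w. real_cond_exp (olaw F) (past t) (indicator {v. v t = w t}) w) \<in> borel_measurable (olaw F)"
    by (rule measurable_compose_countable[where g="\<lambda>w. w t" and f="\<lambda>k. real_cond_exp (olaw F) (past t) (indicator {v. v t = k})"])
      (auto intro: borel_measurable_cond_exp2 measurable_output_coord[OF output_law_basic(2)[OF F]])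
  then show ?thesis unfolding info_density_def[abs_def] by simp
qed

text \<open>Dominated convergence. \<open>theta t 0\<close> is an empty product, hence 1, so the
  case of no blocks in \<open>expectation_theta\<close> supplies the integrable majorant
  \<open>growth ^ w t\<close>.\<close>

lemma info_density_expectation:
  assumes F: "F \<in> laws" and Q: "represents Q F t j z" and ae: "AE w in Q. (\<lambda>m. info F t m w) \<longlonglongrightarrow> info_density L lam0 h F t w"
  shows "integrable Q (info_density L lam0 h F t)"
    and "(\<lambda>m. \<integral>w. info F t m w \<partial>Q) \<longlonglongrightarrow> (\<integral>w. info_density L lam0 h F t w \<partial>Q)"
proof -
  have s: "sets Q = sets (olaw F)" using Q output_law_basic(2)[OF F] by (simp add: represents_def)
  have m: "info_density L lam0 h F t \<in> borel_measurable Q"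
    using info_density_measurable[OF F] s by (simp cong: measurable_cong_sets)
  have mi: "info F t m \<in> borel_measurable Q" for m using expectation_info(1)[OF F Q, of m] by simp
  have dom: "integrable Q (\<lambda>w. growth_const * (theta t 0 w * growth ^ w t))"
    by (intro integrable_mult_right expectation_theta(1)[OF F Q])
  have bd: "AE w in Q. norm (info F t m w) \<le> growth_const * (theta t 0 w * growth ^ w t)" for m
    using info_bounds[OF F, where t=t and m=m] by (simp add: theta_def)
  show "integrable Q (info_density L lam0 h F t)"
    by (rule integrable_dominated_convergence[OF m mi dom ae bd])
  show "(\<lambda>m. \<integral>w. info F t m w \<partial>Q) \<longlonglongrightarrow> (\<integral>w. info_density L lam0 h F t w \<partial>Q)"
    by (rule integral_dominated_convergence[OF m mi dom ae bd])
qed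

lemma cond_ent_tendsto: "F \<in> laws \<Longrightarrow> (\<lambda>m. cond_ent F m) \<longlonglongrightarrow> entropy_rate L lam0 h F"
proof -
  assume F: "F \<in> laws"
  note R = represents_output_law[OF F, of 0]
  have "cond_ent F m = (\<integral>w. info F 0 m w \<partial>olaw F)" for m
    using expectation_info(2)[OF F R, of m] exp_info_baseline[OF F, of 0 m "0 + 1" 0] by simp
  then show ?thesis
    using info_density_expectation(2)[OF F R info_density_tendsto[OF F]] by (simp add: entropy_rate_def)
qed

text \<open>At a real symbol the finite-history functional is a difference of two honest
  expectations of \<open>info\<close>, each of which converges to that of the information
  density.\<close>

lemma Delta_of_real:
  assumes F: "F \<in> laws" and u: "u \<in> {0..A}"
  shows "integrable (olawx F 0 u) (info_density L lam0 h F (int t))"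
    and "Delta L lam0 h F t (of_real u) = of_real
      ((\<integral>w. info_density L lam0 h F (int t) w \<partial>olawx F 0 u) - (\<integral>w. info_density L lam0 h F (int t) w \<partial>olaw F))"
proof -
  note R = represents_output_law[OF F, of "int t"] and Rx = represents_output_law_fixed[OF F u, of 0 "int t"]
  note ae = info_density_tendsto[OF F, of "int t"]
  note aex = AE_output_law_fixed[OF F u ae, of 0]
  show "integrable (olawx F 0 u) (info_density L lam0 h F (int t))"
    by (rule info_density_expectation(1)[OF F Rx aex])
  have "hist_diff F (int t) m 0 (of_real u) = of_real ((\<integral>w. info F (int t) m w \<partial>olawx F 0 u) - (\<integral>w. info F (int t) m w \<partial>olaw F))" for m
    unfolding hist_diff_def expectation_info(2)[OF F Rx] expectation_info(2)[OF F R] by simp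
  moreover have "(\<lambda>m. complex_of_real ((\<integral>w. info F (int t) m w \<partial>olawx F 0 u) - (\<integral>w. info F (int t) m w \<partial>olaw F)))
    \<longlonglongrightarrow> of_real ((\<integral>w. info_density L lam0 h F (int t) w \<partial>olawx F 0 u) - (\<integral>w. info_density L lam0 h F (int t) w \<partial>olaw F))"
    by (intro tendsto_of_real tendsto_diff info_density_expectation(2)[OF F Rx aex] info_density_expectation(2)[OF F R ae])
  ultimately show "Delta L lam0 h F t (of_real u) = of_real
      ((\<integral>w. info_density L lam0 h F (int t) w \<partial>olawx F 0 u) - (\<integral>w. info_density L lam0 h F (int t) w \<partial>olaw F))"
    using LIMSEQ_unique[OF Delta_lim[OF F, of t "of_real u"]] by simp
qed

end

theorem lemma4:
  fixes L :: nat and lam0 A Pavg :: real and h :: "nat \<Rightarrow> real" and F :: "real measure"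
  assumes "lam0 > 0"
    and "h 0 > 0"
    and "\<forall>l\<le>L. h l \<ge> 0"
    and "(\<Sum>l\<le>L. h l) = 1"
    and "A \<ge> 0"
    and "Pavg \<ge> 0"
    and "F \<in> input_laws A Pavg"
  shows
    \<comment> \<open>the complexified laws are well-defined finite complex measures, analytic in the fixed symbol,
        and extend the ordinary laws with a fixed real symbol\<close>
    "(\<forall>a b j. \<forall>y\<in>window a b.
        (\<forall>z\<in>Omega L lam0 h.
           integrable (\<Pi>\<^sub>M k\<in>{a - int L..b} - {j}. F) (window_kernel L lam0 h a b j z y)) \<and>
        (\<lambda>z. fixed_prob L lam0 h F a b j z y) holomorphic_on Omega L lam0 h \<and>
        (\<forall>x\<in>{0..A}. fixed_prob L lam0 h F a b j (of_real x) y =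
           of_real (measure (output_law_fixed L lam0 h F j x) (cylinder {a..b} y)))) \<and>
     (\<forall>a b j. \<forall>z\<in>Omega L lam0 h.
        (\<lambda>y. norm (fixed_prob L lam0 h F a b j z y)) summable_on window a b) \<and>
     \<comment> \<open>the finite-block derivatives are well defined\<close>
     (\<forall>n\<ge>1.
        (\<forall>j\<in>{1 - int L..int n}. \<forall>z\<in>Omega L lam0 h.
           D_block_term L lam0 h F n j z summable_on window 1 (int n)) \<and>
        D_block L lam0 h F n holomorphic_on Omega L lam0 h \<and>
        (\<forall>x\<in>{0..A}.
           ((\<lambda>e. complex_of_real (1 / real n * block_entropy L lam0 h (mix_dirac F x e) n))
              has_vector_derivative D_block L lam0 h F n (of_real x)) (at_right 0))) \<and>
     \<comment> \<open>the finite-history functionals are well defined and analytic\<close>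
     (\<forall>t. \<forall>m\<ge>1.
        (\<forall>z\<in>Omega L lam0 h.
           Delta_hist_term L lam0 h F t m z summable_on window (int t - int m) (int t)) \<and>
        Delta_hist L lam0 h F t m holomorphic_on Omega L lam0 h) \<and>
     \<comment> \<open>convergence on compact sets\<close>
     (\<forall>K. compact K \<and> K \<subseteq> Omega L lam0 h \<longrightarrow>
        (\<forall>t. uniform_limit K (\<lambda>m. Delta_hist L lam0 h F t m) (Delta L lam0 h F t) sequentially) \<and>
        (\<Sum>t. SUP z\<in>K. ennreal (norm (Delta L lam0 h F t z))) < \<infinity> \<and>
        uniform_limit K (\<lambda>n. D_block L lam0 h F n) (h_dot L lam0 h F) sequentially) \<and>
     \<comment> \<open>each limit continues analytically the change in expected baseline information density\<close>
     (\<forall>t. Delta L lam0 h F t holomorphic_on Omega L lam0 h \<and>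
        integrable (output_law L lam0 h F) (info_density L lam0 h F (int t)) \<and>
        (\<forall>x\<in>{0..A}.
           integrable (output_law_fixed L lam0 h F 0 x) (info_density L lam0 h F (int t)) \<and>
           Delta L lam0 h F t (of_real x) = of_real
             ((\<integral>w. info_density L lam0 h F (int t) w \<partial>output_law_fixed L lam0 h F 0 x)
              - (\<integral>w. info_density L lam0 h F (int t) w \<partial>output_law L lam0 h F)))) \<and>
     \<comment> \<open>directional derivative of the entropy rate\<close>
     (\<forall>x\<in>{0..A}.
        ((\<lambda>e. complex_of_real (entropy_rate L lam0 h (mix_dirac F x e)))
           has_vector_derivative h_dot L lam0 h F (of_real x)) (at_right 0))"
proof -
  interpret C: poisson_channel L lam0 A h
    by unfold_locales (use assms in auto)
  have F: "F \<in> laws_upto A"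
    using assms(7) by (auto simp: input_laws_def laws_upto_def)
  have sub: "f holomorphic_on UNIV \<Longrightarrow> f holomorphic_on Omega L lam0 h" for f :: "complex \<Rightarrow> complex"
    by (rule holomorphic_on_subset) auto
  have fp: "(\<lambda>z. fixed_prob L lam0 h F a b j z y) = (\<lambda>z. C.cmass F {a..b} j z y)" for a b j y
    by (rule ext) (rule C.fixed_prob_eq(1)[OF F])
  have A1: "integrable (\<Pi>\<^sub>M k\<in>{a - int L..b} - {j}. F) (window_kernel L lam0 h a b j z y)" for a b j z y
    by (rule C.fixed_prob_eq(2)[OF F])
  have A2: "(\<lambda>z. fixed_prob L lam0 h F a b j z y) holomorphic_on Omega L lam0 h" for a b j y
    unfolding fp by (intro sub C.cmass_holomorphic F) simp
  have A3: "fixed_prob L lam0 h F a b j (of_real x) y = of_real (measure (output_law_fixed L lam0 h F j x) (cylinder {a..b} y))"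
    if "x \<in> {0..A}" for a b j x y
    unfolding C.fixed_prob_eq(1)[OF F] by (rule C.cmass_of_real[OF F that]) simp
  have A4: "(\<lambda>y. norm (fixed_prob L lam0 h F a b j z y)) summable_on window a b" for a b j z
    unfolding C.fixed_prob_eq(1)[OF F] window_def by (rule C.cmass_summable[OF F]) simp
  have B1: "D_block_term L lam0 h F n j z summable_on window 1 (int n)" for n j z
    by (rule has_sum_imp_summable[OF C.D_block_term_has_sum[OF F]])
  have B2: "D_block L lam0 h F n holomorphic_on Omega L lam0 h" for n
    by (intro sub C.D_block_holomorphic F)
  have B3: "((\<lambda>e. complex_of_real (1 / real n * block_entropy L lam0 h (mix_dirac F x e) n))
      has_vector_derivative D_block L lam0 h F n (of_real x)) (at_right 0)" if "n \<ge> 1" "x \<in> {0..A}" for n x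
    by (rule C.block_entropy_right_derivative[OF F that(2,1)])
  have C1: "Delta_hist_term L lam0 h F t m z summable_on window (int t - int m) (int t)" for t m z
    by (rule has_sum_imp_summable[OF C.Delta_hist_term_has_sum[OF F]])
  have C2: "Delta_hist L lam0 h F t m holomorphic_on Omega L lam0 h" for t m
  proof -
    have "Delta_hist L lam0 h F t m = (\<lambda>z. C.hist_diff F (int t) m 0 z)" by (rule ext) (rule C.Delta_hist_eq[OF F])
    then show ?thesis using sub[OF C.hist_diff_holomorphic[OF F]] by simp
  qed
  have D: "(\<forall>t. uniform_limit K (\<lambda>m. Delta_hist L lam0 h F t m) (Delta L lam0 h F t) sequentially) \<and>
      (\<Sum>t. SUP z\<in>K. ennreal (norm (Delta L lam0 h F t z))) < \<infinity> \<and>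
      uniform_limit K (\<lambda>n. D_block L lam0 h F n) (h_dot L lam0 h F) sequentially" if K: "compact K" for K
  proof -
    \<comment> \<open>Compactness supplies a radius, and the constants of all estimates depend on
      \<open>z\<close> only through it.\<close>
    obtain B where B: "B > 0" "\<And>z. z \<in> K \<Longrightarrow> norm z \<le> B"
      using compact_imp_bounded[OF K] unfolding bounded_pos by blast
    show ?thesis
      using C.Delta_uniform_limit[OF F B(2)] C.Delta_sum_finite[OF F B(2)] C.D_block_uniform_limit[OF F B(2)] B(1) by auto
  qed
  have E1: "Delta L lam0 h F t holomorphic_on Omega L lam0 h" for t
    by (intro sub C.Delta_holomorphic F)
  have E2: "integrable (output_law L lam0 h F) (info_density L lam0 h F (int t))" for t
    by (rule C.info_density_expectation(1)[OF F C.represents_output_law[OF F] C.info_density_tendsto[OF F]])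
  have G: "((\<lambda>e. complex_of_real (entropy_rate L lam0 h (mix_dirac F x e)))
      has_vector_derivative h_dot L lam0 h F (of_real x)) (at_right 0)" if "x \<in> {0..A}" for x
    by (rule C.entropy_limit_right_derivative[OF F that C.cond_ent_tendsto])
  show ?thesis
    using A1 A2 A3 A4 B1 B2 B3 C1 C2 D E1 E2 C.Delta_of_real[OF F] G
    by (intro conjI allI ballI impI) simp_all
qed

end
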